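(* Let $(k_n)$ be a sequence of positive integers, and for each $n\in\mathbb{N}$ let $\beta_n$ be a flow on $M_{k_n}$. Let $h_n\in M_{k_n}$ be self-adjoint with $\beta_{n,t}=\mathrm{Ad}\,e^{ith_n}$ for $t\in\mathbb{R}$ and $\mathrm{Spec}(h_n)\cap(-\infty,0]=\{0\}$. Let $B=\prod_n M_{k_n}$, $I=\bigoplus_n M_{k_n}$, $\beta_t=\prod_n\beta_{n,t}$, let $B_\beta$ be the maximal C$^*$-subalgebra of $B$ on which $\beta$ is continuous, and denote again by $\beta$ the induced flow on $B_\beta/I$. For $c>0$ set $$\ell_n(c)=\max\{b-a-c\ :\ [a,b]\subset \mathrm{Spec}(h_n)+[0,c]\}.$$ Then the flow $\beta$ on $B_\beta/I$ is approximately inner if and only if the sequence $(\ell_n(c))_n$ is bounded for every $c>0$.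
   Context: A flow on a C$^*$-algebra $A$ is a strongly continuous one-parameter group $\alpha=(\alpha_t)_{t\in\mathbb{R}}$ of $*$-automorphisms of $A$ (i.e. $t\mapsto\alpha_t(x)$ is norm continuous for each $x\in A$). $\mathrm{Ad}\,u(x)=uxu^*$. $B=\prod_n M_{k_n}$ is the C$^*$-algebra of bounded sequences $x=(x_n)$ with $x_n\in M_{k_n}$, $I=\bigoplus_n M_{k_n}$ is the ideal of sequences with $\|x_n\|\to 0$, and $\beta_t(x)=(\beta_{n,t}(x_n))_n$. $B_\beta=\{x\in B: t\mapsto\beta_t(x)\text{ is norm continuous}\}$; it contains $I$, which is $\beta$-invariant, so $\beta$ induces a flow on $B_\beta/I$. For sets of reals, $S+[0,c]=\{s+r: s\in S,\ 0\le r\le c\}$; the condition on $h_n$ says that the smallest eigenvalue of $h_n$ is $0$. A flow $\alpha$ on a (not necessarily separable) unital C$^*$-algebra $A$ is approximately inner if there is a net $(b_\nu)$ of self-adjoint elements of $A$ such that $\mathrm{Ad}\,e^{itb_\nu}(x)\to\alpha_t(x)$ in norm, uniformly for $t$ in every bounded interval, for each $x\in A$. *)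

theory Defs
  imports
    "HOL-Analysis.L2_Norm"
    "HOL-Algebra.QuotRing"
    "HOL-Algebra.Module"
    "Jordan_Normal_Form.Schur_Decomposition"
    "Jordan_Normal_Form.Spectral_Radius"
begin

text \<open>
  The algebras are represented by records extending those of HOL-Algebra by the involution and the
  norm. None of the definitions below assumes the C*-axioms; they are meant for unital C*-algebras.
\<close>

record 'a star_alg = "(complex, 'a) module" +
  star :: "'a \<Rightarrow> 'a"
  nrm :: "'a \<Rightarrow> real"

text \<open>The element \<open>exp b\<close>: the norm limit of the exponential series. The limit is unique and exists
  in a C*-algebra.\<close>

definition alg_exp :: "('a, 'm) star_alg_scheme \<Rightarrow> 'a \<Rightarrow> 'a" where
  "alg_exp A b = (THE y. y \<in> carrier A \<and>
     (\<lambda>N. nrm A ((\<Oplus>\<^bsub>A\<^esub>j\<in>{..<N}. (1 / fact j) \<odot>\<^bsub>A\<^esub> (b [^]\<^bsub>A\<^esub> (j::nat))) \<ominus>\<^bsub>A\<^esub> y)) \<longlonglongrightarrow> 0)"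

definition Ad :: "('a, 'm) star_alg_scheme \<Rightarrow> 'a \<Rightarrow> 'a \<Rightarrow> 'a" where
  "Ad A u x = u \<otimes>\<^bsub>A\<^esub> x \<otimes>\<^bsub>A\<^esub> star A u"

definition selfadjoint :: "('a, 'm) star_alg_scheme \<Rightarrow> 'a \<Rightarrow> bool" where
  "selfadjoint A b \<longleftrightarrow> b \<in> carrier A \<and> star A b = b"

definition star_automorphism :: "('a, 'm) star_alg_scheme \<Rightarrow> ('a \<Rightarrow> 'a) \<Rightarrow> bool" where
  "star_automorphism A f \<longleftrightarrow> f \<in> ring_iso A A \<and>
     (\<forall>x\<in>carrier A. f (star A x) = star A (f x) \<and> (\<forall>z. f (z \<odot>\<^bsub>A\<^esub> x) = z \<odot>\<^bsub>A\<^esub> f x))"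

definition norm_continuous_orbit ::
    "('a, 'm) star_alg_scheme \<Rightarrow> (real \<Rightarrow> 'a \<Rightarrow> 'a) \<Rightarrow> 'a \<Rightarrow> bool" where
  "norm_continuous_orbit A \<alpha> x \<longleftrightarrow>
     (\<forall>s. ((\<lambda>t. nrm A (\<alpha> t x \<ominus>\<^bsub>A\<^esub> \<alpha> s x)) \<longlongrightarrow> 0) (at s))"

definition flow :: "('a, 'm) star_alg_scheme \<Rightarrow> (real \<Rightarrow> 'a \<Rightarrow> 'a) \<Rightarrow> bool" where
  "flow A \<alpha> \<longleftrightarrow>
     (\<forall>t. star_automorphism A (\<alpha> t)) \<and>
     (\<forall>x\<in>carrier A. \<alpha> 0 x = x) \<and>
     (\<forall>s t. \<forall>x\<in>carrier A. \<alpha> (s + t) x = \<alpha> s (\<alpha> t x)) \<and>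
     (\<forall>x\<in>carrier A. norm_continuous_orbit A \<alpha> x)"

definition directed :: "'i set \<Rightarrow> ('i \<Rightarrow> 'i \<Rightarrow> bool) \<Rightarrow> bool" where
  "directed D R \<longleftrightarrow> D \<noteq> {} \<and> (\<forall>i\<in>D. R i i) \<and>
     (\<forall>i\<in>D. \<forall>j\<in>D. \<forall>k\<in>D. R i j \<longrightarrow> R j k \<longrightarrow> R i k) \<and>
     (\<forall>i\<in>D. \<forall>j\<in>D. \<exists>k\<in>D. R i k \<and> R j k)"

definition implements_flow ::
    "('a, 'm) star_alg_scheme \<Rightarrow> (real \<Rightarrow> 'a \<Rightarrow> 'a) \<Rightarrow> 'i set \<Rightarrow> ('i \<Rightarrow> 'i \<Rightarrow> bool) \<Rightarrow> ('i \<Rightarrow> 'a) \<Rightarrow> bool" where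
  "implements_flow A \<alpha> D R b \<longleftrightarrow> directed D R \<and> (\<forall>\<nu>\<in>D. selfadjoint A (b \<nu>)) \<and>
     (\<forall>x\<in>carrier A. \<forall>S T :: real. \<forall>\<epsilon>>0. \<exists>\<nu>\<^sub>0\<in>D. \<forall>\<nu>\<in>D. R \<nu>\<^sub>0 \<nu> \<longrightarrow>
        (\<forall>t\<in>{S..T}. nrm A (Ad A (alg_exp A ((\<i> * complex_of_real t) \<odot>\<^bsub>A\<^esub> b \<nu>)) x \<ominus>\<^bsub>A\<^esub> \<alpha> t x) < \<epsilon>))"

text \<open>
  HOL cannot quantify existentially over the type of indices of the net. The index type
  \<open>'a set \<times> 'a\<close> chosen here loses no generality, as the lemma following the definition shows.
\<close>

definition approximately_inner ::
    "('a, 'm) star_alg_scheme \<Rightarrow> (real \<Rightarrow> 'a \<Rightarrow> 'a) \<Rightarrow> bool" where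
  "approximately_inner A \<alpha> \<longleftrightarrow>
     (\<exists>(D :: ('a set \<times> 'a) set) R b. implements_flow A \<alpha> D R b)"

lemma approximately_inner_any_net:
  fixes D :: "'i set"
  assumes "implements_flow A \<alpha> D R b"
  shows "approximately_inner A \<alpha>"
proof -
  let ?tl = "\<lambda>\<nu>. b ` {\<mu>\<in>D. R \<nu> \<mu>}"
  define D' where "D' = {(S, y). \<exists>\<nu>\<in>D. S = ?tl \<nu> \<and> y \<in> S}"
  define R' :: "('a set \<times> 'a) \<Rightarrow> ('a set \<times> 'a) \<Rightarrow> bool" where "R' = (\<lambda>p q. fst q \<subseteq> fst p)"
  have dir: "directed D R" and sa: "\<And>\<nu>. \<nu> \<in> D \<Longrightarrow> selfadjoint A (b \<nu>)"
    and lim: "\<And>x S T \<epsilon>. x \<in> carrier A \<Longrightarrow> \<epsilon> > (0::real) \<Longrightarrow> \<exists>\<nu>\<^sub>0\<in>D. \<forall>\<nu>\<in>D. R \<nu>\<^sub>0 \<nu> \<longrightarrow>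
        (\<forall>t\<in>{S..T::real}. nrm A (Ad A (alg_exp A ((\<i> * complex_of_real t) \<odot>\<^bsub>A\<^esub> b \<nu>)) x \<ominus>\<^bsub>A\<^esub> \<alpha> t x) < \<epsilon>)"
    using assms by (auto simp: implements_flow_def)
  have ne: "D \<noteq> {}" and refl: "\<And>i. i \<in> D \<Longrightarrow> R i i"
    and trans: "\<And>i j k. i \<in> D \<Longrightarrow> j \<in> D \<Longrightarrow> k \<in> D \<Longrightarrow> R i j \<Longrightarrow> R j k \<Longrightarrow> R i k"
    and ub: "\<And>i j. i \<in> D \<Longrightarrow> j \<in> D \<Longrightarrow> \<exists>k\<in>D. R i k \<and> R j k"
    using dir unfolding directed_def by blast+
  have mem: "(?tl \<nu>, b \<nu>) \<in> D'" if "\<nu> \<in> D" for \<nu>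
    unfolding D'_def using that refl[OF that] by blast
  have "directed D' R'"
    unfolding directed_def
  proof (intro conjI ballI impI)
    show "D' \<noteq> {}" using mem ne by blast
  next
    fix p q assume "p \<in> D'" "q \<in> D'"
    then obtain i j where ij: "i \<in> D" "j \<in> D" "fst p = ?tl i" "fst q = ?tl j"
      by (auto simp: D'_def)
    then obtain k where k: "k \<in> D" "R i k" "R j k"
      using ub by blast
    have tr: "R i m \<and> R j m" if "m \<in> D" "R k m" for m
      using trans[OF ij(1) k(1) that(1)] trans[OF ij(2) k(1) that(1)] k that by blast
    then have "?tl k \<subseteq> ?tl i" "?tl k \<subseteq> ?tl j" by blast+
    then show "\<exists>r\<in>D'. R' p r \<and> R' q r"
      using ij(3,4) unfolding R'_def
      by (intro bexI[OF _ mem[OF k(1)]]) (simp only: fst_conv)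
  next
    fix p q r assume "R' p q" "R' q r"
    then show "R' p r" unfolding R'_def by (rule subset_trans[rotated])
  qed (simp add: R'_def)
  moreover have "selfadjoint A (snd p)" if "p \<in> D'" for p
    using that sa by (auto simp: D'_def)
  moreover have "\<exists>p\<^sub>0\<in>D'. \<forall>p\<in>D'. R' p\<^sub>0 p \<longrightarrow>
        (\<forall>t\<in>{S..T}. nrm A (Ad A (alg_exp A ((\<i> * complex_of_real t) \<odot>\<^bsub>A\<^esub> snd p)) x \<ominus>\<^bsub>A\<^esub> \<alpha> t x) < \<epsilon>)"
    if x: "x \<in> carrier A" and e: "\<epsilon> > 0" for x S T and \<epsilon> :: real
  proof -
    obtain \<nu>\<^sub>0 where n: "\<nu>\<^sub>0 \<in> D" and *: "\<And>\<nu>. \<nu> \<in> D \<Longrightarrow> R \<nu>\<^sub>0 \<nu> \<Longrightarrow>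
        (\<forall>t\<in>{S..T}. nrm A (Ad A (alg_exp A ((\<i> * complex_of_real t) \<odot>\<^bsub>A\<^esub> b \<nu>)) x \<ominus>\<^bsub>A\<^esub> \<alpha> t x) < \<epsilon>)"
      using lim[OF x e, of S T] by blast
    show ?thesis
    proof (rule bexI[OF _ mem[OF n]], intro ballI impI)
      fix p t assume p: "p \<in> D'" "R' (?tl \<nu>\<^sub>0, b \<nu>\<^sub>0) p" and t: "t \<in> {S..T}"
      then have "snd p \<in> fst p" "fst p \<subseteq> ?tl \<nu>\<^sub>0" unfolding D'_def R'_def by auto
      then have "snd p \<in> ?tl \<nu>\<^sub>0" by (rule subsetD[rotated])
      then obtain \<nu> where "\<nu> \<in> D" "R \<nu>\<^sub>0 \<nu>" "snd p = b \<nu>" by blast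
      then show "nrm A (Ad A (alg_exp A ((\<i> * complex_of_real t) \<odot>\<^bsub>A\<^esub> snd p)) x \<ominus>\<^bsub>A\<^esub> \<alpha> t x) < \<epsilon>"
        using *[of \<nu>] t by simp
    qed
  qed
  ultimately have "implements_flow A \<alpha> D' R' snd"
    unfolding implements_flow_def by blast
  then show ?thesis unfolding approximately_inner_def by blast
qed

text \<open>The quotient by an ideal \<open>I\<close>; elements are cosets. A map of \<open>A\<close> which respects cosets of \<open>I\<close>
  induces \<open>coset_map A I f\<close> (as with multiplication in \<^const>\<open>FactRing\<close>).\<close>

definition coset_map ::
    "('a, 'm) star_alg_scheme \<Rightarrow> 'a set \<Rightarrow> ('a \<Rightarrow> 'a) \<Rightarrow> 'a set \<Rightarrow> 'a set" where
  "coset_map A I f X = (\<Union>x\<in>X. I +>\<^bsub>A\<^esub> f x)"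

definition quotient_alg :: "('a, 'm) star_alg_scheme \<Rightarrow> 'a set \<Rightarrow> 'a set star_alg" where
  "quotient_alg A I = ring.extend (A Quot I)
     \<lparr> smult = (\<lambda>z. coset_map A I (\<lambda>x. z \<odot>\<^bsub>A\<^esub> x)),
       star = coset_map A I (star A),
       nrm = (\<lambda>X. INF x\<in>X. nrm A x) \<rparr>"

definition product_alg :: "(nat \<Rightarrow> ('a, 'm) star_alg_scheme) \<Rightarrow> (nat \<Rightarrow> 'a) star_alg" where
  "product_alg A =
     \<lparr> carrier = {x. (\<forall>n. x n \<in> carrier (A n)) \<and> bdd_above (range (\<lambda>n. nrm (A n) (x n)))},
       monoid.mult = (\<lambda>x y n. x n \<otimes>\<^bsub>A n\<^esub> y n),
       one = (\<lambda>n. \<one>\<^bsub>A n\<^esub>),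
       zero = (\<lambda>n. \<zero>\<^bsub>A n\<^esub>),
       add = (\<lambda>x y n. x n \<oplus>\<^bsub>A n\<^esub> y n),
       smult = (\<lambda>z x n. z \<odot>\<^bsub>A n\<^esub> x n),
       star = (\<lambda>x n. star (A n) (x n)),
       nrm = (\<lambda>x. SUP n. nrm (A n) (x n)) \<rparr>"

definition c0_direct_sum :: "(nat \<Rightarrow> ('a, 'm) star_alg_scheme) \<Rightarrow> (nat \<Rightarrow> 'a) set" where
  "c0_direct_sum A = {x. (\<forall>n. x n \<in> carrier (A n)) \<and> (\<lambda>n. nrm (A n) (x n)) \<longlonglongrightarrow> 0}"

definition product_flow :: "(nat \<Rightarrow> real \<Rightarrow> 'a \<Rightarrow> 'a) \<Rightarrow> real \<Rightarrow> (nat \<Rightarrow> 'a) \<Rightarrow> nat \<Rightarrow> 'a" where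
  "product_flow \<beta> t x = (\<lambda>n. \<beta> n t (x n))"

definition continuous_part ::
    "('a, 'm) star_alg_scheme \<Rightarrow> (real \<Rightarrow> 'a \<Rightarrow> 'a) \<Rightarrow> ('a, 'm) star_alg_scheme" where
  "continuous_part A \<alpha> = A\<lparr>carrier := {x \<in> carrier A. norm_continuous_orbit A \<alpha> x}\<rparr>"

definition vec_norm2 :: "complex vec \<Rightarrow> real" where
  "vec_norm2 v = L2_set (\<lambda>i. cmod (v $ i)) {..<dim_vec v}"

definition mat_op_norm :: "complex mat \<Rightarrow> real" where
  "mat_op_norm M = (SUP v\<in>{v \<in> carrier_vec (dim_col M). vec_norm2 v \<le> 1}. vec_norm2 (M *\<^sub>v v))"

definition matrix_alg :: "nat \<Rightarrow> complex mat star_alg" where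
  "matrix_alg k = ring_mat TYPE(complex) k
     \<lparr> smult = (\<cdot>\<^sub>m), star = mat_adjoint, nrm = mat_op_norm \<rparr>"

definition real_spectrum :: "complex mat \<Rightarrow> real set" where
  "real_spectrum M = {s. complex_of_real s \<in> spectrum M}"

text \<open>The maximum is written with \<^const>\<open>Greatest\<close>, since \<^const>\<open>Max\<close> is for finite sets only.
  It is attained when the spectrum is nonempty and \<open>c \<ge> 0\<close>: then \<open>Spec + [0,c]\<close> is a nonempty finite
  union of compact intervals.\<close>

definition ell :: "complex mat \<Rightarrow> real \<Rightarrow> real" where
  "ell h c = (GREATEST l. \<exists>a b. a \<le> b \<and> {a..b} \<subseteq> {s + r | s r. s \<in> real_spectrum h \<and> 0 \<le> r \<and> r \<le> c}
                \<and> l = b - a - c)"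

end

theory Submission
  imports Defs "HOL-Analysis.Henstock_Kurzweil_Integration" "HOL-Algebra.Subrings"
begin

text \<open>
  Suppose that all \<open>\<ell>\<^sub>n(c)\<close> are at most \<open>K\<close>. Subtracting from every eigenvalue of \<open>h\<^sub>n\<close> the left end point of
  its component in \<open>Spec(h\<^sub>n) + [0,c]\<close> gives self-adjoint \<open>b\<^sub>n\<close> with \<open>0 \<le> b\<^sub>n \<le> K\<close>. Eigenvalues at distance
  at most \<open>c\<close> lie in the same component, so \<open>Ad e\<^bsup>itb\<^esup>\<close> agrees with \<open>\<beta>\<^sub>t\<close>, for all \<open>t\<close>, on matrices whose entries
  vanish between eigenvalues at distance \<open>\<ge> c\<close>. By averaging and Schur multipliers, an element
  with norm continuous orbit is approximated by such band matrices, uniformly in \<open>n\<close>, as \<open>c\<close> grows.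

  Conversely, if \<open>\<ell>\<^sub>n(c)\<close> is large, then \<open>Spec(h\<^sub>n)\<close> contains a long chain with gaps in \<open>[24c, 25c]\<close>.
  The shift \<open>S\<^sub>n\<close> along the chain satisfies \<open>\<beta>\<^sub>t(S\<^sub>n) \<approx> e\<^bsup>24ict\<^esup> S\<^sub>n\<close> for \<open>0 \<le> t \<le> 1/(24c)\<close>. If a bounded \<open>b\<close>
  approximately implements \<open>\<beta>\<close> on \<open>S\<close>, then \<open>S\<^sub>n\<close> raises the spectral subspaces of \<open>b\<^sub>n\<close> by \<open>12c\<close> while
  keeping at least half of the norm, and this can be repeated only about \<open>\<parallel>b\<parallel>/(6c)\<close> times. So the
  length of the chain is bounded.
\<close>

unbundle no vec_syntax
hide_const (open) Finite_Cartesian_Product.mat Finite_Cartesian_Product.vec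
  Finite_Cartesian_Product.row Finite_Cartesian_Product.rows Finite_Cartesian_Product.column
hide_type (open) Finite_Cartesian_Product.vec

section \<open>Norm bounds for matrices\<close>

text \<open>The matrices \<open>h n\<close> need not be bounded in \<open>n\<close>, so in general
  they are no element of the product, whereas an implementing element has to be bounded. The sizes
  \<open>k n\<close> need not be bounded either. Hence no estimate may sum over single entries: each
  passage from a kernel in an eigenbasis to a norm goes through a Schur multiplier, or a Sylvester
  equation, whose bound is free of the size. The quotient norm is a limit superior over the blocks.
  Approximation in it gives, for each single \<open>t\<close>, an estimate for almost all
  \<open>n\<close>, where the exceptional \<open>n\<close> depend on \<open>t\<close>. A finite grid
  of times and a Lipschitz bound uniform in \<open>n\<close> repair this. The numbers for the chain:
  gaps in \<open>[24c, 25c]\<close> cause a phase error of at most \<open>1/24\<close> up to time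
  \<open>1/(24c)\<close>, and the same error is granted to \<open>b\<close>. The sum
  \<open>1/12\<close> is tripled by the raising estimate. The resulting \<open>1/4\<close> is half
  of the half of the norm that survives a shift, so the same situation is met again after each
  shift.\<close>

abbreviation expi :: "real \<Rightarrow> complex" where
  "expi x \<equiv> exp (\<i> * complex_of_real x)"

abbreviation sqsum :: "nat \<Rightarrow> (nat \<Rightarrow> complex) \<Rightarrow> real" where
  "sqsum n v \<equiv> \<Sum>i<n. (cmod (v i))\<^sup>2"

text \<open>The symmetric right-hand side makes the bound additive under direct sums and integrals of
  vectors, and by homogeneity it is equivalent to the bound by \<open>K * norm v * norm w\<close>.\<close>

definition form_bd :: "nat \<Rightarrow> (nat \<Rightarrow> nat \<Rightarrow> complex) \<Rightarrow> real \<Rightarrow> bool" where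
  "form_bd n X K \<longleftrightarrow> (\<forall>v w. cmod (\<Sum>i<n. \<Sum>j<n. cnj (v i) * X i j * w j)
     \<le> K * ((sqsum n v) + (sqsum n w)) / 2)"

lemma form_bdD:
  "form_bd n X K \<Longrightarrow> cmod (\<Sum>i<n. \<Sum>j<n. cnj (v i) * X i j * w j)
     \<le> K * ((sqsum n v) + (sqsum n w)) / 2"
  unfolding form_bd_def by blast

text \<open>Testing the form on \<open>v = X w\<close> and on \<open>w\<close> scaled by
  \<open>K\<close> makes the two squares in the symmetric bound comparable:
  \<open>s \<le> (s + K\<^sup>2 W) / 2\<close>, and half of \<open>s\<close> is absorbed.\<close>

lemma form_bd_imp_apply_le:
  assumes X: "form_bd n X K" and K: "K \<ge> 0"
  shows "(\<Sum>i<n. (cmod (\<Sum>j<n. X i j * w j))\<^sup>2) \<le> K\<^sup>2 * (sqsum n w)"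
proof -
  define y where "y i = (\<Sum>j<n. X i j * w j)" for i
  define s where "s = (sqsum n y)"
  define W where "W = (sqsum n w)"
  have s0: "s \<ge> 0" unfolding s_def by (intro sum_nonneg) auto
  have "(\<Sum>i<n. \<Sum>j<n. cnj (y i) * X i j * (complex_of_real c * w j)) = complex_of_real (c * s)" for c
  proof -
    have "(\<Sum>i<n. \<Sum>j<n. cnj (y i) * X i j * (complex_of_real c * w j)) =
        (\<Sum>i<n. complex_of_real c * (cnj (y i) * y i))"
    proof (rule sum.cong[OF refl])
      fix i
      have "complex_of_real c * (cnj (y i) * y i) = (\<Sum>j<n. complex_of_real c * (cnj (y i) * (X i j * w j)))"
        unfolding sum_distrib_left[symmetric] y_def ..
      then show "(\<Sum>j<n. cnj (y i) * X i j * (complex_of_real c * w j)) = complex_of_real c * (cnj (y i) * y i)"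
        by (simp add: mult_ac)
    qed
    also have "\<dots> = complex_of_real (c * s)"
      unfolding s_def by (simp add: sum_distrib_left complex_norm_square[symmetric] mult_ac)
    finally show ?thesis .
  qed
  then have 1: "cmod (complex_of_real (c * s)) \<le> K * (s + (\<Sum>j<n. (cmod (complex_of_real c * w j))\<^sup>2)) / 2" for c
    using form_bdD[OF X, of y "\<lambda>j. complex_of_real c * w j"] unfolding s_def by simp
  have 2: "(\<Sum>j<n. (cmod (complex_of_real c * w j))\<^sup>2) = c\<^sup>2 * W" for c
    unfolding W_def by (simp add: norm_mult power_mult_distrib sum_distrib_left)
  have "s \<le> K\<^sup>2 * W"
  proof (cases "K = 0")
    case True
    then show ?thesis using 1[of 1] s0 by simp
  next
    case False
    then have "K > 0" using K by simp
    have "K * s \<le> K * (s + K\<^sup>2 * W) / 2" using 1[of K] s0 K 2[of K] by (simp add: norm_mult)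
    then have "s \<le> (s + K\<^sup>2 * W) / 2" using \<open>K > 0\<close> by (simp add: field_simps)
    then show ?thesis by simp
  qed
  then show ?thesis unfolding s_def W_def y_def .
qed

text \<open>The weighted inequality \<open>2 a b \<le> K a\<^sup>2 + b\<^sup>2 / K\<close>, used in
  each coordinate, produces the symmetric bound.\<close>

lemma form_bdI_apply:
  assumes K: "K \<ge> 0"
    and le: "\<And>w. (\<Sum>i<n. (cmod (\<Sum>j<n. X i j * w j))\<^sup>2) \<le> K\<^sup>2 * (sqsum n w)"
  shows "form_bd n X K"
  unfolding form_bd_def
proof (intro allI)
  fix v w :: "nat \<Rightarrow> complex"
  define y where "y i = (\<Sum>j<n. X i j * w j)" for i
  define W where "W = (sqsum n w)"
  define V where "V = (sqsum n v)"
  have V0: "V \<ge> 0" "W \<ge> 0" unfolding V_def W_def by (auto intro: sum_nonneg)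
  have y: "(sqsum n y) \<le> K\<^sup>2 * W" using le unfolding y_def W_def .
  have "cmod (\<Sum>i<n. \<Sum>j<n. cnj (v i) * X i j * w j) = cmod (\<Sum>i<n. cnj (v i) * y i)"
    unfolding y_def by (simp add: sum_distrib_left mult_ac)
  also have "\<dots> \<le> (\<Sum>i<n. cmod (v i) * cmod (y i))"
    by (rule order_trans[OF norm_sum]) (simp add: norm_mult)
  also have "\<dots> \<le> K * (V + W) / 2"
  proof (cases "K = 0")
    case True
    then have "(sqsum n y) = 0" using y by (intro antisym sum_nonneg) auto
    then have "\<forall>i<n. y i = 0" by (simp add: sum_nonneg_eq_0_iff)
    then show ?thesis using True by simp
  next
    case False
    then have Kp: "K > 0" using K by simp
    have "(\<Sum>i<n. cmod (v i) * cmod (y i)) \<le> (\<Sum>i<n. (K * (cmod (v i))\<^sup>2 + (cmod (y i))\<^sup>2 / K) / 2)"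
    proof (rule sum_mono)
      fix i
      have "0 \<le> (K * cmod (v i) - cmod (y i))\<^sup>2 / K" using Kp by simp
      also have "\<dots> = K * (cmod (v i))\<^sup>2 + (cmod (y i))\<^sup>2 / K - 2 * (cmod (v i) * cmod (y i))"
        using Kp by (simp add: power2_eq_square field_simps)
      finally show "cmod (v i) * cmod (y i) \<le> (K * (cmod (v i))\<^sup>2 + (cmod (y i))\<^sup>2 / K) / 2" by simp
    qed
    also have "\<dots> = (K * V + (sqsum n y) / K) / 2"
      unfolding V_def by (simp add: sum_divide_distrib sum.distrib sum_distrib_left add_divide_distrib)
    also have "\<dots> \<le> (K * V + K\<^sup>2 * W / K) / 2"
      using y Kp by (intro divide_right_mono add_left_mono) auto
    also have "\<dots> = K * (V + W) / 2" using Kp by (simp add: power2_eq_square field_simps)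
    finally show ?thesis .
  qed
  finally show "cmod (\<Sum>i<n. \<Sum>j<n. cnj (v i) * X i j * w j)
     \<le> K * ((sqsum n v) + (sqsum n w)) / 2"
    unfolding V_def W_def .
qed

lemma form_bd_mono: "form_bd n X K \<Longrightarrow> K \<le> L \<Longrightarrow> form_bd n X L"
  unfolding form_bd_def
  by (meson add_nonneg_nonneg divide_right_mono mult_right_mono order_trans sum_nonneg
      zero_le_numeral zero_le_power2)

lemma form_bd_cong: "(\<And>i j. i < n \<Longrightarrow> j < n \<Longrightarrow> X i j = Y i j) \<Longrightarrow> form_bd n X K = form_bd n Y K"
  unfolding form_bd_def by simp

lemma form_bd_add:
  assumes "form_bd n X K" "form_bd n Y L"
  shows "form_bd n (\<lambda>i j. X i j + Y i j) (K + L)"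
  unfolding form_bd_def
proof (intro allI)
  fix v w :: "nat \<Rightarrow> complex"
  have "cmod (\<Sum>i<n. \<Sum>j<n. cnj (v i) * (X i j + Y i j) * w j) \<le>
      cmod (\<Sum>i<n. \<Sum>j<n. cnj (v i) * X i j * w j) + cmod (\<Sum>i<n. \<Sum>j<n. cnj (v i) * Y i j * w j)"
    by (rule order_trans[OF _ norm_triangle_ineq]) (simp add: algebra_simps sum.distrib)
  also have "\<dots> \<le> (K + L) * ((sqsum n v) + (sqsum n w)) / 2"
    using form_bdD[OF assms(1), of v w] form_bdD[OF assms(2), of v w]
    by (simp add: algebra_simps add_divide_distrib)
  finally show "cmod (\<Sum>i<n. \<Sum>j<n. cnj (v i) * (X i j + Y i j) * w j)
    \<le> (K + L) * ((sqsum n v) + (sqsum n w)) / 2" .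
qed

lemma form_bd_scale:
  assumes "form_bd n X K"
  shows "form_bd n (\<lambda>i j. a * X i j) (cmod a * K)"
  unfolding form_bd_def
proof (intro allI)
  fix v w :: "nat \<Rightarrow> complex"
  have "(\<Sum>i<n. \<Sum>j<n. cnj (v i) * (a * X i j) * w j) = a * (\<Sum>i<n. \<Sum>j<n. cnj (v i) * X i j * w j)"
    by (simp add: sum_distrib_left mult_ac)
  then show "cmod (\<Sum>i<n. \<Sum>j<n. cnj (v i) * (a * X i j) * w j)
    \<le> cmod a * K * ((sqsum n v) + (sqsum n w)) / 2"
    using mult_left_mono[OF form_bdD[OF assms, of v w], of "cmod a"] by (simp add: norm_mult mult_ac)
qed

text \<open>Diagonal contractions on either side are absorbed into the two test vectors, whose norms
  do not grow.\<close>

lemma form_bd_diag_mult: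
  assumes X: "form_bd n X K" and K: "K \<ge> 0"
    and f: "\<And>i. i < n \<Longrightarrow> cmod (f i) \<le> 1" and g: "\<And>j. j < n \<Longrightarrow> cmod (g j) \<le> 1"
  shows "form_bd n (\<lambda>i j. f i * X i j * g j) K"
  unfolding form_bd_def
proof (intro allI)
  fix v w :: "nat \<Rightarrow> complex"
  have "(\<Sum>i<n. \<Sum>j<n. cnj (v i) * (f i * X i j * g j) * w j) =
      (\<Sum>i<n. \<Sum>j<n. cnj (cnj (f i) * v i) * X i j * (g j * w j))"
    by (simp add: mult_ac)
  moreover have "K * ((\<Sum>i<n. (cmod (cnj (f i) * v i))\<^sup>2) + (\<Sum>j<n. (cmod (g j * w j))\<^sup>2)) / 2
     \<le> K * ((sqsum n v) + (sqsum n w)) / 2"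
    using f g K
    by (intro divide_right_mono mult_left_mono add_mono sum_mono power_mono)
       (auto simp: norm_mult mult_left_le_one_le)
  ultimately show "cmod (\<Sum>i<n. \<Sum>j<n. cnj (v i) * (f i * X i j * g j) * w j)
    \<le> K * ((sqsum n v) + (sqsum n w)) / 2"
    using form_bdD[OF X, of "\<lambda>i. cnj (f i) * v i" "\<lambda>j. g j * w j"] by simp
qed

lemma form_bd_diag:
  assumes "\<And>i. i < n \<Longrightarrow> cmod (f i) \<le> K" "K \<ge> 0"
  shows "form_bd n (\<lambda>i j. if i = j then f i else 0) K"
proof (rule form_bdI_apply[OF assms(2)])
  fix w :: "nat \<Rightarrow> complex"
  have "(\<Sum>i<n. (cmod (\<Sum>j<n. (if i = j then f i else 0) * w j))\<^sup>2) = (\<Sum>i<n. (cmod (f i) * cmod (w i))\<^sup>2)"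
    by (intro sum.cong refl) (simp add: if_distrib[of "\<lambda>x. x * _"] sum.delta norm_mult cong: if_cong)
  also have "\<dots> \<le> (\<Sum>i<n. (K * cmod (w i))\<^sup>2)"
    using assms by (intro sum_mono power_mono mult_right_mono) auto
  finally show "(\<Sum>i<n. (cmod (\<Sum>j<n. (if i = j then f i else 0) * w j))\<^sup>2) \<le> K\<^sup>2 * (sqsum n w)"
    by (simp add: power_mult_distrib sum_distrib_left)
qed

lemma form_bd_mult:
  assumes "form_bd n X K" "form_bd n Y L" "K \<ge> 0" "L \<ge> 0"
  shows "form_bd n (\<lambda>i j. \<Sum>l<n. X i l * Y l j) (K * L)"
proof (rule form_bdI_apply)
  fix w :: "nat \<Rightarrow> complex"
  have "(\<Sum>j<n. (\<Sum>l<n. X i l * Y l j) * w j) = (\<Sum>l<n. X i l * (\<Sum>j<n. Y l j * w j))" for i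
    by (simp add: sum_distrib_left sum_distrib_right mult_ac) (rule sum.swap)
  then have "(\<Sum>i<n. (cmod (\<Sum>j<n. (\<Sum>l<n. X i l * Y l j) * w j))\<^sup>2) \<le>
      K\<^sup>2 * (\<Sum>l<n. (cmod (\<Sum>j<n. Y l j * w j))\<^sup>2)"
    using form_bd_imp_apply_le[OF assms(1,3)] by simp
  also have "\<dots> \<le> K\<^sup>2 * (L\<^sup>2 * (sqsum n w))"
    using form_bd_imp_apply_le[OF assms(2,4)] by (intro mult_left_mono) auto
  finally show "(\<Sum>i<n. (cmod (\<Sum>j<n. (\<Sum>l<n. X i l * Y l j) * w j))\<^sup>2) \<le>
      (K * L)\<^sup>2 * (sqsum n w)"
    by (simp add: power_mult_distrib mult.assoc)
qed (use assms in simp)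

lemma form_bd_cnj_swap:
  assumes "form_bd n X K"
  shows "form_bd n (\<lambda>i j. cnj (X j i)) K"
  unfolding form_bd_def
proof (intro allI)
  fix v w :: "nat \<Rightarrow> complex"
  have "(\<Sum>i<n. \<Sum>j<n. cnj (v i) * cnj (X j i) * w j) = cnj (\<Sum>j<n. \<Sum>i<n. cnj (w j) * X j i * v i)"
    by (subst sum.swap) (simp add: mult_ac)
  then have "cmod (\<Sum>i<n. \<Sum>j<n. cnj (v i) * cnj (X j i) * w j) = cmod (\<Sum>j<n. \<Sum>i<n. cnj (w j) * X j i * v i)"
    by (simp only: complex_mod_cnj)
  then show "cmod (\<Sum>i<n. \<Sum>j<n. cnj (v i) * cnj (X j i) * w j)
    \<le> K * ((sqsum n v) + (sqsum n w)) / 2"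
    using form_bdD[OF assms, of w v] by (simp add: add.commute)
qed

text \<open>A crude bound that grows with \<open>n\<close>. It only serves to show that the supremum
  in \<open>mat_op_norm\<close> is finite and that vectors of norm 0 have images of norm 0.\<close>

lemma form_bd_entries: "form_bd n X (\<Sum>i<n. \<Sum>j<n. cmod (X i j))"
  unfolding form_bd_def
proof (intro allI)
  fix v w :: "nat \<Rightarrow> complex"
  let ?S = "(sqsum n v) + (sqsum n w)"
  have le: "cmod (v i) * cmod (w j) \<le> ?S / 2" if "i < n" "j < n" for i j
  proof -
    have "(cmod (v i))\<^sup>2 \<le> (sqsum n v)" "(cmod (w j))\<^sup>2 \<le> (sqsum n w)"
      using that member_le_sum[of i "{..<n}" "\<lambda>i. (cmod (v i))\<^sup>2"] member_le_sum[of j "{..<n}" "\<lambda>i. (cmod (w i))\<^sup>2"]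
      by auto
    moreover have "2 * (cmod (v i) * cmod (w j)) \<le> (cmod (v i))\<^sup>2 + (cmod (w j))\<^sup>2"
      using sum_squares_bound[of "cmod (v i)" "cmod (w j)"] by (simp add: mult.assoc)
    ultimately show ?thesis by simp
  qed
  have "cmod (\<Sum>i<n. \<Sum>j<n. cnj (v i) * X i j * w j) \<le> (\<Sum>i<n. \<Sum>j<n. cmod (X i j) * (cmod (v i) * cmod (w j)))"
    by (intro order_trans[OF norm_sum] sum_mono) (simp add: norm_mult mult_ac)
  also have "\<dots> \<le> (\<Sum>i<n. \<Sum>j<n. cmod (X i j) * (?S / 2))"
    using le by (intro sum_mono mult_left_mono) auto
  also have "\<dots> = (\<Sum>i<n. \<Sum>j<n. cmod (X i j)) * (?S / 2)"
    unfolding sum_distrib_right ..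
  finally show "cmod (\<Sum>i<n. \<Sum>j<n. cnj (v i) * X i j * w j) \<le> (\<Sum>i<n. \<Sum>j<n. cmod (X i j)) * ?S / 2"
    by simp
qed

section \<open>From bounded forms to the operator norm\<close>

lemma vec_norm2_sq: "(vec_norm2 v)\<^sup>2 = (\<Sum>i<dim_vec v. (cmod (v $ i))\<^sup>2)"
  unfolding vec_norm2_def L2_set_def by (simp add: sum_nonneg)

lemma vec_norm2_nonneg: "vec_norm2 v \<ge> 0"
  unfolding vec_norm2_def by simp

lemma mult_mat_vec_nth:
  assumes "A \<in> carrier_mat n n" "v \<in> carrier_vec n" "i < n"
  shows "(A *\<^sub>v v) $ i = (\<Sum>j<n. A $$ (i,j) * v $ j)"
  using assms by (simp add: scalar_prod_def atLeast0LessThan)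

lemma form_bd_imp_vec_norm2_le:
  assumes A: "A \<in> carrier_mat n n" and bd: "form_bd n (\<lambda>i j. A $$ (i,j)) K" and K: "K \<ge> 0"
    and v: "v \<in> carrier_vec n"
  shows "vec_norm2 (A *\<^sub>v v) \<le> K * vec_norm2 v"
proof (rule power2_le_imp_le)
  show "(vec_norm2 (A *\<^sub>v v))\<^sup>2 \<le> (K * vec_norm2 v)\<^sup>2"
    using form_bd_imp_apply_le[OF bd K, of "\<lambda>j. v $ j"] A v
    by (simp add: vec_norm2_sq power_mult_distrib mult_mat_vec_nth[OF A v] del: index_mult_mat_vec)
qed (simp add: K vec_norm2_nonneg)

lemma vec_norm2_smult: "vec_norm2 (a \<cdot>\<^sub>v v) = cmod a * vec_norm2 v"
  unfolding vec_norm2_def L2_set_right_distrib[OF norm_ge_zero]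
  by (intro L2_set_cong) (auto simp: norm_mult)

lemma mat_op_norm_bdd:
  assumes A: "A \<in> carrier_mat n n"
  shows "bdd_above ((\<lambda>v. vec_norm2 (A *\<^sub>v v)) ` {v \<in> carrier_vec (dim_col A). vec_norm2 v \<le> 1})"
proof (rule bdd_aboveI2)
  fix v assume v: "v \<in> {v \<in> carrier_vec (dim_col A). vec_norm2 v \<le> 1}"
  let ?K = "\<Sum>i<n. \<Sum>j<n. cmod (A $$ (i,j))"
  have K: "?K \<ge> 0" by (intro sum_nonneg) auto
  have "vec_norm2 (A *\<^sub>v v) \<le> ?K * vec_norm2 v"
    using form_bd_imp_vec_norm2_le[OF A form_bd_entries K] v A by auto
  also have "\<dots> \<le> ?K" using v K by (simp add: mult_left_le)
  finally show "vec_norm2 (A *\<^sub>v v) \<le> ?K" .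
qed

lemma mat_op_norm_nonneg:
  assumes A: "A \<in> carrier_mat n n"
  shows "mat_op_norm A \<ge> 0"
proof -
  have "0 \<le> vec_norm2 (A *\<^sub>v 0\<^sub>v n)" by (rule vec_norm2_nonneg)
  also have "\<dots> \<le> mat_op_norm A"
    unfolding mat_op_norm_def
    by (rule cSUP_upper[OF _ mat_op_norm_bdd[OF A]]) (use A in \<open>auto simp: vec_norm2_def L2_set_def\<close>)
  finally show ?thesis .
qed

lemma vec_norm2_mult_le:
  assumes A: "A \<in> carrier_mat n n" and v: "v \<in> carrier_vec n"
  shows "vec_norm2 (A *\<^sub>v v) \<le> mat_op_norm A * vec_norm2 v"
proof (cases "vec_norm2 v = 0")
  case True
  have K: "(\<Sum>i<n. \<Sum>j<n. cmod (A $$ (i,j))) \<ge> 0" by (intro sum_nonneg) auto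
  show ?thesis
    using form_bd_imp_vec_norm2_le[OF A form_bd_entries K v] True by simp
next
  case False
  define c where "c = vec_norm2 v"
  have c: "c > 0" using False vec_norm2_nonneg[of v] unfolding c_def by simp
  let ?u = "complex_of_real (1 / c) \<cdot>\<^sub>v v"
  have u: "?u \<in> carrier_vec n" "vec_norm2 ?u = 1"
    using v c unfolding vec_norm2_smult by (auto simp: c_def[symmetric] norm_divide)
  have "vec_norm2 (A *\<^sub>v ?u) \<le> mat_op_norm A"
    unfolding mat_op_norm_def
    by (rule cSUP_upper[OF _ mat_op_norm_bdd[OF A]]) (use A u in auto)
  also have "A *\<^sub>v ?u = complex_of_real (1 / c) \<cdot>\<^sub>v (A *\<^sub>v v)"
    using A v by (simp add: mult_mat_vec)
  also have "vec_norm2 \<dots> = vec_norm2 (A *\<^sub>v v) / c"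
    using c by (simp add: vec_norm2_smult norm_divide)
  finally show ?thesis using c unfolding c_def by (simp add: pos_divide_le_eq)
qed

lemma form_bd_mat_op_norm:
  assumes A: "A \<in> carrier_mat n n"
  shows "form_bd n (\<lambda>i j. A $$ (i,j)) (mat_op_norm A)"
proof (rule form_bdI_apply[OF mat_op_norm_nonneg[OF A]])
  fix w :: "nat \<Rightarrow> complex"
  have "(vec_norm2 (A *\<^sub>v vec n w))\<^sup>2 \<le> (mat_op_norm A * vec_norm2 (vec n w))\<^sup>2"
    by (intro power_mono vec_norm2_mult_le[OF A] vec_norm2_nonneg) auto
  then show "(\<Sum>i<n. (cmod (\<Sum>j<n. A $$ (i,j) * w j))\<^sup>2) \<le> (mat_op_norm A)\<^sup>2 * (sqsum n w)"
    using A by (simp add: vec_norm2_sq power_mult_distrib mult_mat_vec_nth[OF A, of "vec n w"] del: index_mult_mat_vec)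
qed

text \<open>The bridge between \<open>form_bd\<close> and the norm of the algebra. Estimates are
  proved for forms, where integrals and multipliers are easy to handle, and are carried over
  here.\<close>

lemma mat_op_norm_le_iff:
  assumes A: "A \<in> carrier_mat n n" and K: "K \<ge> 0"
  shows "mat_op_norm A \<le> K \<longleftrightarrow> form_bd n (\<lambda>i j. A $$ (i,j)) K"
proof
  show "form_bd n (\<lambda>i j. A $$ (i,j)) K" if "mat_op_norm A \<le> K"
    using form_bd_mat_op_norm[OF A] that by (rule form_bd_mono)
next
  assume bd: "form_bd n (\<lambda>i j. A $$ (i,j)) K"
  show "mat_op_norm A \<le> K"
    unfolding mat_op_norm_def
  proof (rule cSUP_least)
    have "0\<^sub>v n \<in> {v \<in> carrier_vec (dim_col A). vec_norm2 v \<le> 1}"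
      using A by (auto simp: vec_norm2_def L2_set_def)
    then show "{v \<in> carrier_vec (dim_col A). vec_norm2 v \<le> 1} \<noteq> {}" by blast
    fix v assume v: "v \<in> {v \<in> carrier_vec (dim_col A). vec_norm2 v \<le> 1}"
    then have "vec_norm2 (A *\<^sub>v v) \<le> K * vec_norm2 v"
      using form_bd_imp_vec_norm2_le[OF A bd K] A by auto
    also have "\<dots> \<le> K" using v K by (simp add: mult_left_le)
    finally show "vec_norm2 (A *\<^sub>v v) \<le> K" .
  qed
qed

lemma mat_op_norm_le_if_form_bd:
  "A \<in> carrier_mat n n \<Longrightarrow> K \<ge> 0 \<Longrightarrow> form_bd n (\<lambda>i j. A $$ (i,j)) K \<Longrightarrow> mat_op_norm A \<le> K"
  using mat_op_norm_le_iff by blast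

lemma mat_op_norm_add:
  assumes A: "A \<in> carrier_mat n n" and B: "B \<in> carrier_mat n n"
  shows "mat_op_norm (A + B) \<le> mat_op_norm A + mat_op_norm B"
proof (rule mat_op_norm_le_if_form_bd)
  show "form_bd n (\<lambda>i j. (A + B) $$ (i,j)) (mat_op_norm A + mat_op_norm B)"
    using form_bd_add[OF form_bd_mat_op_norm[OF A] form_bd_mat_op_norm[OF B]] A B
    by (subst form_bd_cong[where Y = "\<lambda>i j. A $$ (i,j) + B $$ (i,j)"]) auto
qed (use A B mat_op_norm_nonneg in auto)

lemma mat_op_norm_smult_le:
  assumes A: "A \<in> carrier_mat n n"
  shows "mat_op_norm (a \<cdot>\<^sub>m A) \<le> cmod a * mat_op_norm A"
proof (rule mat_op_norm_le_if_form_bd)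
  show "form_bd n (\<lambda>i j. (a \<cdot>\<^sub>m A) $$ (i,j)) (cmod a * mat_op_norm A)"
    using form_bd_scale[OF form_bd_mat_op_norm[OF A]] A
    by (subst form_bd_cong[where Y = "\<lambda>i j. a * A $$ (i,j)"]) auto
qed (use A mat_op_norm_nonneg in auto)

lemma mat_op_norm_uminus:
  assumes A: "A \<in> carrier_mat n n"
  shows "mat_op_norm (- A) = mat_op_norm A"
proof -
  have *: "mat_op_norm (- B) \<le> mat_op_norm B" if "B \<in> carrier_mat n n" for B
  proof -
    have "- B = (-1) \<cdot>\<^sub>m B" using that by auto
    then show ?thesis using mat_op_norm_smult_le[OF that, of "-1"] by simp
  qed
  have "- (- A) = A" using A by auto
  then show ?thesis using *[OF A] *[of "- A"] A by (auto intro: antisym)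
qed

lemma mat_op_norm_mult:
  assumes A: "A \<in> carrier_mat n n" and B: "B \<in> carrier_mat n n"
  shows "mat_op_norm (A * B) \<le> mat_op_norm A * mat_op_norm B"
proof (rule mat_op_norm_le_if_form_bd)
  show "form_bd n (\<lambda>i j. (A * B) $$ (i,j)) (mat_op_norm A * mat_op_norm B)"
    using form_bd_mult[OF form_bd_mat_op_norm[OF A] form_bd_mat_op_norm[OF B]] A B mat_op_norm_nonneg
    by (subst form_bd_cong[where Y = "\<lambda>i j. \<Sum>l<n. A $$ (i,l) * B $$ (l,j)"])
       (auto simp: scalar_prod_def atLeast0LessThan)
qed (use A B mat_op_norm_nonneg in auto)

lemma mat_op_norm_zero: "mat_op_norm (0\<^sub>m n n) = 0"
proof (rule antisym)
  show "mat_op_norm (0\<^sub>m n n) \<le> 0"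
    by (rule mat_op_norm_le_if_form_bd[of _ n]) (auto simp: form_bd_def)
qed (rule mat_op_norm_nonneg[of _ n], simp)

lemma mat_op_norm_diff_triangle:
  assumes "A \<in> carrier_mat n n" "B \<in> carrier_mat n n" "C \<in> carrier_mat n n"
  shows "mat_op_norm (A - C) \<le> mat_op_norm (A - B) + mat_op_norm (B - C)"
proof -
  have "A - C = (A - B) + (B - C)" using assms by auto
  then show ?thesis
    using mat_op_norm_add[OF minus_carrier_mat[OF assms(2), of A] minus_carrier_mat[OF assms(3), of B]] by simp
qed

lemma mat_op_norm_diff_commute:
  assumes "A \<in> carrier_mat n n" "B \<in> carrier_mat n n"
  shows "mat_op_norm (A - B) = mat_op_norm (B - A)"
proof -
  have "A - B = - (B - A)" using assms by auto
  then show ?thesis using mat_op_norm_uminus[OF minus_carrier_mat[OF assms(1), of B]] by simp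
qed

lemma mat_op_norm_eq_0:
  assumes A: "A \<in> carrier_mat n n" and "mat_op_norm A = 0"
  shows "A = 0\<^sub>m n n"
proof (rule eq_matI)
  fix i j assume "i < dim_row (0\<^sub>m n n :: complex mat)" "j < dim_col (0\<^sub>m n n :: complex mat)"
  then have ij: "i < n" "j < n" by auto
  have "(\<Sum>i<n. (cmod (\<Sum>l<n. A $$ (i,l) * (if l = j then 1 else 0)))\<^sup>2) \<le> 0"
    using form_bd_imp_apply_le[OF form_bd_mat_op_norm[OF A] mat_op_norm_nonneg[OF A]] assms(2) by force
  then have "(\<Sum>i<n. (cmod (A $$ (i,j)))\<^sup>2) \<le> 0"
    using ij by (simp add: if_distrib[of "\<lambda>x. _ * x"] sum.delta cong: if_cong)
  then have "(\<Sum>i<n. (cmod (A $$ (i,j)))\<^sup>2) = 0" by (intro antisym sum_nonneg) auto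
  then show "A $$ (i,j) = 0\<^sub>m n n $$ (i,j)" using ij by (simp add: sum_nonneg_eq_0_iff)
qed (use A in auto)

section \<open>Adjoints and unitary diagonalisation\<close>

lemma mat_adjoint_dim [simp]:
  "dim_row (mat_adjoint A) = dim_col A" "dim_col (mat_adjoint A) = dim_row A"
  unfolding mat_adjoint_def by auto

lemma mat_adjoint_carrier [simp]: "A \<in> carrier_mat n m \<Longrightarrow> mat_adjoint A \<in> carrier_mat m n"
  by (auto intro: carrier_matI)

lemma mat_adjoint_index [simp]:
  "i < dim_col A \<Longrightarrow> j < dim_row A \<Longrightarrow> mat_adjoint A $$ (i,j) = cnj (A $$ (j,i))"
  unfolding mat_adjoint_def by (simp add: mat_of_rows_index)

lemma mat_mult_index_sum:
  "A \<in> carrier_mat n m \<Longrightarrow> B \<in> carrier_mat m p \<Longrightarrow> i < n \<Longrightarrow> j < p \<Longrightarrow>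
   (A * B) $$ (i,j) = (\<Sum>l<m. A $$ (i,l) * B $$ (l,j))"
  by (simp add: scalar_prod_def atLeast0LessThan)

lemma mat_adjoint_mult:
  assumes "(A :: complex mat) \<in> carrier_mat n n" "B \<in> carrier_mat n n"
  shows "mat_adjoint (A * B) = mat_adjoint B * mat_adjoint A"
proof (rule eq_matI)
  fix i j assume "i < dim_row (mat_adjoint B * mat_adjoint A)" "j < dim_col (mat_adjoint B * mat_adjoint A)"
  then have ij: "i < n" "j < n" using assms by auto
  have "mat_adjoint (A * B) $$ (i,j) = cnj (\<Sum>l<n. A $$ (j,l) * B $$ (l,i))"
    using assms ij by (simp add: mat_mult_index_sum[of A n n B n] del: index_mult_mat(1))
  also have "\<dots> = (mat_adjoint B * mat_adjoint A) $$ (i,j)"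
    using assms ij by (subst mat_mult_index_sum[of _ n n _ n]) (auto simp: mult.commute)
  finally show "mat_adjoint (A * B) $$ (i,j) = (mat_adjoint B * mat_adjoint A) $$ (i,j)" .
qed (use assms in auto)

lemma mat_adjoint_adjoint [simp]: "mat_adjoint (mat_adjoint (A :: complex mat)) = A"
  by (rule eq_matI) auto

lemma mat_adjoint_smult: "mat_adjoint (a \<cdot>\<^sub>m A) = cnj a \<cdot>\<^sub>m mat_adjoint A"
  by (intro eq_matI) auto

lemma mat_adjoint_one [simp]: "mat_adjoint (1\<^sub>m n :: complex mat) = 1\<^sub>m n"
  by (intro eq_matI) auto

lemma mat_op_norm_adjoint:
  assumes A: "A \<in> carrier_mat n n"
  shows "mat_op_norm (mat_adjoint A) = mat_op_norm A"
proof -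
  have *: "mat_op_norm (mat_adjoint B) \<le> mat_op_norm B" if B: "B \<in> carrier_mat n n" for B
  proof (rule mat_op_norm_le_if_form_bd)
    show "form_bd n (\<lambda>i j. mat_adjoint B $$ (i,j)) (mat_op_norm B)"
      using form_bd_cnj_swap[OF form_bd_mat_op_norm[OF B]] B
      by (subst form_bd_cong[where Y = "\<lambda>i j. cnj (B $$ (j,i))"]) auto
  qed (use B mat_op_norm_nonneg in auto)
  show ?thesis using *[OF A] *[of "mat_adjoint A"] A by (auto intro: antisym)
qed

section \<open>Unitary matrices and conjugation by them\<close>

definition unitary :: "nat \<Rightarrow> complex mat \<Rightarrow> bool" where
  "unitary n U \<longleftrightarrow> U \<in> carrier_mat n n \<and> mat_adjoint U * U = 1\<^sub>m n \<and> U * mat_adjoint U = 1\<^sub>m n"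

lemma unitaryD:
  assumes "unitary n U"
  shows "U \<in> carrier_mat n n" "mat_adjoint U \<in> carrier_mat n n"
    "mat_adjoint U * U = 1\<^sub>m n" "U * mat_adjoint U = 1\<^sub>m n"
  using assms unfolding unitary_def by auto

lemma unitaryI:
  assumes "U \<in> carrier_mat n n" "mat_adjoint U * U = 1\<^sub>m n"
  shows "unitary n U"
  using assms mat_mult_left_right_inverse[of "mat_adjoint U" n U] unfolding unitary_def by auto

lemma unitary_adjoint: "unitary n U \<Longrightarrow> unitary n (mat_adjoint U)"
  unfolding unitary_def by auto

lemma unitary_mult:
  assumes U: "unitary n U" and V: "unitary n V"
  shows "unitary n (U * V)"
proof (rule unitaryI)
  note [simp] = unitaryD[OF U] unitaryD[OF V]
  show "U * V \<in> carrier_mat n n" by (auto intro: mult_carrier_mat[of _ n n])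
  have "mat_adjoint (U * V) * (U * V) = mat_adjoint V * (mat_adjoint U * (U * V))"
    unfolding mat_adjoint_mult[OF unitaryD(1)[OF U] unitaryD(1)[OF V]]
    by (rule assoc_mult_mat[of _ n n _ n _ n]) (auto intro: mult_carrier_mat[of _ n n])
  also have "mat_adjoint U * (U * V) = (mat_adjoint U * U) * V"
    by (rule assoc_mult_mat[symmetric, of _ n n _ n _ n]) auto
  also have "\<dots> = V" using left_mult_one_mat[OF unitaryD(1)[OF V]] by simp
  finally show "mat_adjoint (U * V) * (U * V) = 1\<^sub>m n" by simp
qed

text \<open>The columns are orthonormal, so expanding the square of the norm of \<open>U w\<close>
  leaves only the diagonal terms.\<close>

lemma unitary_norm_le:
  assumes U: "unitary n U"
  shows "mat_op_norm U \<le> 1"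
proof (rule mat_op_norm_le_if_form_bd[OF unitaryD(1)[OF U]])
  show "form_bd n (\<lambda>i j. U $$ (i,j)) 1"
  proof (rule form_bdI_apply)
    fix w :: "nat \<Rightarrow> complex"
    have orth: "(\<Sum>i<n. cnj (U $$ (i,j)) * U $$ (i,l)) = (if j = l then 1 else 0)" if "j < n" "l < n" for j l
    proof -
      have "(mat_adjoint U * U) $$ (j,l) = (\<Sum>i<n. mat_adjoint U $$ (j,i) * U $$ (i,l))"
        by (rule mat_mult_index_sum[OF unitaryD(2)[OF U] unitaryD(1)[OF U] that])
      then show ?thesis using unitaryD(1,3)[OF U] that by (simp add: one_mat_def)
    qed
    have "complex_of_real (\<Sum>i<n. (cmod (\<Sum>j<n. U $$ (i,j) * w j))\<^sup>2) =
        (\<Sum>i<n. (\<Sum>j<n. cnj (U $$ (i,j) * w j)) * (\<Sum>l<n. U $$ (i,l) * w l))"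
      unfolding of_real_sum complex_norm_square cnj_sum[symmetric] by (simp add: mult.commute)
    also have "\<dots> = (\<Sum>i<n. \<Sum>j<n. \<Sum>l<n. cnj (w j) * w l * (cnj (U $$ (i,j)) * U $$ (i,l)))"
      unfolding sum_product by (intro sum.cong refl) (simp add: mult_ac)
    also have "\<dots> = (\<Sum>j<n. \<Sum>l<n. \<Sum>i<n. cnj (w j) * w l * (cnj (U $$ (i,j)) * U $$ (i,l)))"
      by (rule trans[OF sum.swap], rule sum.cong[OF refl], rule sum.swap)
    also have "\<dots> = (\<Sum>j<n. \<Sum>l<n. cnj (w j) * w l * (if j = l then 1 else 0))"
      unfolding sum_distrib_left[symmetric] using orth by (intro sum.cong refl) auto
    also have "\<dots> = (\<Sum>j<n. cnj (w j) * w j)"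
      by (simp add: if_distrib[of "\<lambda>x. _ * x"] sum.delta cong: if_cong)
    also have "\<dots> = complex_of_real (sqsum n w)"
      unfolding of_real_sum complex_norm_square by (simp add: mult.commute)
    finally show "(\<Sum>i<n. (cmod (\<Sum>j<n. U $$ (i,j) * w j))\<^sup>2) \<le> 1\<^sup>2 * (sqsum n w)"
      by (simp only: of_real_eq_iff) simp
  qed simp
qed simp

lemma mult_carrier_square [intro, simp]:
  "A \<in> carrier_mat n n \<Longrightarrow> B \<in> carrier_mat n n \<Longrightarrow> A * B \<in> carrier_mat n n"
  by (rule mult_carrier_mat)

lemma assoc_square: "A \<in> carrier_mat n n \<Longrightarrow> B \<in> carrier_mat n n \<Longrightarrow> C \<in> carrier_mat n n \<Longrightarrow>
   A * B * C = A * (B * (C :: 'a :: semiring_0 mat))"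
  by (rule assoc_mult_mat)

text \<open>For a unitary \<open>U\<close> whose columns are eigenvectors, \<open>conj_by U\<close>
  carries a matrix written in the eigenbasis to the standard basis, and
  \<open>conj_by (mat_adjoint U)\<close> carries it back.\<close>

definition conj_by :: "complex mat \<Rightarrow> complex mat \<Rightarrow> complex mat" where
  "conj_by U X = U * X * mat_adjoint U"

lemma conj_by_carrier [simp]:
  "U \<in> carrier_mat n n \<Longrightarrow> X \<in> carrier_mat n n \<Longrightarrow> conj_by U X \<in> carrier_mat n n"
  unfolding conj_by_def by simp

lemma conj_by_adjoint_cancel:
  assumes U: "unitary n U" and X: "X \<in> carrier_mat n n"
  shows "conj_by (mat_adjoint U) (conj_by U X) = X" "conj_by U (conj_by (mat_adjoint U) X) = X"
proof -
  have "conj_by (mat_adjoint V) (conj_by V X) = X" if V: "unitary n V" for V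
  proof -
    note [simp] = unitaryD[OF V] X
    have "conj_by (mat_adjoint V) (conj_by V X) = mat_adjoint V * (V * (X * (mat_adjoint V * V)))"
      unfolding conj_by_def by (simp add: assoc_square[of _ n])
    also have "\<dots> = (mat_adjoint V * V) * X"
      by (subst assoc_square[of _ n]) (auto simp: right_mult_one_mat[OF X])
    finally show ?thesis by (simp add: left_mult_one_mat[OF X])
  qed
  from this[OF U] this[OF unitary_adjoint[OF U]]
  show "conj_by (mat_adjoint U) (conj_by U X) = X" "conj_by U (conj_by (mat_adjoint U) X) = X"
    by simp_all
qed

lemma conj_by_mult:
  assumes U: "unitary n U" and X: "X \<in> carrier_mat n n" and Y: "Y \<in> carrier_mat n n"
  shows "conj_by U X * conj_by U Y = conj_by U (X * Y)"
proof -
  note [simp] = unitaryD[OF U] X Y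
  have "conj_by U X * conj_by U Y = U * (X * ((mat_adjoint U * U) * (Y * mat_adjoint U)))"
    unfolding conj_by_def
    by (simp add: assoc_square[of _ n] del: unitaryD(3)[OF U])
  also have "\<dots> = U * (X * (Y * mat_adjoint U))"
    by (simp add: left_mult_one_mat[of _ n n])
  finally show ?thesis unfolding conj_by_def by (simp add: assoc_square[of _ n])
qed

lemma conj_by_conj_by:
  assumes "U \<in> carrier_mat n n" "V \<in> carrier_mat n n" "X \<in> carrier_mat n n"
  shows "conj_by U (conj_by V X) = conj_by (U * V) X"
  using assms unfolding conj_by_def by (simp add: mat_adjoint_mult[of _ n] assoc_square[of _ n])

lemma conj_by_adjoint:
  assumes "U \<in> carrier_mat n n" "X \<in> carrier_mat n n"
  shows "mat_adjoint (conj_by U X) = conj_by U (mat_adjoint X)"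
  using assms unfolding conj_by_def by (simp add: mat_adjoint_mult[of _ n] assoc_square[of _ n])

lemma conj_by_add:
  assumes "U \<in> carrier_mat n n" "X \<in> carrier_mat n n" "Y \<in> carrier_mat n n"
  shows "conj_by U (X + Y) = conj_by U X + conj_by U Y"
  using assms unfolding conj_by_def
  by (simp add: mult_add_distrib_mat[of _ n n _ n] add_mult_distrib_mat[of _ n n _ _ n])

lemma conj_by_diff:
  assumes "U \<in> carrier_mat n n" "X \<in> carrier_mat n n" "Y \<in> carrier_mat n n"
  shows "conj_by U (X - Y) = conj_by U X - conj_by U Y"
  using assms unfolding conj_by_def
  by (simp add: mult_minus_distrib_mat[of _ n n _ n] minus_mult_distrib_mat[of _ n n _ _ n])

lemma conj_by_smult:
  assumes "U \<in> carrier_mat n n" "X \<in> carrier_mat n n"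
  shows "conj_by U (a \<cdot>\<^sub>m X) = a \<cdot>\<^sub>m conj_by U X"
  using assms unfolding conj_by_def by (simp add: mult_smult_distrib[of _ n n _ n] mult_smult_assoc_mat[of _ n n _ n])

lemma conj_by_one: "unitary n U \<Longrightarrow> conj_by U (1\<^sub>m n) = 1\<^sub>m n"
  unfolding conj_by_def using unitaryD by (simp add: right_mult_one_mat[of _ n n])

lemma conj_by_norm:
  assumes U: "unitary n U" and X: "X \<in> carrier_mat n n"
  shows "mat_op_norm (conj_by U X) = mat_op_norm X"
proof -
  have le: "mat_op_norm (conj_by V Y) \<le> mat_op_norm Y" if V: "unitary n V" and Y: "Y \<in> carrier_mat n n" for V Y
  proof -
    have V1: "mat_op_norm V \<le> 1" "mat_op_norm (mat_adjoint V) \<le> 1"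
      using unitary_norm_le[OF V] unitary_norm_le[OF unitary_adjoint[OF V]] by auto
    have "mat_op_norm (conj_by V Y) \<le> mat_op_norm (V * Y) * mat_op_norm (mat_adjoint V)"
      unfolding conj_by_def by (rule mat_op_norm_mult) (use unitaryD[OF V] Y in auto)
    also have "\<dots> \<le> mat_op_norm (V * Y) * 1"
      using V1 unitaryD[OF V] Y by (intro mult_left_mono mat_op_norm_nonneg[of _ n]) auto
    also have "\<dots> \<le> mat_op_norm V * mat_op_norm Y"
      using mat_op_norm_mult[OF unitaryD(1)[OF V] Y] by simp
    also have "\<dots> \<le> 1 * mat_op_norm Y"
      using V1 Y by (intro mult_right_mono mat_op_norm_nonneg[of _ n]) auto
    finally show ?thesis by simp
  qed
  have "mat_op_norm X = mat_op_norm (conj_by (mat_adjoint U) (conj_by U X))"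
    by (simp add: conj_by_adjoint_cancel[OF U X])
  also have "\<dots> \<le> mat_op_norm (conj_by U X)"
    by (rule le[OF unitary_adjoint[OF U]]) (use unitaryD[OF U] X in auto)
  finally show ?thesis using le[OF U X] by simp
qed

section \<open>Diagonal matrices\<close>

definition diagm :: "nat \<Rightarrow> (nat \<Rightarrow> complex) \<Rightarrow> complex mat" where
  "diagm n f = mat n n (\<lambda>(i,j). if i = j then f i else 0)"

abbreviation rdiag :: "nat \<Rightarrow> (nat \<Rightarrow> real) \<Rightarrow> complex mat" where
  "rdiag n f \<equiv> diagm n (\<lambda>i. complex_of_real (f i))"

lemma diagm_carrier [simp]: "diagm n f \<in> carrier_mat n n"
  unfolding diagm_def by simp

lemma diagm_index [simp]: "i < n \<Longrightarrow> j < n \<Longrightarrow> diagm n f $$ (i,j) = (if i = j then f i else 0)"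
  unfolding diagm_def by simp

lemma diagm_dim [simp]: "dim_row (diagm n f) = n" "dim_col (diagm n f) = n"
  unfolding diagm_def by simp_all

lemma diagm_mult_index:
  assumes "X \<in> carrier_mat n n" "i < n" "j < n"
  shows "(diagm n f * X) $$ (i,j) = f i * X $$ (i,j)" "(X * diagm n f) $$ (i,j) = X $$ (i,j) * f j"
  using assms
  by (simp_all add: mat_mult_index_sum[of _ n n _ n] if_distrib[of "\<lambda>x. x * _"] if_distrib[of "\<lambda>x. _ * x"]
      sum.delta sum.delta' del: index_mult_mat cong: if_cong)

lemma diagm_mult: "diagm n f * diagm n g = diagm n (\<lambda>i. f i * g i)"
  by (rule eq_matI) (auto simp: diagm_mult_index simp del: index_mult_mat(1))

lemma diagm_adjoint: "mat_adjoint (diagm n f) = diagm n (\<lambda>i. cnj (f i))"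
  by (rule eq_matI) auto

lemma diagm_one: "diagm n (\<lambda>_. 1) = 1\<^sub>m n"
  by (rule eq_matI) auto

lemma diagm_cong: "(\<And>i. i < n \<Longrightarrow> f i = g i) \<Longrightarrow> diagm n f = diagm n g"
  by (rule eq_matI) auto

lemma diagm_add: "diagm n f + diagm n g = diagm n (\<lambda>i. f i + g i)"
  by (rule eq_matI) auto

lemma diagm_diff: "diagm n f - diagm n g = diagm n (\<lambda>i. f i - g i)"
  by (rule eq_matI) auto

lemma diagm_smult: "a \<cdot>\<^sub>m diagm n f = diagm n (\<lambda>i. a * f i)"
  by (rule eq_matI) auto

lemma diagm_zero: "diagm n (\<lambda>_. 0) = 0\<^sub>m n n"
  by (rule eq_matI) auto

lemma diagm_pow: "diagm n f ^\<^sub>m m = diagm n (\<lambda>i. f i ^ m)"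
  by (induction m) (auto simp: diagm_one[symmetric] diagm_mult mult.commute)

lemma diagm_norm_le:
  assumes "\<And>i. i < n \<Longrightarrow> cmod (f i) \<le> K" "K \<ge> 0"
  shows "mat_op_norm (diagm n f) \<le> K"
proof (rule mat_op_norm_le_if_form_bd[OF _ assms(2)])
  show "form_bd n (\<lambda>i j. diagm n f $$ (i,j)) K"
    using form_bd_diag[of n f K, OF assms]
    by (subst form_bd_cong[where Y = "\<lambda>i j. if i = j then f i else 0"]) auto
qed simp

text \<open>Applied to a diagonal matrix, this bounds the eigenvalues of an implementing element by
  its norm.\<close>

lemma entry_le_mat_op_norm:
  assumes A: "A \<in> carrier_mat n n" and ij: "i < n" "j < n"
  shows "cmod (A $$ (i,j)) \<le> mat_op_norm A"
proof -
  let ?w = "\<lambda>l. if l = j then 1 else (0::complex)"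
  have "(\<Sum>r<n. (cmod (\<Sum>l<n. A $$ (r,l) * ?w l))\<^sup>2) \<le> (mat_op_norm A)\<^sup>2 * (\<Sum>l<n. (cmod (?w l))\<^sup>2)"
    by (rule form_bd_imp_apply_le[OF form_bd_mat_op_norm[OF A] mat_op_norm_nonneg[OF A]])
  moreover have "(\<Sum>l<n. A $$ (r,l) * ?w l) = A $$ (r,j)" for r
    using ij by (simp add: if_distrib[of "\<lambda>x. _ * x"] sum.delta cong: if_cong)
  moreover have "(\<Sum>l<n. (cmod (?w l))\<^sup>2) = 1"
    using ij by (simp add: if_distrib[of cmod] if_distrib[of "\<lambda>x. x\<^sup>2"] sum.delta cong: if_cong)
  ultimately have "(\<Sum>r<n. (cmod (A $$ (r,j)))\<^sup>2) \<le> (mat_op_norm A)\<^sup>2" by simp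
  moreover have "(cmod (A $$ (i,j)))\<^sup>2 \<le> (\<Sum>r<n. (cmod (A $$ (r,j)))\<^sup>2)"
    using ij by (intro member_le_sum) auto
  ultimately show ?thesis
    by (intro power2_le_imp_le[OF _ mat_op_norm_nonneg[OF A]]) linarith
qed

text \<open>The block diagonal sum of a scalar and \<open>X\<close>, for the induction that splits
  off one eigenvector.\<close>

definition mat_ext :: "nat \<Rightarrow> complex \<Rightarrow> complex mat \<Rightarrow> complex mat" where
  "mat_ext n a X = mat (Suc n) (Suc n) (\<lambda>(i,j).
     case i of 0 \<Rightarrow> (case j of 0 \<Rightarrow> a | Suc _ \<Rightarrow> 0) | Suc i' \<Rightarrow> (case j of 0 \<Rightarrow> 0 | Suc j' \<Rightarrow> X $$ (i',j')))"

lemma mat_ext_carrier [simp]: "mat_ext n a X \<in> carrier_mat (Suc n) (Suc n)"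
  unfolding mat_ext_def by simp

lemma mat_ext_index [simp]:
  "mat_ext n a X $$ (0,0) = a"
  "j < n \<Longrightarrow> mat_ext n a X $$ (0,Suc j) = 0"
  "i < n \<Longrightarrow> mat_ext n a X $$ (Suc i,0) = 0"
  "i < n \<Longrightarrow> j < n \<Longrightarrow> mat_ext n a X $$ (Suc i,Suc j) = X $$ (i,j)"
  unfolding mat_ext_def by simp_all

lemma mat_ext_dim [simp]: "dim_row (mat_ext n a X) = Suc n" "dim_col (mat_ext n a X) = Suc n"
  unfolding mat_ext_def by simp_all

lemma mat_ext_eqI:
  assumes "A \<in> carrier_mat (Suc n) (Suc n)" "A $$ (0,0) = a"
    "\<And>i. i < n \<Longrightarrow> A $$ (Suc i, 0) = 0" "\<And>j. j < n \<Longrightarrow> A $$ (0, Suc j) = 0"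
    "\<And>i j. i < n \<Longrightarrow> j < n \<Longrightarrow> A $$ (Suc i, Suc j) = X $$ (i,j)"
  shows "A = mat_ext n a X"
proof (rule eq_matI)
  fix i j assume "i < dim_row (mat_ext n a X)" "j < dim_col (mat_ext n a X)"
  then show "A $$ (i,j) = mat_ext n a X $$ (i,j)"
    using assms by (cases i; cases j) auto
qed (use assms in auto)

lemma mat_ext_mult:
  assumes "X \<in> carrier_mat n n" "Y \<in> carrier_mat n n"
  shows "mat_ext n a X * mat_ext n b Y = mat_ext n (a * b) (X * Y)"
  by (rule mat_ext_eqI)
     (use assms in \<open>auto simp: mat_mult_index_sum[of _ "Suc n" "Suc n" _ "Suc n"] mat_mult_index_sum[of _ n n _ n]
        sum.lessThan_Suc_shift simp del: index_mult_mat sum.lessThan_Suc\<close>)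

lemma mat_ext_adjoint:
  "X \<in> carrier_mat n n \<Longrightarrow> mat_adjoint (mat_ext n a X) = mat_ext n (cnj a) (mat_adjoint X)"
  by (rule mat_ext_eqI) auto

lemma mat_ext_one: "mat_ext n 1 (1\<^sub>m n) = 1\<^sub>m (Suc n)"
  by (rule mat_ext_eqI[symmetric]) auto

lemma mat_ext_diagm: "mat_ext n a (diagm n f) = diagm (Suc n) (case_nat a f)"
  by (rule mat_ext_eqI[symmetric]) auto

lemma mat_ext_unitary: "unitary n U \<Longrightarrow> unitary (Suc n) (mat_ext n 1 U)"
  using unitaryD[of n U]
  by (intro unitaryI) (simp_all add: mat_ext_adjoint mat_ext_mult mat_ext_one)

text \<open>Gram-Schmidt, run on a basis that begins with \<open>v\<close>, leaves \<open>v\<close>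
  in place. Normalising the orthogonal columns makes the matrix unitary and brings in the factor
  \<open>c\<close>.\<close>

lemma unitary_first_column:
  fixes v :: "complex vec"
  assumes v: "v \<in> carrier_vec n" and v0: "v \<noteq> 0\<^sub>v n" and n: "n > 0"
  obtains U c where "unitary n U" "c \<noteq> 0" "\<And>i. i < n \<Longrightarrow> U $$ (i,0) = c * v $ i"
proof -
  interpret cof_vec_space n "TYPE(complex)" .
  define b where "b = basis_completion v"
  define ws where "ws = gram_schmidt n b"
  define W where "W = mat_of_cols n ws"
  from basis_completion[OF v v0, folded b_def]
  have dist_b: "distinct b" and indep: "\<not> lin_dep (set b)" and b: "set b \<subseteq> carrier_vec n"
    and hdb: "hd b = v" and len_b: "length b = n" by auto
  from hdb len_b n obtain vs where bv: "b = v # vs" by (cases b, auto)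
  from gram_schmidt_result[OF b dist_b indep refl, folded ws_def]
  have ws: "set ws \<subseteq> carrier_vec n" "corthogonal ws" "length ws = n" by (auto simp: len_b)
  from gram_schmidt_hd[OF v, of vs, folded bv] have hdws: "hd ws = v" unfolding ws_def .
  have orth: "corthogonal_mat W" using orthogonal_mat_of_cols ws unfolding W_def by blast
  have W: "W \<in> carrier_mat n n"
    using ws unfolding W_def using mat_of_cols_carrier(1)[of n ws] by auto
  define d where "d j = (\<Sum>i<n. (cmod (W $$ (i,j)))\<^sup>2)" for j
  have ip: "(\<Sum>i<n. W $$ (i,j) * cnj (W $$ (i,l))) = (if j = l then complex_of_real (d j) else 0)"
    and dpos: "d j > 0" if jl: "j < n" "l < n" for j l
  proof -
    have e: "col W j \<bullet>c col W l = (\<Sum>i<n. W $$ (i,j) * cnj (W $$ (i,l)))" if "j < n" "l < n" for j l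
      using W that by (simp add: scalar_prod_def atLeast0LessThan)
    have diag: "(\<Sum>i<n. W $$ (i,j) * cnj (W $$ (i,j))) = complex_of_real (d j)" for j
      unfolding d_def of_real_sum complex_norm_square ..
    show "(\<Sum>i<n. W $$ (i,j) * cnj (W $$ (i,l))) = (if j = l then complex_of_real (d j) else 0)"
      using corthogonal_matD[OF orth, of j l] e[OF jl] diag jl W by auto
    have "d j \<noteq> 0"
      using corthogonal_matD[OF orth, of j j] e[of j j] diag[of j] jl W by auto
    moreover have "d j \<ge> 0" unfolding d_def by (intro sum_nonneg) auto
    ultimately show "d j > 0" by simp
  qed
  define U where "U = mat n n (\<lambda>(i,j). W $$ (i,j) / complex_of_real (sqrt (d j)))"
  have Uc: "U \<in> carrier_mat n n" unfolding U_def by simp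
  have "unitary n U"
  proof (rule unitaryI[OF Uc], rule eq_matI)
    fix j l assume "j < dim_row (1\<^sub>m n :: complex mat)" "l < dim_col (1\<^sub>m n :: complex mat)"
    then have jl: "j < n" "l < n" by auto
    have sq: "complex_of_real (sqrt (d j)) * complex_of_real (sqrt (d j)) = complex_of_real (d j)"
      using dpos[OF jl] by (simp flip: of_real_mult)
    have "(mat_adjoint U * U) $$ (j,l) = (\<Sum>i<n. cnj (W $$ (i,j) / complex_of_real (sqrt (d j))) * (W $$ (i,l) / complex_of_real (sqrt (d l))))"
      using Uc jl by (subst mat_mult_index_sum[of _ n n _ n]) (auto simp: U_def)
    also have "\<dots> = (\<Sum>i<n. W $$ (i,l) * cnj (W $$ (i,j))) / (complex_of_real (sqrt (d j)) * complex_of_real (sqrt (d l)))"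
      by (simp add: sum_divide_distrib mult_ac)
    also have "\<dots> = (if j = l then 1 else 0)"
      using ip[OF jl(2,1)] sq dpos[OF jl] by auto
    finally show "(mat_adjoint U * U) $$ (j,l) = 1\<^sub>m n $$ (j,l)" using jl by simp
  qed (use Uc in auto)
  moreover have "ws ! 0 = v" using hdws ws(3) n by (cases ws) auto
  then have "U $$ (i,0) = (1 / complex_of_real (sqrt (d 0))) * v $ i" if "i < n" for i
    using that n ws unfolding U_def W_def by (simp add: mat_of_cols_index)
  moreover have "1 / complex_of_real (sqrt (d 0)) \<noteq> 0" using dpos[OF n n] by simp
  ultimately show thesis using that by blast
qed

text \<open>Induction on the size. A unitary with an eigenvector as first column clears the first
  column below the diagonal. Self-adjointness then clears the first row, makes the eigenvalue real,
  and passes to the remaining block.\<close>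

theorem hermitian_diagonalisation:
  assumes "A \<in> carrier_mat n n" "mat_adjoint A = A"
  shows "\<exists>U \<mu>. unitary n U \<and> A = conj_by U (rdiag n \<mu>)"
  using assms
proof (induction n arbitrary: A)
  case 0
  have "A = conj_by (1\<^sub>m 0) (diagm 0 f)" for f
    unfolding conj_by_def by (rule eq_matI) (use 0 in auto)
  moreover have "unitary 0 (1\<^sub>m 0)" by (rule unitaryI) auto
  ultimately show ?case by blast
next
  case (Suc n)
  note A = Suc.prems(1)
  obtain e where "e \<in> spectrum A" using spectrum_non_empty[OF A] by auto
  then obtain v where ev: "v \<in> carrier_vec (Suc n)" "v \<noteq> 0\<^sub>v (Suc n)" "A *\<^sub>v v = e \<cdot>\<^sub>v v"
    using A unfolding spectrum_def eigenvalue_def eigenvector_def by auto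
  obtain U c where U: "unitary (Suc n) U" and c: "c \<noteq> 0" and Uv: "\<And>i. i < Suc n \<Longrightarrow> U $$ (i,0) = c * v $ i"
    using unitary_first_column[OF ev(1,2)] by auto
  note Uc = unitaryD[OF U]
  define B where "B = conj_by (mat_adjoint U) A"
  have B: "B \<in> carrier_mat (Suc n) (Suc n)" unfolding B_def using Uc A by simp
  have Bh: "mat_adjoint B = B"
    unfolding B_def using Uc A Suc.prems(2) by (simp add: conj_by_adjoint[of _ "Suc n"])
  have AU: "(A * U) $$ (i,0) = e * U $$ (i,0)" if i: "i < Suc n" for i
  proof -
    have "(A * U) $$ (i,0) = (\<Sum>l<Suc n. A $$ (i,l) * U $$ (l,0))"
      using A Uc i by (subst mat_mult_index_sum[of _ "Suc n" "Suc n" _ "Suc n"]) auto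
    also have "\<dots> = c * (\<Sum>l<Suc n. A $$ (i,l) * v $ l)"
      unfolding sum_distrib_left by (intro sum.cong refl) (auto simp: Uv mult_ac)
    also have "(\<Sum>l<Suc n. A $$ (i,l) * v $ l) = e * v $ i"
      using mult_mat_vec_nth[OF A ev(1) i] ev i by simp
    finally show ?thesis using Uv[OF i] by simp
  qed
  have B_eq: "B = mat_adjoint U * (A * U)"
    unfolding B_def conj_by_def using Uc A by (simp add: assoc_square[of _ "Suc n"])
  have col0: "B $$ (i,0) = (if i = 0 then e else 0)" if i: "i < Suc n" for i
  proof -
    have "B $$ (i,0) = (\<Sum>l<Suc n. mat_adjoint U $$ (i,l) * (A * U) $$ (l,0))"
      unfolding B_eq using A Uc i by (subst mat_mult_index_sum[of _ "Suc n" "Suc n" _ "Suc n"]) auto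
    also have "\<dots> = e * (\<Sum>l<Suc n. mat_adjoint U $$ (i,l) * U $$ (l,0))"
      unfolding sum_distrib_left using AU by (intro sum.cong refl) (auto simp: mult_ac)
    also have "(\<Sum>l<Suc n. mat_adjoint U $$ (i,l) * U $$ (l,0)) = (mat_adjoint U * U) $$ (i,0)"
      using Uc i by (subst mat_mult_index_sum[of _ "Suc n" "Suc n" _ "Suc n"]) auto
    finally show ?thesis using Uc i by simp
  qed
  have "B $$ (0,0) = cnj (B $$ (0,0))" using arg_cong[OF Bh, of "\<lambda>X. X $$ (0,0)"] B by simp
  then have "e = cnj e" using col0[of 0] by simp
  then have e: "e = complex_of_real (Re e)" by (simp add: complex_eq_iff)
  define C where "C = mat n n (\<lambda>(i,j). B $$ (Suc i, Suc j))"
  have C: "C \<in> carrier_mat n n" unfolding C_def by simp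
  have "mat_adjoint C = C"
  proof (rule eq_matI)
    fix i j assume "i < dim_row C" "j < dim_col C"
    then have "i < n" "j < n" using C by auto
    then show "mat_adjoint C $$ (i,j) = C $$ (i,j)"
      using arg_cong[OF Bh, of "\<lambda>X. X $$ (Suc i, Suc j)"] B unfolding C_def by auto
  qed (use C in auto)
  then obtain V \<mu> where V: "unitary n V" and CV: "C = conj_by V (rdiag n \<mu>)"
    using Suc.IH[OF C] by blast
  note Vc = unitaryD[OF V]
  have "B = mat_ext n e C"
  proof (rule mat_ext_eqI[OF B])
    fix j assume j: "j < n"
    show "B $$ (0, Suc j) = 0"
      using arg_cong[OF Bh, of "\<lambda>X. X $$ (0, Suc j)"] B col0[of "Suc j"] j by simp
  qed (use col0 in \<open>auto simp: C_def\<close>)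
  also have "\<dots> = conj_by (mat_ext n 1 V) (mat_ext n e (rdiag n \<mu>))"
    using Vc unfolding CV conj_by_def by (simp add: mat_ext_adjoint mat_ext_mult)
  also have "mat_ext n e (rdiag n \<mu>) =
      diagm (Suc n) (\<lambda>i. complex_of_real (case_nat (Re e) \<mu> i))"
    unfolding mat_ext_diagm by (rule diagm_cong) (use e in \<open>auto split: nat.split\<close>)
  finally have B2: "B = conj_by (mat_ext n 1 V) (diagm (Suc n) (\<lambda>i. complex_of_real (case_nat (Re e) \<mu> i)))" .
  have "A = conj_by U B" unfolding B_def using conj_by_adjoint_cancel(2)[OF U A] by simp
  also have "\<dots> = conj_by (U * mat_ext n 1 V) (diagm (Suc n) (\<lambda>i. complex_of_real (case_nat (Re e) \<mu> i)))"
    unfolding B2 by (rule conj_by_conj_by[of _ "Suc n"]) (use Uc in auto)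
  finally show ?case using unitary_mult[OF U mat_ext_unitary[OF V]] by blast
qed

section \<open>Schur multipliers depending on eigenvalue differences\<close>

lemma form_bd_diff:
  assumes "form_bd n X K" "form_bd n Y L"
  shows "form_bd n (\<lambda>i j. X i j - Y i j) (K + L)"
  using form_bd_add[OF assms(1) form_bd_scale[OF assms(2), of "-1"]] by simp

text \<open>For fixed test vectors the form is a finite sum of scalar integrals, so the usual
  estimate by the length of the interval applies, with no loss in \<open>n\<close>.\<close>

lemma form_bd_integral:
  assumes bd: "\<And>t. t \<in> {p..q} \<Longrightarrow> form_bd n (F t) K"
    and G: "\<And>i j. i < n \<Longrightarrow> j < n \<Longrightarrow> ((\<lambda>t. F t i j) has_integral G i j) {p..q}"
    and pq: "p \<le> q" and K: "K \<ge> 0"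
  shows "form_bd n G (K * (q - p))"
  unfolding form_bd_def
proof (intro allI)
  fix v w :: "nat \<Rightarrow> complex"
  let ?S = "(sqsum n v) + (sqsum n w)"
  have S: "?S \<ge> 0" by (intro add_nonneg_nonneg sum_nonneg) auto
  have "((\<lambda>t. \<Sum>i<n. \<Sum>j<n. cnj (v i) * F t i j * w j) has_integral (\<Sum>i<n. \<Sum>j<n. cnj (v i) * G i j * w j)) {p..q}"
    by (intro has_integral_sum has_integral_mult_left has_integral_mult_right G) auto
  moreover have "0 \<le> K * ?S / 2" using S K by simp
  ultimately have "cmod (\<Sum>i<n. \<Sum>j<n. cnj (v i) * G i j * w j) \<le> (K * ?S / 2) * content {p..q}"
    using form_bdD[OF bd] by (intro has_integral_bound_real[where S = "{}"]) auto
  then show "cmod (\<Sum>i<n. \<Sum>j<n. cnj (v i) * G i j * w j) \<le> K * (q - p) * ?S / 2"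
    using pq by (simp add: mult_ac)
qed

lemma has_integral_indicator_interval:
  fixes p q x y :: real
  assumes "p \<le> x" "y \<le> q"
  shows "((\<lambda>u. if u \<in> {x..y} then 1 else (0::real)) has_integral max 0 (y - x)) {p..q}"
proof -
  have "((\<lambda>u. 1 :: real) has_integral content {x..y} *\<^sub>R 1) {x..y}" by (rule has_integral_const_real)
  moreover have "content {x..y} *\<^sub>R (1::real) = max 0 (y - x)" by (auto simp: max_def)
  ultimately have "((\<lambda>u. 1 :: real) has_integral max 0 (y - x)) {x..y}" by simp
  then show ?thesis using has_integral_restrict[of "{x..y}" "{p..q}" "\<lambda>_. 1 :: real"] assms by auto
qed

text \<open>The triangle function is the autocorrelation of an interval, so the multiplier is an average of
  compressions to spectral windows of length \<open>1 / r\<close>.\<close>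

lemma triangle_multiplier:
  fixes l :: "nat \<Rightarrow> real"
  assumes Z: "form_bd n Z K" and K: "K \<ge> 0" and r: "r \<ge> 0"
  shows "form_bd n (\<lambda>i j. complex_of_real (max 0 (1 - \<bar>l i - l j\<bar> * r)) * Z i j) K"
proof (cases "r = 0")
  case True
  then show ?thesis using Z by simp
next
  case False
  then have r0: "r > 0" using r by simp
  define a where "a = 1 / r"
  have a: "a > 0" using r0 unfolding a_def by simp
  \<comment> \<open>\<open>{p..q}\<close> only has to contain all windows
    \<open>{l i..l i + a}\<close>; the sum is a convenient bound for every
    \<open>\<bar>l i\<bar>\<close>.\<close>
  define p where "p = - (\<Sum>i<n. \<bar>l i\<bar>)"
  define q where "q = (\<Sum>i<n. \<bar>l i\<bar>) + a"
  have lb: "p \<le> l i \<and> l i + a \<le> q" if "i < n" for i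
    using member_le_sum[of i "{..<n}" "\<lambda>i. \<bar>l i\<bar>"] that unfolding p_def q_def by auto
  define E :: "nat \<Rightarrow> real \<Rightarrow> real" where "E i u = (if u \<in> {l i..l i + a} then 1 else 0)" for i u
  have EE: "((\<lambda>u. E i u * E j u) has_integral max 0 (a - \<bar>l i - l j\<bar>)) {p..q}" if "i < n" "j < n" for i j
  proof -
    have "((\<lambda>u. if u \<in> {max (l i) (l j)..min (l i) (l j) + a} then 1 else (0::real)) has_integral
        max 0 ((min (l i) (l j) + a) - max (l i) (l j))) {p..q}"
      using lb[OF that(1)] lb[OF that(2)] by (intro has_integral_indicator_interval) auto
    moreover have "(\<lambda>u. if u \<in> {max (l i) (l j)..min (l i) (l j) + a} then 1 else (0::real)) = (\<lambda>u. E i u * E j u)"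
      unfolding E_def by (auto simp: fun_eq_iff)
    moreover have "(min (l i) (l j) + a) - max (l i) (l j) = a - \<bar>l i - l j\<bar>" by auto
    ultimately show ?thesis by simp
  qed
  have E1: "(E i has_integral a) {p..q}" if "i < n" for i
  proof -
    have "(\<lambda>u. E i u * E i u) = E i" unfolding E_def by auto
    then show ?thesis using EE[OF that that] a by simp
  qed
  show ?thesis
    unfolding form_bd_def
  proof (intro allI)
    fix v w :: "nat \<Rightarrow> complex"
    let ?tri = "\<lambda>i j. max 0 (1 - \<bar>l i - l j\<bar> * r)"
    let ?I = "\<lambda>u. \<Sum>i<n. \<Sum>j<n. cnj (complex_of_real (E i u) * v i) * Z i j * (complex_of_real (E j u) * w j)"
    let ?g = "\<lambda>u. K * ((\<Sum>i<n. (cmod (v i))\<^sup>2 * E i u) + (\<Sum>j<n. (cmod (w j))\<^sup>2 * E j u)) / 2"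
    let ?S = "(sqsum n v) + (sqsum n w)"
    have at: "a * ?tri i j = max 0 (a - \<bar>l i - l j\<bar>)" for i j
    proof -
      have "a * ?tri i j = max (a * 0) (a * (1 - \<bar>l i - l j\<bar> * r))" using a by (simp add: max_mult_distrib_left)
      also have "a * (1 - \<bar>l i - l j\<bar> * r) = a - \<bar>l i - l j\<bar>" unfolding a_def using r0 by (simp add: field_simps)
      finally show ?thesis by simp
    qed
    have "((\<lambda>u. \<Sum>i<n. \<Sum>j<n. complex_of_real (E i u * E j u) * (cnj (v i) * Z i j * w j)) has_integral
        (\<Sum>i<n. \<Sum>j<n. complex_of_real (max 0 (a - \<bar>l i - l j\<bar>)) * (cnj (v i) * Z i j * w j))) {p..q}"
      by (intro has_integral_sum has_integral_mult_left has_integral_of_real EE) auto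
    also have "(\<lambda>u. \<Sum>i<n. \<Sum>j<n. complex_of_real (E i u * E j u) * (cnj (v i) * Z i j * w j)) = ?I"
      by (simp add: mult_ac)
    also have "(\<Sum>i<n. \<Sum>j<n. complex_of_real (max 0 (a - \<bar>l i - l j\<bar>)) * (cnj (v i) * Z i j * w j)) =
        complex_of_real a * (\<Sum>i<n. \<Sum>j<n. cnj (v i) * (complex_of_real (?tri i j) * Z i j) * w j)"
      unfolding sum_distrib_left at[symmetric] by (intro sum.cong refl) (simp only: of_real_mult mult_ac)
    finally have I: "(?I has_integral complex_of_real a *
        (\<Sum>i<n. \<Sum>j<n. cnj (v i) * (complex_of_real (?tri i j) * Z i j) * w j)) {p..q}" .
    have g: "(?g has_integral K * ((\<Sum>i<n. (cmod (v i))\<^sup>2 * a) + (\<Sum>j<n. (cmod (w j))\<^sup>2 * a)) / 2) {p..q}"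
      by (intro has_integral_divide has_integral_mult_right has_integral_add has_integral_sum E1) auto
    \<comment> \<open>At the parameter \<open>u\<close> both test vectors are cut down to the
      indices with \<open>l i\<close> in \<open>[u - a, u]\<close>. Since \<open>E\<close> takes the
      values 0 and 1, it equals its square.\<close>
    have le: "cmod (?I u) \<le> ?g u" for u
    proof -
      have "(cmod (complex_of_real (E i u) * x))\<^sup>2 = (cmod x)\<^sup>2 * E i u" for i x
        unfolding E_def by (auto simp: norm_mult)
      then show ?thesis
        using form_bdD[OF Z, of "\<lambda>i. complex_of_real (E i u) * v i" "\<lambda>j. complex_of_real (E j u) * w j"] by simp
    qed
    have "cmod (integral {p..q} ?I) \<le> integral {p..q} ?g"
      by (rule integral_norm_bound_integral) (use I g le in \<open>auto simp: integrable_on_def\<close>)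
    then have "a * cmod (\<Sum>i<n. \<Sum>j<n. cnj (v i) * (complex_of_real (?tri i j) * Z i j) * w j) \<le>
        K * ((\<Sum>i<n. (cmod (v i))\<^sup>2 * a) + (\<Sum>j<n. (cmod (w j))\<^sup>2 * a)) / 2"
      unfolding integral_unique[OF I] integral_unique[OF g] norm_mult using a by simp
    also have "\<dots> = a * (K * ?S / 2)"
      unfolding sum_distrib_right[symmetric] by (simp add: algebra_simps)
    finally show "cmod (\<Sum>i<n. \<Sum>j<n. cnj (v i) * (complex_of_real (?tri i j) * Z i j) * w j) \<le> K * ?S / 2"
      using a by simp
  qed
qed

text \<open>The values inside \<open>\<bar>s\<bar> < c\<close> are not a free choice: the whole
  function is the integral of \<open>6 * r\<close> times the triangle function over
  \<open>0 \<le> r \<le> 1 / c\<close>. As a positive superposition of triangles it is a Schur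
  multiplier with a bound free of the size, and beyond \<open>c\<close> it is exactly
  \<open>1 / s\<^sup>2\<close>.\<close>

definition inv_square_cutoff :: "real \<Rightarrow> real \<Rightarrow> real" where
  "inv_square_cutoff c s = (if \<bar>s\<bar> \<ge> c then 1 / s\<^sup>2 else 3 / c\<^sup>2 - 2 * \<bar>s\<bar> / c ^ 3)"

text \<open>The integrand has the primitive \<open>3 r\<^sup>2 - 2 \<bar>s\<bar> r\<^sup>3\<close>
  up to \<open>r = 1 / \<bar>s\<bar>\<close> and vanishes from there on. For
  \<open>\<bar>s\<bar> \<ge> c\<close> that point lies within the range of integration.\<close>

lemma has_integral_inv_square_cutoff:
  assumes c: "c > 0"
  shows "((\<lambda>r. 6 * r * max 0 (1 - \<bar>s\<bar> * r)) has_integral inv_square_cutoff c s) {0..1/c}"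
proof -
  have main: "((\<lambda>r. 6 * r * max 0 (1 - \<bar>s\<bar> * r)) has_integral 3 * y\<^sup>2 - 2 * \<bar>s\<bar> * y ^ 3) {0..y}"
    if y: "y \<ge> 0" "\<bar>s\<bar> * y \<le> 1" for y
  proof -
    have "((\<lambda>r. 6 * r * max 0 (1 - \<bar>s\<bar> * r)) has_integral
        (3 * y\<^sup>2 - 2 * \<bar>s\<bar> * y ^ 3) - (3 * 0\<^sup>2 - 2 * \<bar>s\<bar> * 0 ^ 3)) {0..y}"
    proof (rule fundamental_theorem_of_calculus[OF y(1)])
      fix x assume x: "x \<in> {0..y}"
      then have "\<bar>s\<bar> * x \<le> 1" using y by (meson abs_ge_zero atLeastAtMost_iff mult_left_mono order_trans)
      then have e: "6 * x * max 0 (1 - \<bar>s\<bar> * x) = 6 * x - 6 * \<bar>s\<bar> * x\<^sup>2"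
        by (simp add: max_def power2_eq_square algebra_simps)
      show "((\<lambda>r. 3 * r\<^sup>2 - 2 * \<bar>s\<bar> * r ^ 3) has_vector_derivative 6 * x * max 0 (1 - \<bar>s\<bar> * x)) (at x within {0..y})"
        unfolding e has_real_derivative_iff_has_vector_derivative[symmetric]
        by (auto intro!: derivative_eq_intros simp: power2_eq_square)
    qed
    then show ?thesis by simp
  qed
  show ?thesis
  proof (cases "\<bar>s\<bar> \<ge> c")
    case True
    then have s: "\<bar>s\<bar> > 0" using c by simp
    have le: "1 / \<bar>s\<bar> \<le> 1 / c" using True c by (simp add: frac_le)
    have "((\<lambda>r. 6 * r * max 0 (1 - \<bar>s\<bar> * r)) has_integral 0) {1 / \<bar>s\<bar>..1 / c}"
    proof (rule has_integral_is_0)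
      fix r assume "r \<in> {1 / \<bar>s\<bar>..1 / c}"
      then have "1 \<le> \<bar>s\<bar> * r" using s by (simp add: field_simps)
      then show "6 * r * max 0 (1 - \<bar>s\<bar> * r) = 0" by simp
    qed
    moreover have "((\<lambda>r. 6 * r * max 0 (1 - \<bar>s\<bar> * r)) has_integral 1 / s\<^sup>2) {0..1 / \<bar>s\<bar>}"
    proof -
      have "3 * (1 / \<bar>s\<bar>)\<^sup>2 - 2 * \<bar>s\<bar> * (1 / \<bar>s\<bar>) ^ 3 = 1 / \<bar>s\<bar>\<^sup>2"
        using s by (simp add: power2_eq_square power3_eq_cube field_simps)
      then show ?thesis using main[of "1 / \<bar>s\<bar>"] s by simp
    qed
    ultimately have "((\<lambda>r. 6 * r * max 0 (1 - \<bar>s\<bar> * r)) has_integral 1 / s\<^sup>2 + 0) {0..1 / c}"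
      using le s by (intro has_integral_combine[of 0 "1 / \<bar>s\<bar>"]) auto
    then show ?thesis using True unfolding inv_square_cutoff_def by simp
  next
    case False
    then have "\<bar>s\<bar> * (1 / c) \<le> 1" using c by simp
    then have "((\<lambda>r. 6 * r * max 0 (1 - \<bar>s\<bar> * r)) has_integral 3 * (1/c)\<^sup>2 - 2 * \<bar>s\<bar> * (1/c) ^ 3) {0..1/c}"
      using c by (intro main) auto
    then show ?thesis using False unfolding inv_square_cutoff_def by (simp add: power_divide)
  qed
qed

text \<open>The constant comes from the crude estimate \<open>6 * r \<le> 6 / c\<close> on an
  interval of length \<open>1 / c\<close>.\<close>

lemma inv_square_cutoff_multiplier:
  fixes l :: "nat \<Rightarrow> real"
  assumes Z: "form_bd n Z K" and K: "K \<ge> 0" and c: "c > 0"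
  shows "form_bd n (\<lambda>i j. complex_of_real (inv_square_cutoff c (l i - l j)) * Z i j) (6 / c\<^sup>2 * K)"
proof -
  have "form_bd n (\<lambda>i j. complex_of_real (inv_square_cutoff c (l i - l j)) * Z i j) (6 / c * K * (1 / c - 0))"
  proof (rule form_bd_integral[where F = "\<lambda>r i j. complex_of_real (6 * r * max 0 (1 - \<bar>l i - l j\<bar> * r)) * Z i j"])
    fix r assume r: "r \<in> {0..1 / c}"
    have "form_bd n (\<lambda>i j. complex_of_real (6 * r) * (complex_of_real (max 0 (1 - \<bar>l i - l j\<bar> * r)) * Z i j))
        (cmod (complex_of_real (6 * r)) * K)"
      by (intro form_bd_scale triangle_multiplier Z K) (use r in auto)
    moreover have "cmod (complex_of_real (6 * r)) * K \<le> 6 / c * K"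
      using r K by (intro mult_right_mono) (auto simp: norm_mult)
    ultimately show "form_bd n (\<lambda>i j. complex_of_real (6 * r * max 0 (1 - \<bar>l i - l j\<bar> * r)) * Z i j) (6 / c * K)"
      unfolding of_real_mult mult.assoc by (rule form_bd_mono)
  next
    fix i j
    show "((\<lambda>r. complex_of_real (6 * r * max 0 (1 - \<bar>l i - l j\<bar> * r)) * Z i j) has_integral
        complex_of_real (inv_square_cutoff c (l i - l j)) * Z i j) {0..1 / c}"
      by (intro has_integral_mult_left has_integral_of_real has_integral_inv_square_cutoff c)
  qed (use c K in auto)
  then show ?thesis by (simp add: power2_eq_square mult_ac)
qed

text \<open>This is conjugation by a diagonal unitary, read off on the entries.\<close>

lemma unimodular_diff_multiplier:
  fixes l :: "nat \<Rightarrow> real"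
  assumes "form_bd n X K" "K \<ge> 0"
  shows "form_bd n (\<lambda>i j. expi (t * (l i - l j)) * X i j) K"
proof -
  have "form_bd n (\<lambda>i j. expi (t * l i) * X i j * expi (- t * l j)) K"
    by (rule form_bd_diag_mult[OF assms]) (simp_all add: norm_exp_eq_Re)
  moreover have "expi (t * l i) * x * expi (- t * l j) =
      expi (t * (l i - l j)) * x" for x i j
  proof -
    have "expi (t * l i) * expi (- t * l j) =
        expi (t * (l i - l j))"
      unfolding exp_add[symmetric] by (simp add: algebra_simps)
    then show ?thesis by (simp only: mult_ac)
  qed
  ultimately show ?thesis by (simp only:)
qed

text \<open>The closed form of the mean of \<open>expi (t * s)\<close> over
  \<open>0 \<le> t \<le> T\<close>.\<close>

definition exp_mean :: "real \<Rightarrow> real \<Rightarrow> complex" where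
  "exp_mean T s = (if s = 0 then 1 else (expi (T * s) - 1) / (\<i> * complex_of_real (T * s)))"

lemma has_integral_exp_mean:
  assumes T: "T > 0"
  shows "((\<lambda>t. expi (t * s)) has_integral complex_of_real T * exp_mean T s) {0..T}"
proof (cases "s = 0")
  case True
  then show ?thesis using has_integral_const_real[of "1::complex" 0 T] T
    by (simp add: exp_mean_def scaleR_conv_of_real)
next
  case False
  have "((\<lambda>t. expi (t * s)) has_integral
     expi (T * s) / (\<i> * complex_of_real s) - expi (0 * s) / (\<i> * complex_of_real s)) {0..T}"
  proof (rule fundamental_theorem_of_calculus)
    fix x assume "x \<in> {0..T}"
    have "((\<lambda>t. complex_of_real t) has_vector_derivative 1) (at x within {0..T})" 
      using has_vector_derivative_of_real[OF DERIV_ident] by simp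
    from has_vector_derivative_mult_right[OF this, of "\<i> * complex_of_real s"]
    have "((\<lambda>t. \<i> * complex_of_real (t * s)) has_vector_derivative \<i> * complex_of_real s) (at x within {0..T})"
      by (simp add: mult_ac)
    from field_vector_diff_chain_within[OF this DERIV_subset[OF DERIV_exp subset_UNIV], unfolded o_def]
    have "((\<lambda>t. expi (t * s)) has_vector_derivative
        (\<i> * complex_of_real s) * expi (x * s)) (at x within {0..T})"
      .
    from has_vector_derivative_divide[OF this, of "\<i> * complex_of_real s"]
    show "((\<lambda>t. expi (t * s) / (\<i> * complex_of_real s)) has_vector_derivative
        expi (x * s)) (at x within {0..T})"
      using False by simp
  qed (use T in simp)
  moreover have "expi (T * s) / (\<i> * complex_of_real s) - expi (0 * s) / (\<i> * complex_of_real s) =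
      complex_of_real T * exp_mean T s"
    using False T by (simp add: exp_mean_def field_simps)
  ultimately show ?thesis by (simp only:)
qed

text \<open>The mean times its frequency is a difference of two exponentials. This is how a factor
  \<open>s\<close>, which is not bounded uniformly, is exchanged for something that the hypotheses
  control.\<close>

lemma exp_mean_times: "T > 0 \<Longrightarrow> \<i> * complex_of_real (T * s) * exp_mean T s = expi (T * s) - 1"
  unfolding exp_mean_def by simp

text \<open>Averaging differences that are all of size \<open>w\<close> keeps the size. The array
  \<open>d\<close> is arbitrary, since it is also used with eigenvalue differences offset by a
  constant.\<close>

lemma exp_mean_approx:
  fixes d :: "nat \<Rightarrow> nat \<Rightarrow> real"
  assumes T: "T > 0" and w: "w \<ge> 0"
    and X: "\<And>t. t \<in> {0..T} \<Longrightarrow> form_bd n (\<lambda>i j. (expi (t * d i j) - 1) * X i j) w"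
  shows "form_bd n (\<lambda>i j. exp_mean T (d i j) * X i j - X i j) w"
proof -
  have "form_bd n (\<lambda>i j. (complex_of_real T * exp_mean T (d i j) - complex_of_real T) * X i j) (w * (T - 0))"
  proof (rule form_bd_integral[OF X])
    fix i j
    have "((\<lambda>t. 1 :: complex) has_integral complex_of_real T) {0..T}"
      using has_integral_const_real[of "1::complex" 0 T] T by (simp add: scaleR_conv_of_real)
    then show "((\<lambda>t. (expi (t * d i j) - 1) * X i j) has_integral
        (complex_of_real T * exp_mean T (d i j) - complex_of_real T) * X i j) {0..T}"
      by (intro has_integral_mult_left has_integral_diff has_integral_exp_mean T)
  qed (use T w in auto)
  from form_bd_scale[OF this, of "complex_of_real (1 / T)"]
  have "form_bd n (\<lambda>i j. complex_of_real (1 / T) * ((complex_of_real T * exp_mean T (d i j) - complex_of_real T) * X i j)) w"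
    using T by (simp add: norm_divide)
  moreover have "complex_of_real (1 / T) * ((complex_of_real T * exp_mean T (d i j) - complex_of_real T) * X i j) =
      exp_mean T (d i j) * X i j - X i j" for i j
    using T by (simp add: field_simps)
  ultimately show ?thesis by simp
qed

lemma exp_mean_multiplier:
  fixes l :: "nat \<Rightarrow> real"
  assumes T: "T > 0" and K: "K \<ge> 0" and X: "form_bd n X K"
  shows "form_bd n (\<lambda>i j. exp_mean T (l i - l j) * X i j) K"
proof -
  have "form_bd n (\<lambda>i j. (complex_of_real T * exp_mean T (l i - l j)) * X i j) (K * (T - 0))"
  proof (rule form_bd_integral[OF unimodular_diff_multiplier[OF X K]])
    fix i j
    show "((\<lambda>t. expi (t * (l i - l j)) * X i j) has_integral
        (complex_of_real T * exp_mean T (l i - l j)) * X i j) {0..T}"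
      by (intro has_integral_mult_left has_integral_exp_mean T)
  qed (use T K in auto)
  from form_bd_scale[OF this, of "complex_of_real (1 / T)"]
  show ?thesis using T by (simp add: norm_divide)
qed

text \<open>If \<open>X\<close> moves little under the unitary group of \<open>l\<close>, then its mean over \<open>[0, T]\<close>, taken twice, is
  close to \<open>X\<close>, and the part of this mean beyond \<open>c\<close> is its second derivative multiplied by
  \<open>1 / s\<^sup>2\<close>, which is small.\<close>

lemma band_limited_approximation:
  fixes l :: "nat \<Rightarrow> real"
  assumes T: "T > 0" and c: "c > 0" and w: "w \<ge> 0"
    and X: "\<And>t. t \<in> {0..T} \<Longrightarrow> form_bd n (\<lambda>i j. (expi (t * (l i - l j)) - 1) * X i j) w"
  shows "\<exists>Z. (\<forall>i j. \<bar>l i - l j\<bar> \<ge> c \<longrightarrow> Z i j = 0) \<and>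
     form_bd n (\<lambda>i j. X i j - Z i j) (2 * w + 6 / c\<^sup>2 * (2 * w / T\<^sup>2))"
proof -
  define \<phi> where "\<phi> i j = exp_mean T (l i - l j)" for i j
  define s where "s i j = complex_of_real (l i - l j)" for i j
  define e where "e i j = expi (T * (l i - l j)) - 1" for i j
  define A where "A i j = complex_of_real (inv_square_cutoff c (l i - l j))" for i j
  \<comment> \<open>Beyond \<open>c\<close> the function \<open>A\<close> is
    \<open>1 / s\<^sup>2\<close>, so the factor \<open>1 - s\<^sup>2 A\<close> vanishes there and
    \<open>Z\<close> is a band matrix. The mean is squared because each of the two factors
    \<open>s\<close> has to be paid for by one mean.\<close>
  define Z where "Z i j = \<phi> i j ^ 2 * (1 - s i j ^ 2 * A i j) * X i j" for i j
  have 1: "form_bd n (\<lambda>i j. \<phi> i j * X i j - X i j) w"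
    unfolding \<phi>_def by (rule exp_mean_approx[OF T w X])
  have 2: "form_bd n (\<lambda>i j. \<phi> i j * (\<phi> i j * X i j - X i j)) w"
    unfolding \<phi>_def[of i j for i j] by (rule exp_mean_multiplier[OF T w 1[unfolded \<phi>_def]])
  have 3: "form_bd n (\<lambda>i j. e i j * X i j) w" unfolding e_def using X[of T] T by simp
  have 4: "form_bd n (\<lambda>i j. e i j * (e i j * X i j)) (w + w)"
  proof -
    have "form_bd n (\<lambda>i j. expi (T * (l i - l j)) * (e i j * X i j) - e i j * X i j) (w + w)"
      by (intro form_bd_diff 3 unimodular_diff_multiplier w)
    then show ?thesis unfolding e_def by (simp add: algebra_simps)
  qed
  \<comment> \<open>Since \<open>e = \<i> T s \<phi>\<close>, the product
    \<open>s\<^sup>2 \<phi>\<^sup>2 X\<close> is \<open>- e\<^sup>2 X / T\<^sup>2\<close>: no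
    unbounded frequency remains.\<close>
  have 5: "form_bd n (\<lambda>i j. s i j ^ 2 * \<phi> i j ^ 2 * X i j) (2 * w / T\<^sup>2)"
  proof -
    have "form_bd n (\<lambda>i j. complex_of_real (- 1 / T\<^sup>2) * (e i j * (e i j * X i j)))
        (cmod (complex_of_real (- 1 / T\<^sup>2)) * (w + w))"
      by (rule form_bd_scale[OF 4])
    moreover have "complex_of_real (- 1 / T\<^sup>2) * (e i j * (e i j * X i j)) = s i j ^ 2 * \<phi> i j ^ 2 * X i j" for i j
    proof -
      have "e i j = \<i> * complex_of_real T * s i j * \<phi> i j"
        unfolding e_def \<phi>_def s_def using exp_mean_times[OF T, of "l i - l j"] by (simp add: mult_ac)
      then show ?thesis using T by (simp add: power2_eq_square field_simps)
    qed
    moreover have "cmod (complex_of_real (- 1 / T\<^sup>2)) * (w + w) = 2 * w / T\<^sup>2"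
      unfolding norm_of_real using T by simp
    ultimately show ?thesis by simp
  qed
  have 6: "form_bd n (\<lambda>i j. A i j * (s i j ^ 2 * \<phi> i j ^ 2 * X i j)) (6 / c\<^sup>2 * (2 * w / T\<^sup>2))"
    unfolding A_def by (rule inv_square_cutoff_multiplier[OF 5 _ c]) (use w in simp)
  \<comment> \<open>The two mean errors telescope: \<open>(\<phi> X - X) + \<phi> (\<phi> X - X) =
    \<phi>\<^sup>2 X - X\<close>.\<close>
  have "form_bd n (\<lambda>i j. A i j * (s i j ^ 2 * \<phi> i j ^ 2 * X i j) - ((\<phi> i j * X i j - X i j) + \<phi> i j * (\<phi> i j * X i j - X i j)))
      (6 / c\<^sup>2 * (2 * w / T\<^sup>2) + (w + w))"
    by (intro form_bd_diff form_bd_add 1 2 6)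
  moreover have "A i j * (s i j ^ 2 * \<phi> i j ^ 2 * X i j) - ((\<phi> i j * X i j - X i j) + \<phi> i j * (\<phi> i j * X i j - X i j)) = X i j - Z i j" for i j
    unfolding Z_def by (simp add: algebra_simps power2_eq_square)
  ultimately have "form_bd n (\<lambda>i j. X i j - Z i j) (2 * w + 6 / c\<^sup>2 * (2 * w / T\<^sup>2))"
    by (simp add: add.commute)
  moreover have "Z i j = 0" if "\<bar>l i - l j\<bar> \<ge> c" for i j
  proof -
    have "s i j ^ 2 * A i j = complex_of_real ((l i - l j)\<^sup>2 * (1 / (l i - l j)\<^sup>2))"
      unfolding s_def A_def inv_square_cutoff_def using that by (simp only: of_real_mult of_real_power if_True)
    also have "(l i - l j)\<^sup>2 * (1 / (l i - l j)\<^sup>2) = 1" using that c by auto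
    finally show ?thesis unfolding Z_def by simp
  qed
  ultimately show ?thesis by blast
qed

text \<open>A self-improving estimate. Let \<open>N\<close> be the norm of \<open>X\<close> and let
  \<open>R\<close> dominate all \<open>q i\<close>. Adding \<open>(R - q i) X\<close>, of norm at
  most \<open>R N\<close>, replaces the coefficient by \<open>p j + d + R\<close>, which depends on
  the column only and is at least \<open>d + R\<close>. Dividing it out gives
  \<open>(d + R) N \<le> K + R N\<close>, hence \<open>d N \<le> K\<close>.\<close>

lemma sylvester_bound:
  fixes p q :: "nat \<Rightarrow> real"
  assumes p: "\<And>j. j < n \<Longrightarrow> p j \<ge> 0" and q: "\<And>i. i < n \<Longrightarrow> q i \<ge> 0" and d: "d > 0" and K: "K \<ge> 0"
    and Y: "form_bd n (\<lambda>i j. complex_of_real (p j + q i + d) * X i j) K"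
  shows "form_bd n X (K / d)"
proof -
  define M where "M = mat n n (\<lambda>(i,j). X i j)"
  define N where "N = mat_op_norm M"
  have M: "M \<in> carrier_mat n n" unfolding M_def by simp
  have N0: "N \<ge> 0" unfolding N_def by (rule mat_op_norm_nonneg[OF M])
  have X_iff: "form_bd n X B \<longleftrightarrow> N \<le> B" if "B \<ge> 0" for B
    unfolding N_def mat_op_norm_le_iff[OF M that] by (rule form_bd_cong) (simp add: M_def)
  have XN: "form_bd n X N" using X_iff[OF N0] by simp
  \<comment> \<open>The summand 1 keeps \<open>R\<close> positive when all \<open>q i\<close>
    vanish.\<close>
  define R where "R = (\<Sum>i<n. q i) + 1"
  have R: "R > 0" unfolding R_def by (intro add_nonneg_pos sum_nonneg) (use q in auto)
  have qR: "q i \<le> R" if "i < n" for i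
    unfolding R_def using member_le_sum[of i "{..<n}" q] q that by auto
  have 1: "form_bd n (\<lambda>i j. complex_of_real ((R - q i) / R) * X i j * 1) N"
    by (rule form_bd_diag_mult[OF XN N0]) (use q qR R in \<open>auto simp: norm_divide simp flip: of_real_diff\<close>)
  have 2: "form_bd n (\<lambda>i j. complex_of_real (p j + q i + d) * X i j + complex_of_real R * (complex_of_real ((R - q i) / R) * X i j * 1))
      (K + cmod (complex_of_real R) * N)"
    by (intro form_bd_add form_bd_scale 1 Y)
  have "complex_of_real (p j + q i + d) * X i j + complex_of_real R * (complex_of_real ((R - q i) / R) * X i j * 1) =
      complex_of_real (p j + d + R) * X i j" for i j
    using R by (simp add: field_simps)
  then have 3: "form_bd n (\<lambda>i j. complex_of_real (p j + d + R) * X i j) (K + R * N)" using 2 R by simp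
  have "form_bd n (\<lambda>i j. 1 * (complex_of_real (p j + d + R) * X i j) * complex_of_real ((d + R) / (p j + d + R))) (K + R * N)"
  proof (rule form_bd_diag_mult[OF 3])
    show "K + R * N \<ge> 0" using K R N0 by simp
    fix j assume "j < n"
    then show "cmod (complex_of_real ((d + R) / (p j + d + R))) \<le> 1" using p[of j] d R
      unfolding norm_of_real by (simp add: field_simps)
  qed simp
  moreover have eq: "1 * (complex_of_real (p j + d + R) * X i j) * complex_of_real ((d + R) / (p j + d + R)) = complex_of_real (d + R) * X i j"
    if "i < n" "j < n" for i j
  proof -
    have "p j + d + R \<noteq> 0" using p[OF that(2)] d R by auto
    then show ?thesis by (simp add: field_simps flip: of_real_add)
  qed
  ultimately have "form_bd n (\<lambda>i j. complex_of_real (d + R) * X i j) (K + R * N)"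
    using form_bd_cong[of n "\<lambda>i j. 1 * (complex_of_real (p j + d + R) * X i j) * complex_of_real ((d + R) / (p j + d + R))"
        "\<lambda>i j. complex_of_real (d + R) * X i j", OF eq] by (simp only:)
  from form_bd_scale[OF this, of "complex_of_real (1 / (d + R))"]
  have "form_bd n (\<lambda>i j. complex_of_real (1 / (d + R)) * (complex_of_real (d + R) * X i j)) ((K + R * N) / (d + R))"
    using d R by (simp add: norm_divide flip: of_real_add)
  moreover have "complex_of_real (1 / (d + R)) * (complex_of_real (d + R) * x) = x" for x
    unfolding mult.assoc[symmetric] of_real_mult[symmetric] using d R by simp
  ultimately have "form_bd n X ((K + R * N) / (d + R))" by simp
  then have "N \<le> (K + R * N) / (d + R)" by (subst (asm) X_iff) (use K R N0 d in auto)
  then have "N * d \<le> K" using d R by (simp add: field_simps)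
  then have "N \<le> K / d" using d by (simp add: field_simps)
  then show ?thesis using X_iff[of "K / d"] K d by simp
qed

text \<open>The mean of \<open>a\<close> over \<open>[0, T]\<close> solves a Sylvester equation with coefficients
  \<open>m j - m i + L\<close>, and these are at least \<open>L / 2\<close> on the entries in question.\<close>

lemma spectral_raising_bound:
  fixes m :: "nat \<Rightarrow> real"
  assumes L: "L > 0" and T: "T > 0" and K: "K \<ge> 0"
    and a: "\<And>t. t \<in> {0..T} \<Longrightarrow> form_bd n (\<lambda>i j. (expi (t * (m i - m j - L)) - 1) * a i j) K"
  shows "form_bd n (\<lambda>i j. if m i < s + L / 2 \<and> m j \<ge> s then a i j else 0) (K + 2 * K / (T * L))"
proof -
  define x where "x i j = exp_mean T (m i - m j - L) * a i j" for i j
  define f :: "nat \<Rightarrow> complex" where "f i = (if m i < s + L / 2 then 1 else 0)" for i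
  define g :: "nat \<Rightarrow> complex" where "g j = (if m j \<ge> s then 1 else 0)" for j
  have fg: "cmod (f i) \<le> 1" "cmod (g i) \<le> 1" for i unfolding f_def g_def by auto
  have 1: "form_bd n (\<lambda>i j. x i j - a i j) K" unfolding x_def by (rule exp_mean_approx[OF T K a])
  have 2: "form_bd n (\<lambda>i j. (\<i> / complex_of_real T) * ((expi (T * (m i - m j - L)) - 1) * a i j)) (K / T)"
    using form_bd_scale[OF a[of T], of "\<i> / complex_of_real T"] T by (simp add: norm_divide)
  have e: "(\<i> / complex_of_real T) * ((expi (T * (m i - m j - L)) - 1) * a i j) =
      complex_of_real (m j - m i + L) * x i j" for i j
  proof -
    have "\<i> / complex_of_real T * (\<i> * complex_of_real (T * (m i - m j - L))) = complex_of_real (m j - m i + L)"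
      using T by (simp add: field_simps)
    then show ?thesis
      unfolding exp_mean_times[OF T, symmetric] x_def by (simp only: mult.assoc[symmetric])
  qed
  have 3: "form_bd n (\<lambda>i j. f i * (complex_of_real (m j - m i + L) * x i j) * g j) (K / T)"
    by (rule form_bd_diag_mult) (use 2[unfolded e] fg K T in auto)
  \<comment> \<open>On the selected entries \<open>m j - m i + L\<close> is the sum of
    \<open>m j - s\<close>, \<open>s + L / 2 - m i\<close> and \<open>L / 2\<close>, and the first
    two are non-negative. Truncation at 0 makes them non-negative for all indices, and on the other
    entries the matrix is zero.\<close>
  have 4: "form_bd n (\<lambda>i j. f i * x i j * g j) (K / T / (L / 2))"
  proof (rule sylvester_bound[where p = "\<lambda>j. max 0 (m j - s)" and q = "\<lambda>i. max 0 (s + L / 2 - m i)"])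
    have "complex_of_real (max 0 (m j - s) + max 0 (s + L / 2 - m i) + L / 2) * (f i * x i j * g j) =
      f i * (complex_of_real (m j - m i + L) * x i j) * g j" for i j :: nat
    proof (cases "m i < s + L / 2 \<and> m j \<ge> s")
      case True
      then have "max 0 (m j - s) + max 0 (s + L / 2 - m i) + L / 2 = m j - m i + L" by simp
      then show ?thesis by (simp only: mult_ac)
    qed (auto simp: f_def g_def)
    then show "form_bd n (\<lambda>i j. complex_of_real (max 0 (m j - s) + max 0 (s + L / 2 - m i) + L / 2) * (f i * x i j * g j)) (K / T)"
      using 3 by (simp only:)
  qed (use L T K in auto)
  have 5: "form_bd n (\<lambda>i j. f i * (x i j - a i j) * g j) K"
    by (rule form_bd_diag_mult[OF 1 K]) (use fg in auto)
  have "form_bd n (\<lambda>i j. f i * x i j * g j - f i * (x i j - a i j) * g j) (K / T / (L / 2) + K)"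
    by (rule form_bd_diff[OF 4 5])
  moreover have "f i * x i j * g j - f i * (x i j - a i j) * g j = (if m i < s + L / 2 \<and> m j \<ge> s then a i j else 0)" for i j
    unfolding f_def g_def by auto
  moreover have "K / T / (L / 2) + K = K + 2 * K / (T * L)" by (simp add: field_simps)
  ultimately show ?thesis by (simp only:)
qed

section \<open>Gaps of the spectrum\<close>

definition thicken :: "real set \<Rightarrow> real \<Rightarrow> real set" where
  "thicken S c = {s + r | s r. s \<in> S \<and> 0 \<le> r \<and> r \<le> c}"

lemma thicken_iff: "x \<in> thicken S c \<longleftrightarrow> (\<exists>s\<in>S. s \<le> x \<and> x \<le> s + c)"
proof
  assume "\<exists>s\<in>S. s \<le> x \<and> x \<le> s + c"
  then obtain s where "s \<in> S" "s \<le> x" "x \<le> s + c" by blast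
  then have "x = s + (x - s) \<and> s \<in> S \<and> 0 \<le> x - s \<and> x - s \<le> c" by simp
  then show "x \<in> thicken S c" unfolding thicken_def by blast
next
  assume "x \<in> thicken S c"
  then obtain s r where s: "x = s + r" "s \<in> S" "0 \<le> r" "r \<le> c" unfolding thicken_def by blast
  then have "s \<le> x" "x \<le> s + c" by simp_all
  with s show "\<exists>s\<in>S. s \<le> x \<and> x \<le> s + c" by blast
qed

lemma thickenI: "s \<in> S \<Longrightarrow> s \<le> x \<Longrightarrow> x \<le> s + c \<Longrightarrow> x \<in> thicken S c"
  unfolding thicken_iff by blast

lemma thicken_interval: "s \<in> S \<Longrightarrow> {s..s + c} \<subseteq> thicken S c"
  by (rule subsetI, erule thickenI) (simp_all only: atLeastAtMost_iff)

lemma Icc_subset_shrink: "{a..b'} \<subseteq> A \<Longrightarrow> b \<le> (b' :: real) \<Longrightarrow> {a..b} \<subseteq> A"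
  by (rule subset_trans[of _ "{a..b'}"]) simp_all

lemma thicken_extend_right:
  assumes "{a..l} \<subseteq> thicken S c" "l \<in> S"
  shows "{a..l + c} \<subseteq> thicken S c"
proof
  fix x assume x: "x \<in> {a..l + c}"
  show "x \<in> thicken S c"
  proof (cases "x \<le> l")
    case True
    then have "x \<in> {a..l}" using x by simp
    then show ?thesis using assms(1) by blast
  next
    case False
    show ?thesis by (rule thickenI[OF assms(2)]) (use x False in simp_all)
  qed
qed

text \<open>Every interval in the thickened set can be enlarged until it starts at a point
  \<open>m\<close> of the spectrum and ends at \<open>v + c\<close> with \<open>v\<close> in the
  spectrum. Only finitely many values \<open>v - m\<close> compete, so the greatest one
  exists.\<close>

lemma ell_greatest:
  assumes S: "finite (real_spectrum h)" "real_spectrum h \<noteq> {}" and c: "c > 0"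
  shows "\<exists>a b. a \<le> b \<and> {a..b} \<subseteq> thicken (real_spectrum h) c \<and> ell h c = b - a - c"
    and "\<And>a b. a \<le> b \<Longrightarrow> {a..b} \<subseteq> thicken (real_spectrum h) c \<Longrightarrow> b - a - c \<le> ell h c"
proof -
  let ?S = "real_spectrum h"
  let ?P = "\<lambda>l. \<exists>a b. a \<le> b \<and> {a..b} \<subseteq> thicken ?S c \<and> l = b - a - c"
  define D where "D = {v - m | m v. m \<in> ?S \<and> v \<in> ?S \<and> m \<le> v \<and> {m..v + c} \<subseteq> thicken ?S c}"
  have "D \<subseteq> (\<lambda>(m,v). v - m) ` (?S \<times> ?S)"
  proof
    fix x assume "x \<in> D"
    then obtain m v where "m \<in> ?S" "v \<in> ?S" "x = v - m" unfolding D_def by blast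
    then show "x \<in> (\<lambda>(m,v). v - m) ` (?S \<times> ?S)" by (intro image_eqI[of _ _ "(m, v)"]) simp_all
  qed
  then have fin: "finite D" by (rule finite_subset) (use S in simp)
  obtain s where s: "s \<in> ?S" using S by auto
  have zero: "0 \<in> D"
  proof -
    have "s - s \<in> D" unfolding D_def using s thicken_interval[OF s, of c] by blast
    then show ?thesis by simp
  qed
  have PM: "?P (Max D)"
  proof -
    have "Max D \<in> D" using fin zero by (intro Max_in) auto
    then obtain m v where mv: "m \<le> v" "{m..v + c} \<subseteq> thicken ?S c" "Max D = v - m" unfolding D_def by blast
    then have "m \<le> v + c" "Max D = v + c - m - c" using c by simp_all
    then show ?thesis using mv(2) by blast
  qed
  have le: "l \<le> Max D" if P: "?P l" for l
  proof -
    obtain a b where ab: "a \<le> b" "{a..b} \<subseteq> thicken ?S c" "l = b - a - c" using P by blast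
    have "a \<in> {a..b}" "b \<in> {a..b}" using ab(1) by simp_all
    then have "a \<in> thicken ?S c" "b \<in> thicken ?S c" using ab(2) by blast+
    then obtain m v where m: "m \<in> ?S" "m \<le> a" "a \<le> m + c" and v: "v \<in> ?S" "v \<le> b" "b \<le> v + c"
      unfolding thicken_iff by blast
    show ?thesis
    proof (cases "m \<le> v")
      case True
      have "{m..v + c} \<subseteq> thicken ?S c"
      proof
        fix x assume x: "x \<in> {m..v + c}"
        consider "x \<le> a" | "a \<le> x" "x \<le> b" | "b \<le> x" by linarith
        then show "x \<in> thicken ?S c"
        proof cases
          case 1
          then have "m \<le> x" "x \<le> m + c" using x m by simp_all
          then show ?thesis by (rule thickenI[OF m(1)])
        next
          case 2
          then have "x \<in> {a..b}" by simp
          then show ?thesis using ab(2) by blast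
        next
          case 3
          then have "v \<le> x" "x \<le> v + c" using x v by simp_all
          then show ?thesis by (rule thickenI[OF v(1)])
        qed
      qed
      then have "v - m \<in> D" unfolding D_def using True m(1) v(1) by blast
      then have "v - m \<le> Max D" using fin by simp
      then show ?thesis using ab m v by simp
    next
      case False
      \<comment> \<open>Here \<open>b \<le> v + c < m + c \<le> a + c\<close>, so \<open>l\<close>
        is negative, while 0 is in \<open>D\<close>.\<close>
      then show ?thesis using ab m v Max_ge[OF fin zero] by linarith
    qed
  qed
  have G: "ell h c = Max D"
    unfolding ell_def thicken_def[symmetric] by (rule Greatest_equality, rule PM, rule le)
  show "?P (ell h c)" unfolding G by (rule PM)
  show "b - a - c \<le> ell h c" if "a \<le> b" "{a..b} \<subseteq> thicken ?S c" for a b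
    unfolding G by (rule le) (use that in blast)
qed


text \<open>For \<open>l\<close> in a finite \<open>S\<close>, the component of \<open>l\<close> in
  the thickened set begins at a point of \<open>S\<close>, so its left end is a minimum over
  finitely many candidates.\<close>

definition component_start :: "real set \<Rightarrow> real \<Rightarrow> real \<Rightarrow> real" where
  "component_start S c l = Min {m \<in> S. m \<le> l \<and> {m..l} \<subseteq> thicken S c}"

lemma component_start:
  assumes S: "finite S" and l: "l \<in> S" and c: "c > 0"
  shows "component_start S c l \<in> S" "component_start S c l \<le> l"
    "{component_start S c l..l + c} \<subseteq> thicken S c"
proof -
  let ?M = "{m \<in> S. m \<le> l \<and> {m..l} \<subseteq> thicken S c}"
  have "{l..l} \<subseteq> thicken S c" by (rule Icc_subset_shrink[OF thicken_interval[OF l]]) (use c in simp)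
  then have "l \<in> ?M" using l by auto
  then have "Min ?M \<in> ?M" using S by (intro Min_in) auto
  then show "component_start S c l \<in> S" "component_start S c l \<le> l"
    "{component_start S c l..l + c} \<subseteq> thicken S c"
    unfolding component_start_def using thicken_extend_right[OF _ l] by auto
qed

text \<open>A covered interval that ends at a point of \<open>S\<close> extends to the right by
  \<open>c\<close>, hence reaches any neighbour within \<open>c\<close>. So the start belonging to
  one of the two points is a candidate for the other.\<close>

lemma component_start_eq:
  assumes S: "finite S" and l: "l \<in> S" "l' \<in> S" and c: "c > 0" and near: "\<bar>l - l'\<bar> \<le> c"
  shows "component_start S c l = component_start S c l'"
proof -
  have *: "component_start S c l = component_start S c l'"
    if l: "l \<in> S" "l' \<in> S" and le: "l \<le> l'" "l' \<le> l + c" for l l'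
  proof (rule antisym)
    let ?M = "\<lambda>l. {m \<in> S. m \<le> l \<and> {m..l} \<subseteq> thicken S c}"
    have "{component_start S c l..l'} \<subseteq> thicken S c"
      by (rule Icc_subset_shrink[OF component_start(3)[OF S l(1) c]]) (use le in simp)
    then have "component_start S c l \<in> ?M l'"
      using component_start[OF S l(1) c] le by auto
    then show ge: "component_start S c l' \<le> component_start S c l"
      unfolding component_start_def[of S c l'] using S by (intro Min_le) auto
    have "{component_start S c l'..l} \<subseteq> thicken S c"
      by (rule Icc_subset_shrink[OF component_start(3)[OF S l(2) c]]) (use le c in simp)
    then have "component_start S c l' \<in> ?M l"
      using component_start[OF S l(2) c] component_start[OF S l(1) c] ge by auto
    then show "component_start S c l \<le> component_start S c l'"
      unfolding component_start_def[of S c l] using S by (intro Min_le) auto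
  qed
  show ?thesis using *[of l l'] *[of l' l] l near by linarith
qed

text \<open>Greedy choice. The point \<open>x N + L + c\<close> still lies in the covered interval,
  so some point of \<open>S\<close> lies at most \<open>c\<close> below it, and this makes the gap
  at least \<open>L\<close> and at most \<open>L + c\<close>. The two bounds on \<open>x k\<close>
  keep the next target between \<open>a\<close> and \<open>b\<close>.\<close>

lemma thicken_chain:
  assumes ab: "{a..b} \<subseteq> thicken S c" and c: "c > 0" and L: "L > 0"
    and N: "a + real N * (L + c) \<le> b"
  shows "\<exists>x :: nat \<Rightarrow> real. (\<forall>k\<le>N. x k \<in> S \<and> a - c \<le> x k \<and> x k \<le> a + real k * (L + c)) \<and>
     (\<forall>k<N. L \<le> x (Suc k) - x k \<and> x (Suc k) - x k \<le> L + c)"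
  using N
proof (induction N)
  case 0
  then have "a \<in> thicken S c" using ab by auto
  then obtain s where "s \<in> S" "s \<le> a" "a \<le> s + c" by (auto simp: thicken_iff)
  then show ?case by (intro exI[of _ "\<lambda>_. s"]) auto
next
  case (Suc N)
  have "real N * (L + c) \<le> real (Suc N) * (L + c)" using L c by (intro mult_right_mono) auto
  then have "a + real N * (L + c) \<le> b" using Suc.prems by linarith
  from Suc.IH[OF this] obtain x :: "nat \<Rightarrow> real" where
    x: "\<forall>k\<le>N. x k \<in> S \<and> a - c \<le> x k \<and> x k \<le> a + real k * (L + c)"
    and gap: "\<forall>k<N. L \<le> x (Suc k) - x k \<and> x (Suc k) - x k \<le> L + c" by blast
  define y where "y = x N + L + c"
  have xN: "a - c \<le> x N" "x N \<le> a + real N * (L + c)" using x by auto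
  have y: "y \<le> a + real (Suc N) * (L + c)" unfolding y_def using xN by (simp add: algebra_simps)
  have "a \<le> y" unfolding y_def using xN L by simp
  then have "y \<in> thicken S c" using ab y Suc.prems by auto
  then obtain s where s: "s \<in> S" "s \<le> y" "y \<le> s + c" by (auto simp: thicken_iff)
  have s2: "L \<le> s - x N" "s - x N \<le> L + c" using s unfolding y_def by auto
  show ?case
  proof (intro exI[of _ "x(Suc N := s)"] conjI allI impI)
    fix k assume k: "k \<le> Suc N"
    show "(x(Suc N := s)) k \<in> S" using x s k by auto
    show "a - c \<le> (x(Suc N := s)) k" using x s2 xN L k by (auto simp: le_Suc_eq)
    show "(x(Suc N := s)) k \<le> a + real k * (L + c)" using x s y k by (auto simp: le_Suc_eq)
  next
    fix k assume k: "k < Suc N"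
    show "L \<le> (x(Suc N := s)) (Suc k) - (x(Suc N := s)) k"
      using gap s2 k by (auto simp: less_Suc_eq)
    show "(x(Suc N := s)) (Suc k) - (x(Suc N := s)) k \<le> L + c"
      using gap s2 k by (auto simp: less_Suc_eq)
  qed
qed

lemma real_spectrum_diag:
  assumes U: "unitary n U"
  shows "real_spectrum (conj_by U (rdiag n l)) = l ` {..<n}"
proof -
  let ?D = "rdiag n l"
  note Uc = unitaryD[OF U]
  have "similar_mat_wit (conj_by U ?D) ?D U (mat_adjoint U)"
    by (rule similar_mat_witI[of _ _ n]) (use Uc in \<open>auto simp: conj_by_def\<close>)
  then have "char_poly (conj_by U ?D) = char_poly ?D"
    by (intro char_poly_similar) (auto simp: similar_mat_def)
  also have "\<dots> = (\<Prod>a\<leftarrow>diag_mat ?D. [:- a, 1:])"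
    by (rule char_poly_upper_triangular[of _ n]) auto
  finally have cp: "char_poly (conj_by U ?D) = (\<Prod>a\<leftarrow>diag_mat ?D. [:- a, 1:])" .
  have "spectrum (conj_by U ?D) = {x. poly (\<Prod>a\<leftarrow>diag_mat ?D. [:- a, 1:]) x = 0}"
    using spectrum_root_char_poly[of "conj_by U ?D" n] Uc cp by simp
  also have "\<dots> = set (diag_mat ?D)" by (auto simp: poly_prod_list prod_list_zero_iff)
  also have "\<dots> = (\<lambda>i. complex_of_real (l i)) ` {..<n}"
    unfolding diag_mat_def by (force simp: image_iff)
  finally show ?thesis unfolding real_spectrum_def by auto
qed

section \<open>Unitary groups and shifts along a chain of eigenvalues\<close>

text \<open>The unitary group of \<open>conj_by U (rdiag n l)\<close>, written by functional
  calculus; \<open>matrix_alg_exp\<close> identifies it with the exponential series.\<close>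

definition uexp :: "nat \<Rightarrow> complex mat \<Rightarrow> (nat \<Rightarrow> real) \<Rightarrow> real \<Rightarrow> complex mat" where
  "uexp n U l t = conj_by U (diagm n (\<lambda>i. expi (t * l i)))"

lemma uexp_carrier [simp]: "U \<in> carrier_mat n n \<Longrightarrow> uexp n U l t \<in> carrier_mat n n"
  unfolding uexp_def by simp

lemma cnj_exp_ii: "cnj (expi x) = exp (- (\<i> * complex_of_real x))"
  using cis_cnj[of x] unfolding cis_conv_exp by simp

lemma exp_ii_cnj_mult: "expi x * cnj (expi y) = expi (x - y)"
  unfolding cnj_exp_ii exp_add[symmetric] by (simp add: algebra_simps)

lemma uexp_unitary:
  assumes U: "unitary n U"
  shows "unitary n (uexp n U l t)"
proof (rule unitary_adjoint[of n "mat_adjoint (uexp n U l t)", simplified], rule unitaryI)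
  note Uc = unitaryD[OF U]
  show "mat_adjoint (uexp n U l t) \<in> carrier_mat n n" using Uc by simp
  have "uexp n U l t * mat_adjoint (uexp n U l t) =
      conj_by U (diagm n (\<lambda>i. expi (t * l i) * cnj (expi (t * l i))))"
    unfolding uexp_def by (simp add: conj_by_adjoint[OF Uc(1)] conj_by_mult[OF U] diagm_adjoint diagm_mult)
  also have "\<dots> = 1\<^sub>m n" unfolding exp_ii_cnj_mult by (simp add: diagm_one conj_by_one[OF U])
  finally show "mat_adjoint (mat_adjoint (uexp n U l t)) * mat_adjoint (uexp n U l t) = 1\<^sub>m n" by simp
qed

text \<open>In the eigenbasis the evolution is a Schur multiplier in the eigenvalue differences. All
  norm estimates for the flows rest on this.\<close>

lemma conj_by_uexp_index:
  assumes U: "unitary n U" and X: "X \<in> carrier_mat n n" and ij: "i < n" "j < n"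
  shows "conj_by (mat_adjoint U) (conj_by (uexp n U l t) X) $$ (i,j) =
    expi (t * (l i - l j)) * conj_by (mat_adjoint U) X $$ (i,j)"
proof -
  note Uc = unitaryD[OF U]
  let ?D = "diagm n (\<lambda>i. expi (t * l i))"
  let ?Y = "conj_by (mat_adjoint U) X"
  have Y: "?Y \<in> carrier_mat n n" using Uc X by simp
  have "mat_adjoint U * uexp n U l t = ?D * mat_adjoint U"
  proof -
    have "mat_adjoint U * uexp n U l t = (mat_adjoint U * U) * (?D * mat_adjoint U)"
      unfolding uexp_def conj_by_def using Uc(1,2) by (simp add: assoc_square[of _ n])
    then show ?thesis using Uc by (simp add: left_mult_one_mat[of _ n n])
  qed
  then have "conj_by (mat_adjoint U) (conj_by (uexp n U l t) X) = conj_by ?D ?Y"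
    using Uc X by (simp add: conj_by_conj_by[of _ n])
  also have "\<dots> $$ (i,j) = expi (t * l i) * ?Y $$ (i,j) * cnj (expi (t * l j))"
    unfolding conj_by_def[of ?D] diagm_adjoint using Y ij
    by (simp add: diagm_mult_index[of _ n] del: index_mult_mat(1))
  also have "\<dots> = (expi (t * l i) * cnj (expi (t * l j))) * ?Y $$ (i,j)"
    by (simp only: mult_ac)
  finally show ?thesis unfolding exp_ii_cnj_mult by (simp only: right_diff_distrib)
qed

text \<open>The inequality of arithmetic and geometric means, applied to each entry, separates the
  two vectors; what remains are row sums for one and column sums for the other.\<close>

lemma schur_test:
  assumes r: "\<And>i. i < n \<Longrightarrow> (\<Sum>j<n. cmod (X i j)) \<le> K" and c: "\<And>j. j < n \<Longrightarrow> (\<Sum>i<n. cmod (X i j)) \<le> K"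
  shows "form_bd n X K"
  unfolding form_bd_def
proof (intro allI)
  fix v w :: "nat \<Rightarrow> complex"
  have "cmod (\<Sum>i<n. \<Sum>j<n. cnj (v i) * X i j * w j) \<le>
     (\<Sum>i<n. \<Sum>j<n. (cmod (X i j) * (cmod (v i))\<^sup>2 + cmod (X i j) * (cmod (w j))\<^sup>2) / 2)"
  proof (intro order_trans[OF norm_sum] sum_mono)
    fix i j
    have "cmod (v i) * cmod (w j) \<le> ((cmod (v i))\<^sup>2 + (cmod (w j))\<^sup>2) / 2"
      using sum_squares_bound[of "cmod (v i)" "cmod (w j)"] by simp
    from mult_left_mono[OF this norm_ge_zero[of "X i j"]]
    show "cmod (cnj (v i) * X i j * w j) \<le> (cmod (X i j) * (cmod (v i))\<^sup>2 + cmod (X i j) * (cmod (w j))\<^sup>2) / 2"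
      by (simp add: norm_mult algebra_simps)
  qed
  also have "\<dots> = ((\<Sum>i<n. \<Sum>j<n. cmod (X i j) * (cmod (v i))\<^sup>2) + (\<Sum>i<n. \<Sum>j<n. cmod (X i j) * (cmod (w j))\<^sup>2)) / 2"
    by (simp only: sum.distrib sum_divide_distrib[symmetric])
  also have "(\<Sum>i<n. \<Sum>j<n. cmod (X i j) * (cmod (w j))\<^sup>2) = (\<Sum>j<n. \<Sum>i<n. cmod (X i j) * (cmod (w j))\<^sup>2)"
    by (rule sum.swap)
  also have "((\<Sum>i<n. \<Sum>j<n. cmod (X i j) * (cmod (v i))\<^sup>2) + (\<Sum>j<n. \<Sum>i<n. cmod (X i j) * (cmod (w j))\<^sup>2)) / 2 \<le>
      ((\<Sum>i<n. K * (cmod (v i))\<^sup>2) + (\<Sum>j<n. K * (cmod (w j))\<^sup>2)) / 2"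
    unfolding sum_distrib_right[symmetric]
    by (intro divide_right_mono add_mono sum_mono mult_right_mono r c) auto
  finally show "cmod (\<Sum>i<n. \<Sum>j<n. cnj (v i) * X i j * w j)
     \<le> K * ((sqsum n v) + (sqsum n w)) / 2"
    by (simp add: sum_distrib_left distrib_left)
qed

lemma sum_at_most_one:
  fixes f :: "nat \<Rightarrow> real"
  assumes "\<And>i j. i < n \<Longrightarrow> j < n \<Longrightarrow> f i \<noteq> 0 \<Longrightarrow> f j \<noteq> 0 \<Longrightarrow> i = j"
    and "\<And>i. i < n \<Longrightarrow> f i \<le> K" and "K \<ge> 0"
  shows "(\<Sum>i<n. f i) \<le> K"
proof (cases "\<exists>i<n. f i \<noteq> 0")
  case True
  then obtain i where i: "i < n" "f i \<noteq> 0" by blast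
  have "(\<Sum>i<n. f i) = (\<Sum>j\<in>{i}. f j)"
    using i assms(1) by (intro sum.mono_neutral_right) auto
  then show ?thesis using assms(2)[OF i(1)] by simp
qed (use assms in \<open>simp add: sum.neutral\<close>)

definition shift_rel :: "nat \<Rightarrow> (nat \<Rightarrow> nat) \<Rightarrow> nat \<Rightarrow> nat \<Rightarrow> bool" where
  "shift_rel N \<sigma> i j \<longleftrightarrow> (\<exists>k<N. i = \<sigma> (Suc k) \<and> j = \<sigma> k)"

text \<open>The truncated shift in the eigenbasis: it moves basis vector \<open>\<sigma> k\<close>
  to \<open>\<sigma> (Suc k)\<close>. For \<open>\<sigma>\<close> injective on \<open>{..N}\<close>
  it is a partial isometry, and within the chain it kills only the last vector.\<close>

definition shift_mat :: "nat \<Rightarrow> nat \<Rightarrow> (nat \<Rightarrow> nat) \<Rightarrow> complex mat" where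
  "shift_mat n N \<sigma> = mat n n (\<lambda>(i,j). if shift_rel N \<sigma> i j then 1 else 0)"

lemma shift_mat_carrier [simp]: "shift_mat n N \<sigma> \<in> carrier_mat n n"
  unfolding shift_mat_def by simp

lemma shift_mat_index: "i < n \<Longrightarrow> j < n \<Longrightarrow> shift_mat n N \<sigma> $$ (i,j) = (if shift_rel N \<sigma> i j then 1 else 0)"
  unfolding shift_mat_def by simp

lemma shift_relE:
  assumes "shift_rel N \<sigma> i j"
  obtains k where "k < N" "i = \<sigma> (Suc k)" "j = \<sigma> k"
  using assms unfolding shift_rel_def by blast

lemma shift_rel_inj:
  assumes inj: "inj_on \<sigma> {..N}"
  shows "shift_rel N \<sigma> i j \<Longrightarrow> shift_rel N \<sigma> i j' \<Longrightarrow> j = j'"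
    and "shift_rel N \<sigma> i j \<Longrightarrow> shift_rel N \<sigma> i' j \<Longrightarrow> i = i'"
proof -
  assume 1: "shift_rel N \<sigma> i j" and 2: "shift_rel N \<sigma> i j'"
  from 1 obtain k where k: "k < N" "i = \<sigma> (Suc k)" "j = \<sigma> k" by (rule shift_relE)
  from 2 obtain k' where k': "k' < N" "i = \<sigma> (Suc k')" "j' = \<sigma> k'" by (rule shift_relE)
  have "\<sigma> (Suc k) = \<sigma> (Suc k')" using k k' by simp
  then have "Suc k = Suc k'" using inj_onD[OF inj] k(1) k'(1) by (metis Suc_leI atMost_iff)
  then show "j = j'" using k k' by simp
next
  assume 1: "shift_rel N \<sigma> i j" and 2: "shift_rel N \<sigma> i' j"
  from 1 obtain k where k: "k < N" "i = \<sigma> (Suc k)" "j = \<sigma> k" by (rule shift_relE)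
  from 2 obtain k' where k': "k' < N" "i' = \<sigma> (Suc k')" "j = \<sigma> k'" by (rule shift_relE)
  have "\<sigma> k = \<sigma> k'" using k k' by simp
  then have "k = k'" using inj_onD[OF inj] k(1) k'(1) by (metis less_imp_le atMost_iff)
  then show "i = i'" using k k' by simp
qed

text \<open>Injectivity leaves at most one non-zero entry in each row and column, so the Schur test
  gives the largest weight.\<close>

lemma weighted_shift_bd:
  assumes inj: "inj_on \<sigma> {..N}" and K: "K \<ge> 0"
    and w: "\<And>i j. shift_rel N \<sigma> i j \<Longrightarrow> cmod (\<omega> i j) \<le> K"
  shows "form_bd n (\<lambda>i j. if shift_rel N \<sigma> i j then \<omega> i j else 0) K"
proof (rule schur_test; rule sum_at_most_one)
  fix i j j' assume "cmod (if shift_rel N \<sigma> i j then \<omega> i j else 0) \<noteq> 0" "cmod (if shift_rel N \<sigma> i j' then \<omega> i j' else 0) \<noteq> 0"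
  then show "j = j'" using shift_rel_inj(1)[OF inj, of i j j'] by (auto split: if_splits)
next
  fix i i' j assume "cmod (if shift_rel N \<sigma> i j then \<omega> i j else 0) \<noteq> 0" "cmod (if shift_rel N \<sigma> i' j then \<omega> i' j else 0) \<noteq> 0"
  then show "i = i'" using shift_rel_inj(2)[OF inj, of i j i'] by (auto split: if_splits)
qed (use w K in auto)

lemma shift_mat_norm:
  assumes "inj_on \<sigma> {..N}"
  shows "mat_op_norm (shift_mat n N \<sigma>) \<le> 1"
proof (rule mat_op_norm_le_if_form_bd[of _ n])
  show "form_bd n (\<lambda>i j. shift_mat n N \<sigma> $$ (i,j)) 1"
    using weighted_shift_bd[OF assms, of 1 "\<lambda>_ _. 1" n]
    by (subst form_bd_cong[where Y = "\<lambda>i j. if shift_rel N \<sigma> i j then 1 else 0"]) (auto simp: shift_mat_index)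
qed auto

definition chain_vec :: "nat \<Rightarrow> nat \<Rightarrow> (nat \<Rightarrow> nat) \<Rightarrow> complex vec \<Rightarrow> bool" where
  "chain_vec n N \<sigma> w \<longleftrightarrow> w \<in> carrier_vec n \<and> (\<forall>i<n. i \<notin> \<sigma> ` {..N} \<longrightarrow> w $ i = 0)"

lemma shift_mat_apply:
  assumes inj: "inj_on \<sigma> {..N}" and sub: "\<sigma> ` {..N} \<subseteq> {..<n}" and v: "v \<in> carrier_vec n" and i: "i < n"
  shows "k < N \<Longrightarrow> (shift_mat n N \<sigma> *\<^sub>v v) $ (\<sigma> (Suc k)) = v $ (\<sigma> k)"
    and "i \<notin> \<sigma> ` Suc ` {..<N} \<Longrightarrow> (shift_mat n N \<sigma> *\<^sub>v v) $ i = 0"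
proof -
  have e: "(shift_mat n N \<sigma> *\<^sub>v v) $ i = (\<Sum>j<n. (if shift_rel N \<sigma> i j then 1 else 0) * v $ j)" if "i < n" for i
    using mult_mat_vec_nth[OF shift_mat_carrier v that] that by (simp add: shift_mat_index)
  show "(shift_mat n N \<sigma> *\<^sub>v v) $ (\<sigma> (Suc k)) = v $ (\<sigma> k)" if k: "k < N"
  proof -
    have rel: "shift_rel N \<sigma> (\<sigma> (Suc k)) j \<longleftrightarrow> j = \<sigma> k" for j
    proof
      have "shift_rel N \<sigma> (\<sigma> (Suc k)) (\<sigma> k)" using k unfolding shift_rel_def by blast
      then show "j = \<sigma> k" if "shift_rel N \<sigma> (\<sigma> (Suc k)) j" using shift_rel_inj(1)[OF inj that] by simp
      show "shift_rel N \<sigma> (\<sigma> (Suc k)) j" if "j = \<sigma> k" using k that unfolding shift_rel_def by blast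
    qed
    have "\<sigma> (Suc k) < n" "\<sigma> k < n" using k sub by (simp_all add: image_subset_iff)
    then show ?thesis
      using e[of "\<sigma> (Suc k)"] by (simp add: rel if_distrib[of "\<lambda>x. x * _"] sum.delta' cong: if_cong)
  qed
  show "(shift_mat n N \<sigma> *\<^sub>v v) $ i = 0" if "i \<notin> \<sigma> ` Suc ` {..<N}"
  proof -
    have "\<not> shift_rel N \<sigma> i j" for j using that unfolding shift_rel_def by auto
    then show ?thesis using e[OF i] by simp
  qed
qed

lemma shift_mat_chain_vec:
  assumes inj: "inj_on \<sigma> {..N}" and sub: "\<sigma> ` {..N} \<subseteq> {..<n}" and v: "v \<in> carrier_vec n"
  shows "chain_vec n N \<sigma> (shift_mat n N \<sigma> *\<^sub>v v)"
  unfolding chain_vec_def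
proof (intro conjI allI impI)
  show "shift_mat n N \<sigma> *\<^sub>v v \<in> carrier_vec n" using v by (rule mult_mat_vec_carrier[OF shift_mat_carrier])
  fix i assume i: "i < n" "i \<notin> \<sigma> ` {..N}"
  then have "i \<notin> \<sigma> ` Suc ` {..<N}" by (auto simp: image_iff)
  then show "(shift_mat n N \<sigma> *\<^sub>v v) $ i = 0" by (rule shift_mat_apply(2)[OF inj sub v i(1)])
qed

lemma shift_mat_isometric:
  assumes inj: "inj_on \<sigma> {..N}" and sub: "\<sigma> ` {..N} \<subseteq> {..<n}" and w: "chain_vec n N \<sigma> w"
    and top: "w $ (\<sigma> N) = 0"
  shows "vec_norm2 (shift_mat n N \<sigma> *\<^sub>v w) = vec_norm2 w"
proof -
  have wc: "w \<in> carrier_vec n" using w unfolding chain_vec_def by simp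
  let ?y = "shift_mat n N \<sigma> *\<^sub>v w"
  have yc: "?y \<in> carrier_vec n" using wc by (rule mult_mat_vec_carrier[OF shift_mat_carrier])
  have "(vec_norm2 ?y)\<^sup>2 = (\<Sum>i<n. (cmod (?y $ i))\<^sup>2)" using yc by (simp only: vec_norm2_sq carrier_vecD)
  also have "\<dots> = (\<Sum>i\<in>\<sigma> ` Suc ` {..<N}. (cmod (?y $ i))\<^sup>2)"
  proof (rule sum.mono_neutral_right)
    show "\<sigma> ` Suc ` {..<N} \<subseteq> {..<n}" using sub by (auto simp: image_subset_iff)
    show "\<forall>i\<in>{..<n} - \<sigma> ` Suc ` {..<N}. (cmod (?y $ i))\<^sup>2 = 0"
      using shift_mat_apply(2)[OF inj sub wc] by auto
  qed simp
  also have "\<dots> = (\<Sum>k<N. (cmod (?y $ (\<sigma> (Suc k))))\<^sup>2)"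
    unfolding image_image by (rule sum.reindex_cong[of "\<lambda>k. \<sigma> (Suc k)"]) (auto intro!: inj_onI dest: inj_onD[OF inj])
  also have "\<dots> = (\<Sum>k<N. (cmod (w $ (\<sigma> k)))\<^sup>2)"
  proof (rule sum.cong[OF refl])
    fix k assume "k \<in> {..<N}"
    then have "k < N" by simp
    moreover have "n > 0" using sub by (cases n) auto
    ultimately show "(cmod (?y $ (\<sigma> (Suc k))))\<^sup>2 = (cmod (w $ (\<sigma> k)))\<^sup>2"
      using shift_mat_apply(1)[OF inj sub wc, of 0 k] by simp
  qed
  also have "\<dots> = (\<Sum>k\<le>N. (cmod (w $ (\<sigma> k)))\<^sup>2)"
    using top by (simp add: lessThan_Suc_atMost[symmetric])
  also have "\<dots> = (\<Sum>i\<in>\<sigma> ` {..N}. (cmod (w $ i))\<^sup>2)"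
    using sum.reindex[OF inj, of "\<lambda>i. (cmod (w $ i))\<^sup>2"] by (simp add: o_def)
  also have "\<dots> = (\<Sum>i<n. (cmod (w $ i))\<^sup>2)"
    using sub w unfolding chain_vec_def by (intro sum.mono_neutral_left) auto
  also have "\<dots> = (vec_norm2 w)\<^sup>2" using wc by (simp only: vec_norm2_sq carrier_vecD)
  finally show ?thesis by (simp add: power2_eq_iff_nonneg vec_norm2_nonneg)
qed

text \<open>There are \<open>m\<close> equations for \<open>N + 1\<close> unknowns. Zero rows fill
  the system up to a square matrix; its last row is zero because \<open>m \<le> N\<close>, so the
  determinant vanishes.\<close>

lemma underdetermined_system:
  fixes a :: "nat \<Rightarrow> nat \<Rightarrow> complex"
  assumes "m \<le> N"
  shows "\<exists>c. (\<exists>k\<le>N. c k \<noteq> 0) \<and> (\<forall>r<m. (\<Sum>k\<le>N. a r k * c k) = 0)"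
proof -
  define K where "K = mat (Suc N) (Suc N) (\<lambda>(r,k). if r < m then a r k else 0)"
  have K: "K \<in> carrier_mat (Suc N) (Suc N)" unfolding K_def by simp
  have "K\<^sup>T *\<^sub>v unit_vec (Suc N) N = 0\<^sub>v (Suc N)"
    by (rule eq_vecI) (use assms in \<open>auto simp: K_def\<close>)
  moreover have "unit_vec (Suc N) N \<noteq> (0\<^sub>v (Suc N) :: complex vec)" by simp
  moreover have "unit_vec (Suc N) N \<in> (carrier_vec (Suc N) :: complex vec set)" by simp
  ultimately have "det (K\<^sup>T) = 0"
    using det_0_iff_vec_prod_zero_field[OF transpose_carrier_mat[THEN iffD2, OF K]] by blast
  then have "det K = 0" using det_transpose[OF K] by simp
  then obtain v where v: "v \<in> carrier_vec (Suc N)" "v \<noteq> 0\<^sub>v (Suc N)" "K *\<^sub>v v = 0\<^sub>v (Suc N)"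
    using det_0_iff_vec_prod_zero_field[OF K] by blast
  have "\<exists>k\<le>N. v $ k \<noteq> 0"
  proof (rule ccontr)
    assume "\<not> ?thesis"
    then have "v = 0\<^sub>v (Suc N)" using v(1) by (intro eq_vecI) auto
    then show False using v(2) by simp
  qed
  moreover have "(\<Sum>k\<le>N. a r k * v $ k) = 0" if r: "r < m" for r
  proof -
    have "(K *\<^sub>v v) $ r = (\<Sum>k<Suc N. K $$ (r,k) * v $ k)"
      using r assms by (intro mult_mat_vec_nth[OF K v(1)]) auto
    moreover have "K $$ (r,k) = a r k" if "k < Suc N" for k using that r assms by (simp add: K_def)
    ultimately show ?thesis using v(3) r assms by (simp add: lessThan_Suc_atMost del: index_mult_mat_vec)
  qed
  ultimately show ?thesis by blast
qed

lemma vec_norm2_triangle: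
  assumes "v \<in> carrier_vec n" "w \<in> carrier_vec n"
  shows "vec_norm2 (v + w) \<le> vec_norm2 v + vec_norm2 w"
proof -
  have "vec_norm2 (v + w) = L2_set (\<lambda>i. cmod (v $ i + w $ i)) {..<n}"
    unfolding vec_norm2_def using assms by (intro L2_set_cong) auto
  also have "\<dots> \<le> L2_set (\<lambda>i. cmod (v $ i) + cmod (w $ i)) {..<n}"
    by (intro L2_set_mono) (auto intro: norm_triangle_ineq)
  also have "\<dots> \<le> vec_norm2 v + vec_norm2 w"
    unfolding vec_norm2_def using assms L2_set_triangle_ineq by simp
  finally show ?thesis .
qed

text \<open>After division by one of the phases this is
  \<open>2 * \<bar>sin (z / 2)\<bar> \<le> \<bar>z\<bar>\<close>.\<close>

lemma cmod_exp_ii_diff_le: "cmod (expi x - expi y) \<le> \<bar>x - y\<bar>"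
proof -
  have "expi x - expi y =
      expi y * (expi (x - y) - 1)"
    by (simp add: algebra_simps exp_add[symmetric])
  then have "cmod (expi x - expi y) = cmod (expi (x - y) - 1)"
    by (simp add: norm_mult norm_exp_eq_Re)
  also have "\<dots> = cmod (cis (x - y) - cis 0)" by (simp add: cis_conv_exp)
  also have "\<dots> \<le> \<bar>x - y\<bar>"
  proof -
    have "(cmod (cis z - cis 0))\<^sup>2 \<le> z\<^sup>2" for z :: real
    proof -
      have "(cmod (cis z - cis 0))\<^sup>2 = (cos z - 1)\<^sup>2 + (sin z)\<^sup>2"
        by (simp add: cmod_power2)
      also have "\<dots> = 2 - 2 * cos z"
        using sin_cos_squared_add[of z] by (simp add: power2_eq_square algebra_simps)
      also have "\<dots> = (2 * sin (z / 2))\<^sup>2"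
        using cos_double_sin[of "z / 2"] by (simp add: power_mult_distrib)
      also have "\<dots> \<le> z\<^sup>2"
        unfolding abs_le_square_iff[symmetric] abs_mult using abs_sin_x_le_abs_x[of "z / 2"] by simp
      finally show ?thesis .
    qed
    from this[of "x - y"] show ?thesis unfolding abs_le_square_iff[symmetric] by simp
  qed
  finally show ?thesis .
qed

section \<open>Spectral projections and the raising property of the shift\<close>

definition spec_proj :: "nat \<Rightarrow> complex mat \<Rightarrow> (nat \<Rightarrow> real) \<Rightarrow> real set \<Rightarrow> complex mat" where
  "spec_proj n U l A = conj_by U (diagm n (\<lambda>i. if l i \<in> A then 1 else 0))"

lemma spec_proj_carrier [simp]: "U \<in> carrier_mat n n \<Longrightarrow> spec_proj n U l A \<in> carrier_mat n n"
  unfolding spec_proj_def by simp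

lemma spec_proj_compl:
  assumes U: "unitary n U"
  shows "spec_proj n U l A + spec_proj n U l (- A) = 1\<^sub>m n"
proof -
  have "spec_proj n U l A + spec_proj n U l (- A) =
      conj_by U (diagm n (\<lambda>i. (if l i \<in> A then 1 else 0) + (if l i \<in> - A then 1 else 0)))"
    unfolding spec_proj_def by (simp add: conj_by_add[symmetric, OF unitaryD(1)[OF U]] diagm_add)
  also have "diagm n (\<lambda>i. (if l i \<in> A then 1 else 0) + (if l i \<in> - A then 1 else 0)) = 1\<^sub>m n"
    unfolding diagm_one[symmetric] by (rule diagm_cong) simp
  finally show ?thesis using conj_by_one[OF U] by simp
qed

lemma spec_proj_empty:
  assumes U: "unitary n U" and "\<And>i. i < n \<Longrightarrow> l i \<notin> A"
  shows "spec_proj n U l A = 0\<^sub>m n n"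
proof -
  have "diagm n (\<lambda>i. if l i \<in> A then 1 else 0) = 0\<^sub>m n n"
    unfolding diagm_zero[symmetric] by (rule diagm_cong) (use assms(2) in auto)
  then show ?thesis unfolding spec_proj_def conj_by_def using unitaryD[OF U]
    by (simp add: right_mult_zero_mat[of _ n n] left_mult_zero_mat[of _ n n])
qed

lemma spec_proj_sandwich_norm:
  assumes U: "unitary n U" and X: "X \<in> carrier_mat n n" and K: "K \<ge> 0"
    and bd: "form_bd n (\<lambda>i j. if l i \<in> A \<and> l j \<in> B then conj_by (mat_adjoint U) X $$ (i,j) else 0) K"
  shows "mat_op_norm (spec_proj n U l A * (X * spec_proj n U l B)) \<le> K"
proof -
  note Uc = unitaryD[OF U]
  let ?D = "\<lambda>A. diagm n (\<lambda>i. if l i \<in> A then 1 else 0)"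
  let ?Y = "conj_by (mat_adjoint U) X"
  have Y: "?Y \<in> carrier_mat n n" using Uc X by simp
  have "X = conj_by U ?Y" using conj_by_adjoint_cancel(2)[OF U X] by simp
  then have "spec_proj n U l A * (X * spec_proj n U l B) = conj_by U (?D A) * (conj_by U ?Y * conj_by U (?D B))"
    unfolding spec_proj_def by simp
  also have "\<dots> = conj_by U (?D A * (?Y * ?D B))"
    using conj_by_mult[OF U Y] conj_by_mult[OF U, of "?D A" "?Y * ?D B"] Y by simp
  also have "mat_op_norm \<dots> = mat_op_norm (?D A * (?Y * ?D B))"
    by (rule conj_by_norm[OF U]) (use Y in simp)
  also have "\<dots> \<le> K"
  proof (rule mat_op_norm_le_if_form_bd[of _ n])
    have e: "(?D A * (?Y * ?D B)) $$ (i,j) = (if l i \<in> A \<and> l j \<in> B then ?Y $$ (i,j) else 0)" if "i < n" "j < n" for i j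
      using that Y by (simp add: diagm_mult_index[of _ n] del: index_mult_mat(1))
    show "form_bd n (\<lambda>i j. (?D A * (?Y * ?D B)) $$ (i,j)) K"
      using form_bd_cong[of n "\<lambda>i j. (?D A * (?Y * ?D B)) $$ (i,j)"
          "\<lambda>i j. if l i \<in> A \<and> l j \<in> B then ?Y $$ (i,j) else 0" K, OF e] bd by (simp only:)
  qed (use Y K in auto)
  finally show ?thesis .
qed

lemma kernel_bd:
  assumes "X \<in> carrier_mat n n" "mat_op_norm X \<le> K" "K \<ge> 0"
    and "\<And>i j. i < n \<Longrightarrow> j < n \<Longrightarrow> X $$ (i,j) = x i j"
  shows "form_bd n x K"
  using mat_op_norm_le_iff[OF assms(1,3)] assms(2) form_bd_cong[of n "\<lambda>i j. X $$ (i,j)" x K, OF assms(4)] by blast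

lemma minus_smult_index:
  "A \<in> carrier_mat n n \<Longrightarrow> B \<in> carrier_mat n n \<Longrightarrow> i < n \<Longrightarrow> j < n \<Longrightarrow>
   (A - z \<cdot>\<^sub>m B) $$ (i,j) = A $$ (i,j) - z * B $$ (i,j)"
  by simp

text \<open>A gap exceeds \<open>L = 24 * c\<close> by at most \<open>c\<close>, so for
  \<open>t \<le> 1 / L\<close> the phases of the \<open>U\<close>-orbit of \<open>S\<close> are
  within \<open>1 / 24\<close> of \<open>expi (t * L)\<close>. Together with \<open>near\<close>,
  the \<open>V\<close>-orbit of \<open>S\<close> is within \<open>1 / 12\<close> of a pure
  oscillation of frequency \<open>L\<close>. With \<open>T = 1 / L\<close> the factor
  \<open>1 + 2 / (T * L)\<close> of \<open>spectral_raising_bound\<close> is 3.\<close>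

lemma raising_along_chain:
  fixes l \<mu> :: "nat \<Rightarrow> real"
  assumes U: "unitary n U" and V: "unitary n V" and c: "c > 0"
    and inj: "inj_on \<sigma> {..N}" and sub: "\<sigma> ` {..N} \<subseteq> {..<n}"
    and gap: "\<And>k. k < N \<Longrightarrow> 24 * c \<le> l (\<sigma> (Suc k)) - l (\<sigma> k) \<and> l (\<sigma> (Suc k)) - l (\<sigma> k) \<le> 25 * c"
    and near: "\<And>t. t \<in> {0..1 / (24 * c)} \<Longrightarrow>
      mat_op_norm (conj_by (uexp n V \<mu> t) (conj_by U (shift_mat n N \<sigma>)) - conj_by (uexp n U l t) (conj_by U (shift_mat n N \<sigma>))) \<le> 1 / 24"
  defines "S \<equiv> conj_by U (shift_mat n N \<sigma>)"
  shows "mat_op_norm (spec_proj n V \<mu> {..<s + 12 * c} * (S * spec_proj n V \<mu> {s..})) \<le> 1 / 4"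
proof (rule spec_proj_sandwich_norm[OF V])
  note Uc = unitaryD[OF U] and Vc = unitaryD[OF V]
  let ?S0 = "shift_mat n N \<sigma>"
  define L where "L = 24 * c"
  have L: "L > 0" unfolding L_def using c by simp
  show S: "S \<in> carrier_mat n n" unfolding S_def using Uc by simp
  define a where "a i j = conj_by (mat_adjoint V) S $$ (i,j)" for i j
  have main: "form_bd n (\<lambda>i j. (expi (t * (\<mu> i - \<mu> j - L)) - 1) * a i j) (1 / 12)"
    if t: "t \<in> {0..1 / L}" for t
  proof -
    let ?E = "conj_by (uexp n V \<mu> t) S" and ?F = "conj_by (uexp n U l t) S"
    let ?z = "expi (t * L)"
    have EF: "?E \<in> carrier_mat n n" "?F \<in> carrier_mat n n" using Uc Vc S by simp_all
    have F: "mat_op_norm (?F - ?z \<cdot>\<^sub>m S) \<le> 1 / 24"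
    proof -
      let ?Y = "conj_by (mat_adjoint U) (?F - ?z \<cdot>\<^sub>m S)"
      have US: "conj_by (mat_adjoint U) S = ?S0"
        unfolding S_def by (rule conj_by_adjoint_cancel(1)[OF U shift_mat_carrier])
      have "?Y = conj_by (mat_adjoint U) ?F - ?z \<cdot>\<^sub>m ?S0"
        using Uc EF S US by (simp add: conj_by_diff[of _ n] conj_by_smult[of _ n])
      then have e: "?Y $$ (i,j) = (if shift_rel N \<sigma> i j then expi (t * (l i - l j)) - ?z else 0)"
        if "i < n" "j < n" for i j
        using that conj_by_uexp_index[OF U S that, of l t] US minus_smult_index[of "conj_by (mat_adjoint U) ?F" n ?S0 i j ?z] Uc EF
        by (simp add: shift_mat_index)
      have "form_bd n (\<lambda>i j. if shift_rel N \<sigma> i j then expi (t * (l i - l j)) - ?z else 0) (1 / 24)"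
      proof (rule weighted_shift_bd[OF inj])
        fix i j assume "shift_rel N \<sigma> i j"
        then obtain k where k: "k < N" "i = \<sigma> (Suc k)" "j = \<sigma> k" by (rule shift_relE)
        have "cmod (expi (t * (l i - l j)) - ?z) \<le> \<bar>t * (l i - l j) - t * L\<bar>"
          by (rule cmod_exp_ii_diff_le)
        also have "\<dots> = t * \<bar>(l i - l j) - L\<bar>"
          using t by (simp add: right_diff_distrib[symmetric] abs_mult)
        also have "\<dots> \<le> (1 / L) * c"
          using t gap[OF k(1)] c L unfolding k L_def by (intro mult_mono) auto
        also have "\<dots> = 1 / 24" unfolding L_def using c by simp
        finally show "cmod (expi (t * (l i - l j)) - ?z) \<le> 1 / 24" .
      qed simp
      then have "form_bd n (\<lambda>i j. ?Y $$ (i,j)) (1 / 24)"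
        using form_bd_cong[of n "\<lambda>i j. ?Y $$ (i,j)", OF e] by (simp only:)
      moreover have "?Y \<in> carrier_mat n n"
        by (intro conj_by_carrier[OF Uc(2)] minus_carrier_mat smult_carrier_mat S)
      ultimately have "mat_op_norm ?Y \<le> 1 / 24" by (intro mat_op_norm_le_if_form_bd) simp_all
      moreover have "?F - ?z \<cdot>\<^sub>m S \<in> carrier_mat n n"
        by (intro minus_carrier_mat) (simp only: smult_carrier_mat S)
      ultimately show ?thesis using conj_by_norm[OF unitary_adjoint[OF U]] by simp
    qed
    have "mat_op_norm (?E - ?z \<cdot>\<^sub>m S) \<le> mat_op_norm (?E - ?F) + mat_op_norm (?F - ?z \<cdot>\<^sub>m S)"
      using EF S by (intro mat_op_norm_diff_triangle) auto
    also have "\<dots> \<le> 1 / 24 + 1 / 24"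
      using near[of t] t F unfolding S_def L_def by (intro add_mono) auto
    finally have le: "mat_op_norm (?E - ?z \<cdot>\<^sub>m S) \<le> 1 / 12" by simp
    let ?Z = "conj_by (mat_adjoint V) (?E - ?z \<cdot>\<^sub>m S)"
    have EzS: "?E - ?z \<cdot>\<^sub>m S \<in> carrier_mat n n"
      by (intro minus_carrier_mat) (simp only: smult_carrier_mat S)
    have Zc: "?Z \<in> carrier_mat n n" by (rule conj_by_carrier[OF Vc(2) EzS])
    have Zn: "mat_op_norm ?Z \<le> 1 / 12"
      using le conj_by_norm[OF unitary_adjoint[OF V] EzS] by simp
    have "?Z = conj_by (mat_adjoint V) ?E - ?z \<cdot>\<^sub>m conj_by (mat_adjoint V) S"
      using Vc EF S by (simp add: conj_by_diff[of _ n] conj_by_smult[of _ n])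
    then have "?Z $$ (i,j) = expi (t * (\<mu> i - \<mu> j)) * a i j - ?z * a i j" if "i < n" "j < n" for i j
      using conj_by_uexp_index[OF V S that, of \<mu> t]
        minus_smult_index[OF conj_by_carrier[OF Vc(2) EF(1)] conj_by_carrier[OF Vc(2) S] that, of ?z]
      unfolding a_def by (simp only:)
    then have "form_bd n (\<lambda>i j. expi (t * (\<mu> i - \<mu> j)) * a i j - ?z * a i j) (1 / 12)"
      by (intro kernel_bd[OF Zc Zn]) auto
    \<comment> \<open>Dividing by the phase \<open>expi (t * L)\<close> brings the estimate into the
      form that \<open>spectral_raising_bound\<close> expects.\<close>
    from form_bd_scale[OF this, of "exp (- (\<i> * complex_of_real (t * L)))"]
    have "form_bd n (\<lambda>i j. exp (- (\<i> * complex_of_real (t * L))) * (expi (t * (\<mu> i - \<mu> j)) * a i j - ?z * a i j)) (1 / 12)"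
      by (simp add: norm_exp_eq_Re)
    moreover have "exp (- (\<i> * complex_of_real (t * L))) * (expi (t * (\<mu> i - \<mu> j)) * a i j - ?z * a i j) =
        (expi (t * (\<mu> i - \<mu> j - L)) - 1) * a i j" for i j
    proof -
      have "exp (- (\<i> * complex_of_real (t * L))) * expi (t * (\<mu> i - \<mu> j)) =
          expi (t * (\<mu> i - \<mu> j - L))"
        unfolding exp_add[symmetric] by (simp add: algebra_simps)
      moreover have "exp (- (\<i> * complex_of_real (t * L))) * ?z = 1" unfolding exp_add[symmetric] by simp
      ultimately show ?thesis by (simp only: right_diff_distrib left_diff_distrib mult.assoc[symmetric] mult_1_left)
    qed
    ultimately show ?thesis by (simp only:)
  qed
  have "form_bd n (\<lambda>i j. if \<mu> i < s + L / 2 \<and> \<mu> j \<ge> s then a i j else 0) (1 / 12 + 2 * (1 / 12) / ((1 / L) * L))"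
    by (rule spectral_raising_bound[OF L _ _ main]) (use L in auto)
  moreover have "1 / 12 + 2 * (1 / 12) / ((1 / L) * L) = (1 / 4 :: real)" using L by simp
  moreover have "s + L / 2 = s + 12 * c" unfolding L_def by simp
  ultimately show "form_bd n (\<lambda>i j. if \<mu> i \<in> {..<s + 12 * c} \<and> \<mu> j \<in> {s..} then conj_by (mat_adjoint V) S $$ (i,j) else 0) (1 / 4)"
    unfolding a_def by (simp only: lessThan_iff atLeast_iff)
qed simp

text \<open>Each application of the shift raises the \<open>V\<close>-spectral support by \<open>12 * c\<close> and keeps at
  least half of the norm; a vector in the chain which survives \<open>m\<close> shifts exists as soon as the chain
  has more than \<open>m\<close> members.\<close>

lemma chain_length_bound:
  fixes l \<mu> :: "nat \<Rightarrow> real"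
  assumes U: "unitary n U" and V: "unitary n V" and c: "c > 0"
    and inj: "inj_on \<sigma> {..N}" and sub: "\<sigma> ` {..N} \<subseteq> {..<n}"
    and gap: "\<And>k. k < N \<Longrightarrow> 24 * c \<le> l (\<sigma> (Suc k)) - l (\<sigma> k) \<and> l (\<sigma> (Suc k)) - l (\<sigma> k) \<le> 25 * c"
    and near: "\<And>t. t \<in> {0..1 / (24 * c)} \<Longrightarrow>
      mat_op_norm (conj_by (uexp n V \<mu> t) (conj_by U (shift_mat n N \<sigma>)) - conj_by (uexp n U l t) (conj_by U (shift_mat n N \<sigma>))) \<le> 1 / 24"
    and M: "\<And>i. i < n \<Longrightarrow> \<bar>\<mu> i\<bar> \<le> M"
    and m: "2 * M < real m * (12 * c)"
  shows "N < m"
proof (rule ccontr)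
  assume "\<not> N < m"
  then have mN: "m \<le> N" by simp
  note Uc = unitaryD[OF U] and Vc = unitaryD[OF V]
  let ?S0 = "shift_mat n N \<sigma>"
  define S where "S = conj_by U ?S0"
  \<comment> \<open>Nothing of the spectrum of the \<open>V\<close>-operator lies below
    \<open>s 0 = - M\<close>, and by the choice of \<open>m\<close> all of it lies below
    \<open>s m\<close>.\<close>
  define s where "s r = - M + real r * (12 * c)" for r
  have s_Suc: "s (Suc r) = s r + 12 * c" for r unfolding s_def by (simp add: algebra_simps)
  \<comment> \<open>The complementary spectral projections of the \<open>V\<close>-operator below
    and above \<open>s r\<close>, written in the eigenbasis of \<open>U\<close>, where the shift is
    a matrix of zeros and ones.\<close>
  define P where "P r = conj_by (mat_adjoint U) (spec_proj n V \<mu> {..<s r})" for r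
  define Q where "Q r = conj_by (mat_adjoint U) (spec_proj n V \<mu> {s r..})" for r
  have P: "P r \<in> carrier_mat n n" and Q: "Q r \<in> carrier_mat n n" for r
    unfolding P_def Q_def using Uc Vc by simp_all
  have PQ: "P r + Q r = 1\<^sub>m n" for r
  proof -
    have "- {..<s r} = {s r..}" by auto
    then have "P r + Q r = conj_by (mat_adjoint U) (1\<^sub>m n)"
      unfolding P_def Q_def using spec_proj_compl[OF V, of \<mu> "{..<s r}"] Uc Vc
      by (simp add: conj_by_add[symmetric, of _ n])
    then show ?thesis using conj_by_one[OF unitary_adjoint[OF U]] by simp
  qed
  have PSQ: "mat_op_norm (P (Suc r) * (?S0 * Q r)) \<le> 1 / 4" for r
  proof -
    have "?S0 = conj_by (mat_adjoint U) S"
      unfolding S_def using conj_by_adjoint_cancel(1)[OF U shift_mat_carrier] by simp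
    moreover have "S \<in> carrier_mat n n" unfolding S_def using Uc by simp
    ultimately have "P (Suc r) * (?S0 * Q r) =
        conj_by (mat_adjoint U) (spec_proj n V \<mu> {..<s r + 12 * c} * (S * spec_proj n V \<mu> {s r..}))"
      unfolding P_def Q_def s_Suc using conj_by_mult[OF unitary_adjoint[OF U]] Vc by simp
    then have "mat_op_norm (P (Suc r) * (?S0 * Q r)) = mat_op_norm (spec_proj n V \<mu> {..<s r + 12 * c} * (S * spec_proj n V \<mu> {s r..}))"
      using conj_by_norm[OF unitary_adjoint[OF U]] Vc \<open>S \<in> carrier_mat n n\<close> by simp
    also have "\<dots> \<le> 1 / 4"
      unfolding S_def by (rule raising_along_chain[OF U V c inj sub gap near])
    finally show ?thesis .
  qed
  \<comment> \<open>\<open>G r\<close> is the linear map from the start vector to the vector after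
    \<open>r\<close> rounds; a round first discards the part below \<open>s r\<close> and then
    shifts.\<close>
  define G where "G = rec_nat (1\<^sub>m n) (\<lambda>r X. ?S0 * (Q r * X))"
  have G0: "G 0 = 1\<^sub>m n" and GS: "G (Suc r) = ?S0 * (Q r * G r)" for r
    unfolding G_def by simp_all
  have G: "G r \<in> carrier_mat n n" for r
    by (induction r) (simp_all add: G0 GS Q)
  \<comment> \<open>The shift is isometric on a vector of the chain whose last coefficient is 0. To
    have this before each of the \<open>m\<close> rounds means \<open>m\<close> homogeneous linear
    equations for the \<open>N + 1\<close> coefficients of the start vector.\<close>
  obtain co where co: "\<exists>k\<le>N. co k \<noteq> 0" and sys: "\<And>r. r < m \<Longrightarrow> (\<Sum>k\<le>N. G r $$ (\<sigma> N, \<sigma> k) * co k) = 0"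
    using underdetermined_system[OF mN, of "\<lambda>r k. G r $$ (\<sigma> N, \<sigma> k)"] by blast
  define w0 where "w0 = vec n (\<lambda>i. \<Sum>k\<le>N. if i = \<sigma> k then co k else 0)"
  have w0: "w0 \<in> carrier_vec n" unfolding w0_def by simp
  have \<sigma>n: "\<sigma> k < n" if "k \<le> N" for k using sub that by auto
  have w0_at: "w0 $ (\<sigma> k) = co k" if "k \<le> N" for k
  proof -
    have "\<sigma> k = \<sigma> k' \<longleftrightarrow> k' = k" if "k' \<le> N" for k' using inj_onD[OF inj, of k k'] that \<open>k \<le> N\<close> by auto
    then have "(\<Sum>k'\<le>N. if \<sigma> k = \<sigma> k' then co k' else 0) = (\<Sum>k'\<le>N. if k' = k then co k' else 0)"
      by (intro sum.cong) auto
    moreover have "w0 $ (\<sigma> k) = (\<Sum>k'\<le>N. if \<sigma> k = \<sigma> k' then co k' else 0)"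
      unfolding w0_def using \<sigma>n[OF that] by simp
    ultimately show ?thesis using that by (simp add: sum.delta)
  qed
  have w0_off: "w0 $ i = 0" if "i < n" "i \<notin> \<sigma> ` {..N}" for i
    unfolding w0_def using that by (simp, intro sum.neutral) auto
  define w where "w r = G r *\<^sub>v w0" for r
  have w: "w r \<in> carrier_vec n" for r unfolding w_def using G w0 by (rule mult_mat_vec_carrier)
  have w_Suc: "w (Suc r) = ?S0 *\<^sub>v (Q r *\<^sub>v w r)" for r
    unfolding w_def GS using G Q w0 by (simp add: assoc_mult_mat_vec[of _ n n _ n])
  have w_0: "w 0 = w0" unfolding w_def G0 using w0 by simp
  have chain: "chain_vec n N \<sigma> (w r)" for r
  proof (cases r)
    case 0
    then show ?thesis unfolding chain_vec_def using w_0 w0 w0_off by simp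
  next
    case (Suc r')
    have "Q r' *\<^sub>v w r' \<in> carrier_vec n" using Q w by (rule mult_mat_vec_carrier)
    then show ?thesis unfolding Suc w_Suc by (rule shift_mat_chain_vec[OF inj sub])
  qed
  have top: "w r $ (\<sigma> N) = 0" if r: "r < m" for r
  proof -
    have "w r $ (\<sigma> N) = (\<Sum>i<n. G r $$ (\<sigma> N, i) * w0 $ i)"
      unfolding w_def by (rule mult_mat_vec_nth[OF G w0 \<sigma>n]) simp
    also have "\<dots> = (\<Sum>i\<in>\<sigma> ` {..N}. G r $$ (\<sigma> N, i) * w0 $ i)"
      using w0_off sub by (intro sum.mono_neutral_right) auto
    also have "\<dots> = (\<Sum>k\<le>N. G r $$ (\<sigma> N, \<sigma> k) * w0 $ (\<sigma> k))"
      using sum.reindex[OF inj] by (simp add: o_def)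
    also have "\<dots> = (\<Sum>k\<le>N. G r $$ (\<sigma> N, \<sigma> k) * co k)"
      using w0_at by (intro sum.cong) auto
    finally show ?thesis using sys[OF r] by simp
  qed
  \<comment> \<open>At most half of the norm lies below the threshold. The shift keeps the full norm
    of \<open>w r\<close>, so discarding that part leaves at least half. The new part below the next
    threshold is at most a quarter of the old norm, hence at most half of the new one.\<close>
  have inv: "vec_norm2 (w r) > 0 \<and> vec_norm2 (P r *\<^sub>v w r) \<le> vec_norm2 (w r) / 2" if "r \<le> m" for r
    using that
  proof (induction r)
    case 0
    obtain k where k: "k \<le> N" "co k \<noteq> 0" using co by blast
    have "0 < (cmod (w0 $ (\<sigma> k)))\<^sup>2" using k w0_at by simp
    also have "\<dots> \<le> (vec_norm2 w0)\<^sup>2"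
      unfolding vec_norm2_sq using w0 \<sigma>n[OF k(1)] by (intro member_le_sum) auto
    finally have "vec_norm2 w0 > 0" using vec_norm2_nonneg[of w0] by (cases "vec_norm2 w0 = 0") auto
    moreover have "spec_proj n V \<mu> {..<s 0} = 0\<^sub>m n n"
    proof (rule spec_proj_empty[OF V])
      fix i assume "i < n"
      then show "\<mu> i \<notin> {..<s 0}" using M[of i] unfolding s_def by auto
    qed
    then have "mat_op_norm (P 0) = 0"
      unfolding P_def using conj_by_norm[OF unitary_adjoint[OF U], of "0\<^sub>m n n"] by (simp add: mat_op_norm_zero)
    then have "vec_norm2 (P 0 *\<^sub>v w0) \<le> 0" using vec_norm2_mult_le[OF P w0, of 0] by simp
    ultimately show ?case unfolding w_0 by simp
  next
    case (Suc r)
    then have r: "r < m" and IH: "vec_norm2 (w r) > 0" "vec_norm2 (P r *\<^sub>v w r) \<le> vec_norm2 (w r) / 2" by auto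
    have Pw: "P r *\<^sub>v w r \<in> carrier_vec n" and Qw: "Q r *\<^sub>v w r \<in> carrier_vec n"
      using P Q w by (auto intro: mult_mat_vec_carrier)
    have "w r = P r *\<^sub>v w r + Q r *\<^sub>v w r"
      using add_mult_distrib_mat_vec[OF P Q w, of r r r] PQ w by simp
    then have "?S0 *\<^sub>v w r = ?S0 *\<^sub>v (P r *\<^sub>v w r) + w (Suc r)"
      unfolding w_Suc using mult_add_distrib_mat_vec[OF shift_mat_carrier Pw Qw, of N \<sigma>] by simp
    then have "vec_norm2 (w r) = vec_norm2 (?S0 *\<^sub>v (P r *\<^sub>v w r) + w (Suc r))"
      using shift_mat_isometric[OF inj sub chain top[OF r]] by simp
    also have "\<dots> \<le> vec_norm2 (?S0 *\<^sub>v (P r *\<^sub>v w r)) + vec_norm2 (w (Suc r))"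
      by (rule vec_norm2_triangle[OF mult_mat_vec_carrier[OF shift_mat_carrier Pw] w])
    also have "vec_norm2 (?S0 *\<^sub>v (P r *\<^sub>v w r)) \<le> mat_op_norm ?S0 * vec_norm2 (P r *\<^sub>v w r)"
      by (rule vec_norm2_mult_le[OF shift_mat_carrier Pw])
    also have "\<dots> \<le> 1 * (vec_norm2 (w r) / 2)"
      using IH shift_mat_norm[OF inj] vec_norm2_nonneg by (intro mult_mono) auto
    finally have half: "vec_norm2 (w r) / 2 \<le> vec_norm2 (w (Suc r))" by simp
    have "P (Suc r) *\<^sub>v w (Suc r) = (P (Suc r) * (?S0 * Q r)) *\<^sub>v w r"
      unfolding w_Suc using P Q w Qw by (simp add: assoc_mult_mat_vec[of _ n n _ n])
    then have "vec_norm2 (P (Suc r) *\<^sub>v w (Suc r)) \<le> mat_op_norm (P (Suc r) * (?S0 * Q r)) * vec_norm2 (w r)"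
      using vec_norm2_mult_le[of "P (Suc r) * (?S0 * Q r)" n "w r"] P Q w by simp
    also have "\<dots> \<le> 1 / 4 * vec_norm2 (w r)"
      using PSQ IH by (intro mult_right_mono) auto
    also have "\<dots> \<le> vec_norm2 (w (Suc r)) / 2" using half by simp
    finally show ?case using half IH by simp
  qed
  \<comment> \<open>The threshold has passed the whole spectrum, so \<open>P m\<close> is the
    identity and a non-zero vector would have at most half of its own norm.\<close>
  have "Q m = 0\<^sub>m n n"
  proof -
    have "spec_proj n V \<mu> {s m..} = 0\<^sub>m n n"
    proof (rule spec_proj_empty[OF V])
      fix i assume "i < n"
      then have "\<mu> i < s m" using M[of i] m unfolding s_def by linarith
      then show "\<mu> i \<notin> {s m..}" by simp
    qed
    then show ?thesis unfolding Q_def conj_by_def using Uc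
      by (simp add: right_mult_zero_mat[of _ n n] left_mult_zero_mat[of _ n n])
  qed
  then have "P m = 1\<^sub>m n" using PQ[of m] right_add_zero_mat[OF P, of m] by simp
  then have "P m *\<^sub>v w m = w m" using w[of m] by simp
  then show False using inv[of m] by auto
qed

section \<open>The matrix algebras and their exponentials\<close>

lemma matrix_alg_simps [simp]:
  "carrier (matrix_alg k) = carrier_mat k k"
  "monoid.mult (matrix_alg k) = (*)"
  "one (matrix_alg k) = 1\<^sub>m k"
  "add (matrix_alg k) = (+)"
  "zero (matrix_alg k) = 0\<^sub>m k k"
  "smult (matrix_alg k) = (\<cdot>\<^sub>m)"
  "star (matrix_alg k) = mat_adjoint"
  "nrm (matrix_alg k) = mat_op_norm"
  unfolding matrix_alg_def ring_mat_def by simp_all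

lemma matrix_alg_ring: "ring (matrix_alg k)"
  by (unfold_locales, insert add_inv_exists_mat, auto simp: algebra_simps Units_def)

lemma matrix_alg_minus:
  assumes "x \<in> carrier_mat k k" "y \<in> carrier_mat k k"
  shows "x \<ominus>\<^bsub>matrix_alg k\<^esub> y = x - y"
proof -
  interpret ring "matrix_alg k" by (rule matrix_alg_ring)
  have "\<ominus>\<^bsub>matrix_alg k\<^esub> y = - y"
    by (rule minus_equality) (use assms in \<open>simp_all add: uminus_l_inv_mat\<close>)
  then show ?thesis using assms by (simp add: a_minus_def add_uminus_minus_mat)
qed

lemma matrix_alg_pow:
  assumes "x \<in> carrier_mat k k"
  shows "x [^]\<^bsub>matrix_alg k\<^esub> (j::nat) = x ^\<^sub>m j"
proof -
  interpret ring "matrix_alg k" by (rule matrix_alg_ring)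
  show ?thesis using assms by (induction j) auto
qed

section \<open>Partial sums of the exponential series\<close>

definition psum :: "('a, 'm) star_alg_scheme \<Rightarrow> 'a \<Rightarrow> nat \<Rightarrow> 'a" where
  "psum A b N = (\<Oplus>\<^bsub>A\<^esub>j\<in>{..<N}. (1 / fact j) \<odot>\<^bsub>A\<^esub> (b [^]\<^bsub>A\<^esub> (j::nat)))"

lemma psum_rec:
  assumes A: "ring A" and b: "b \<in> carrier A" and sm: "\<And>z x. x \<in> carrier A \<Longrightarrow> z \<odot>\<^bsub>A\<^esub> x \<in> carrier A"
  shows "psum A b 0 = \<zero>\<^bsub>A\<^esub>" "psum A b (Suc N) = (1 / fact N) \<odot>\<^bsub>A\<^esub> (b [^]\<^bsub>A\<^esub> N) \<oplus>\<^bsub>A\<^esub> psum A b N"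
    "psum A b N \<in> carrier A"
proof -
  interpret ring A by (rule A)
  have c: "(1 / fact j) \<odot>\<^bsub>A\<^esub> (b [^]\<^bsub>A\<^esub> (j::nat)) \<in> carrier A" for j by (intro sm nat_pow_closed b)
  show "psum A b 0 = \<zero>\<^bsub>A\<^esub>" unfolding psum_def by simp
  show "psum A b (Suc N) = (1 / fact N) \<odot>\<^bsub>A\<^esub> (b [^]\<^bsub>A\<^esub> N) \<oplus>\<^bsub>A\<^esub> psum A b N"
    unfolding psum_def lessThan_Suc by (rule finsum_insert) (use c in auto)
  show "psum A b N \<in> carrier A" unfolding psum_def by (rule finsum_closed) (use c in auto)
qed

text \<open>Uniqueness of the limit. The metric properties are hypotheses because the records carry
  no axioms and the lemma is applied both to matrices and to the quotient. The partial sum comes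
  first in both differences of the triangle inequality, to match the two limits.\<close>

lemma alg_exp_eqI:
  assumes y: "y \<in> carrier A" "(\<lambda>N. nrm A (psum A b N \<ominus>\<^bsub>A\<^esub> y)) \<longlonglongrightarrow> 0"
    and p: "\<And>N. psum A b N \<in> carrier A"
    and tri: "\<And>x y z. x \<in> carrier A \<Longrightarrow> y \<in> carrier A \<Longrightarrow> z \<in> carrier A \<Longrightarrow>
      nrm A (y \<ominus>\<^bsub>A\<^esub> z) \<le> nrm A (x \<ominus>\<^bsub>A\<^esub> y) + nrm A (x \<ominus>\<^bsub>A\<^esub> z)"
    and pos: "\<And>y z. y \<in> carrier A \<Longrightarrow> z \<in> carrier A \<Longrightarrow> nrm A (y \<ominus>\<^bsub>A\<^esub> z) \<le> 0 \<Longrightarrow> y = z"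
  shows "alg_exp A b = y"
  unfolding alg_exp_def psum_def[symmetric]
proof (rule the_equality)
  show "y \<in> carrier A \<and> (\<lambda>N. nrm A (psum A b N \<ominus>\<^bsub>A\<^esub> y)) \<longlonglongrightarrow> 0" using y by blast
  fix z assume z: "z \<in> carrier A \<and> (\<lambda>N. nrm A (psum A b N \<ominus>\<^bsub>A\<^esub> z)) \<longlonglongrightarrow> 0"
  then have "(\<lambda>N. nrm A (psum A b N \<ominus>\<^bsub>A\<^esub> z) + nrm A (psum A b N \<ominus>\<^bsub>A\<^esub> y)) \<longlonglongrightarrow> 0 + 0"
    using y by (intro tendsto_add) auto
  then have "nrm A (z \<ominus>\<^bsub>A\<^esub> y) \<le> 0 + 0"
    by (rule LIMSEQ_le_const) (use tri[OF p] z y in blast)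
  then show "z = y" using pos z y by simp
qed

definition exp_tail :: "real \<Rightarrow> nat \<Rightarrow> real" where
  "exp_tail R N = exp R - (\<Sum>j<N. R ^ j / fact j)"

lemma exp_tail_tendsto: "exp_tail R \<longlonglongrightarrow> 0"
proof -
  have "(\<lambda>j. R ^ j / fact j) sums exp R" using exp_converges[of R] by (simp add: field_simps)
  then have "(\<lambda>N. exp R - (\<Sum>j<N. R ^ j / fact j)) \<longlonglongrightarrow> exp R - exp R"
    unfolding sums_def by (intro tendsto_diff tendsto_const)
  then show ?thesis unfolding exp_tail_def by simp
qed

text \<open>The remainder is dominated term by term by that of \<open>exp R\<close>, which gives one
  rate for all eigenvalues in a disc.\<close>

lemma exp_partial_sum_bound:
  fixes z :: complex
  assumes z: "cmod z \<le> R"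
  shows "cmod ((\<Sum>j<N. (1 / fact j) * z ^ j) - exp z) \<le> exp_tail R N"
proof -
  have s: "(\<lambda>j. (1 / fact j) * z ^ j) sums exp z" using exp_converges[of z] by (simp add: scaleR_conv_of_real field_simps)
  have r: "(\<lambda>j. R ^ j / fact j) sums exp R" using exp_converges[of R] by (simp add: field_simps)
  have le: "cmod ((1 / fact j) * z ^ j) \<le> R ^ j / fact j" for j
    using power_mono[OF z, of j] by (simp add: norm_mult norm_divide norm_power divide_right_mono)
  have sr: "summable (\<lambda>j. R ^ (j + N) / fact (j + N))"
    using r summable_ignore_initial_segment[of "\<lambda>j. R ^ j / fact j" N] by (simp add: sums_iff)
  have "exp z - (\<Sum>j<N. (1 / fact j) * z ^ j) = (\<Sum>j. (1 / fact (j + N)) * z ^ (j + N))"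
    using suminf_minus_initial_segment[of "\<lambda>j. (1 / fact j) * z ^ j" N] s by (simp add: sums_iff)
  then have "cmod ((\<Sum>j<N. (1 / fact j) * z ^ j) - exp z) = cmod (\<Sum>j. (1 / fact (j + N)) * z ^ (j + N))"
    by (metis norm_minus_commute)
  also have "\<dots> \<le> (\<Sum>j. R ^ (j + N) / fact (j + N))"
    by (rule norm_suminf_le[OF le sr])
  also have "\<dots> = exp_tail R N"
    unfolding exp_tail_def using suminf_minus_initial_segment[of "\<lambda>j. R ^ j / fact j" N] r by (simp add: sums_iff)
  finally show ?thesis .
qed

definition mat_psum :: "nat \<Rightarrow> complex mat \<Rightarrow> (nat \<Rightarrow> real) \<Rightarrow> real \<Rightarrow> nat \<Rightarrow> complex mat" where
  "mat_psum n V \<mu> t N = conj_by V (diagm n (\<lambda>i. \<Sum>j<N. (1 / fact j) * (\<i> * complex_of_real (t * \<mu> i)) ^ j))"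

lemma conj_by_pow:
  assumes V: "unitary n V" and X: "X \<in> carrier_mat n n"
  shows "conj_by V X ^\<^sub>m j = conj_by V (X ^\<^sub>m j)"
proof (induction j)
  case 0
  have "dim_row (conj_by V X) = n" using unitaryD(1)[OF V] unfolding conj_by_def by simp
  then show ?case using conj_by_one[OF V] X by simp
next
  case (Suc j)
  then show ?case using conj_by_mult[OF V pow_carrier_mat[OF X] X] by simp
qed

lemma ii_diag_term:
  assumes V: "unitary n V"
  shows "(1 / fact j) \<cdot>\<^sub>m (((\<i> * complex_of_real t) \<cdot>\<^sub>m conj_by V (rdiag n \<mu>)) ^\<^sub>m j) =
    conj_by V (diagm n (\<lambda>i. (1 / fact j) * (\<i> * complex_of_real (t * \<mu> i)) ^ j))"
proof -
  note Vc = unitaryD[OF V]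
  have "(\<i> * complex_of_real t) \<cdot>\<^sub>m conj_by V (rdiag n \<mu>) =
      conj_by V (diagm n (\<lambda>i. \<i> * complex_of_real (t * \<mu> i)))"
    using Vc by (simp add: conj_by_smult[symmetric, of _ n] diagm_smult mult.assoc)
  then show ?thesis
    using Vc by (simp add: conj_by_pow[OF V] diagm_pow conj_by_smult[symmetric, of _ n] diagm_smult)
qed

lemma mat_psum_carrier [simp]: "V \<in> carrier_mat n n \<Longrightarrow> mat_psum n V \<mu> t N \<in> carrier_mat n n"
  unfolding mat_psum_def by simp

lemma mat_psum_rec:
  assumes V: "unitary n V"
  shows "mat_psum n V \<mu> t 0 = 0\<^sub>m n n"
    "mat_psum n V \<mu> t (Suc N) = (1 / fact N) \<cdot>\<^sub>m (((\<i> * complex_of_real t) \<cdot>\<^sub>m conj_by V (rdiag n \<mu>)) ^\<^sub>m N)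
       + mat_psum n V \<mu> t N"
proof -
  note Vc = unitaryD[OF V]
  show "mat_psum n V \<mu> t 0 = 0\<^sub>m n n"
    unfolding mat_psum_def conj_by_def using Vc
    by (simp add: diagm_zero right_mult_zero_mat[of _ n n] left_mult_zero_mat[of _ n n])
  show "mat_psum n V \<mu> t (Suc N) = (1 / fact N) \<cdot>\<^sub>m (((\<i> * complex_of_real t) \<cdot>\<^sub>m conj_by V (rdiag n \<mu>)) ^\<^sub>m N)
       + mat_psum n V \<mu> t N"
    unfolding ii_diag_term[OF V] mat_psum_def using Vc
    by (simp add: conj_by_add[symmetric, of _ n] diagm_add add.commute)
qed

text \<open>The rate depends on \<open>t\<close> and on the bound \<open>M\<close> of the
  eigenvalues, but not on the size. So one \<open>M\<close> for all blocks gives convergence uniform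
  in the blocks.\<close>

lemma mat_psum_bound:
  assumes V: "unitary n V" and M: "\<And>i. i < n \<Longrightarrow> \<bar>\<mu> i\<bar> \<le> M" and M0: "M \<ge> 0"
  shows "mat_op_norm (mat_psum n V \<mu> t N - uexp n V \<mu> t) \<le> exp_tail (\<bar>t\<bar> * M) N"
proof -
  note Vc = unitaryD[OF V]
  let ?f = "\<lambda>i. (\<Sum>j<N. (1 / fact j) * (\<i> * complex_of_real (t * \<mu> i)) ^ j) - expi (t * \<mu> i)"
  have "mat_psum n V \<mu> t N - uexp n V \<mu> t = conj_by V (diagm n ?f)"
    unfolding mat_psum_def uexp_def by (simp only: conj_by_diff[symmetric, OF Vc(1) diagm_carrier diagm_carrier] diagm_diff)
  then have "mat_op_norm (mat_psum n V \<mu> t N - uexp n V \<mu> t) = mat_op_norm (diagm n ?f)"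
    using conj_by_norm[OF V diagm_carrier] by simp
  also have "\<dots> \<le> exp_tail (\<bar>t\<bar> * M) N"
  proof (rule diagm_norm_le)
    fix i assume "i < n"
    then show "cmod (?f i) \<le> exp_tail (\<bar>t\<bar> * M) N"
      using M by (intro exp_partial_sum_bound) (simp add: norm_mult abs_mult mult_left_mono)
  next
    \<comment> \<open>The estimate at the point 0 shows that the tail is non-negative.\<close>
    have "cmod ((\<Sum>j<N. (1 / fact j) * 0 ^ j) - exp 0) \<le> exp_tail (\<bar>t\<bar> * M) N"
      using M0 by (intro exp_partial_sum_bound) simp
    then show "exp_tail (\<bar>t\<bar> * M) N \<ge> 0" using norm_ge_zero order_trans by blast
  qed
  finally show ?thesis .
qed

lemma matrix_alg_psum:
  assumes V: "unitary n V"
  shows "psum (matrix_alg n) ((\<i> * complex_of_real t) \<odot>\<^bsub>matrix_alg n\<^esub> conj_by V (rdiag n \<mu>)) N =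
    mat_psum n V \<mu> t N"
proof (induction N)
  case 0
  show ?case using psum_rec(1)[OF matrix_alg_ring] mat_psum_rec(1)[OF V] unitaryD(1)[OF V] by simp
next
  case (Suc N)
  have b: "(\<i> * complex_of_real t) \<cdot>\<^sub>m conj_by V (rdiag n \<mu>) \<in> carrier_mat n n"
    using unitaryD(1)[OF V] by simp
  show ?case
    using psum_rec(2)[OF matrix_alg_ring, of _ n N] b Suc mat_psum_rec(2)[OF V] by (simp add: matrix_alg_pow[OF b])
qed

lemma matrix_alg_exp:
  assumes V: "unitary n V"
  shows "alg_exp (matrix_alg n) ((\<i> * complex_of_real t) \<odot>\<^bsub>matrix_alg n\<^esub> conj_by V (rdiag n \<mu>)) =
    uexp n V \<mu> t"
proof (rule alg_exp_eqI)
  note Vc = unitaryD[OF V]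
  let ?M = "\<Sum>i<n. \<bar>\<mu> i\<bar>"
  have M: "\<bar>\<mu> i\<bar> \<le> ?M" if "i < n" for i using that by (intro member_le_sum) auto
  show "uexp n V \<mu> t \<in> carrier (matrix_alg n)" using Vc by simp
  show "(\<lambda>N. nrm (matrix_alg n) (psum (matrix_alg n) ((\<i> * complex_of_real t) \<odot>\<^bsub>matrix_alg n\<^esub> conj_by V (rdiag n \<mu>)) N
      \<ominus>\<^bsub>matrix_alg n\<^esub> uexp n V \<mu> t)) \<longlonglongrightarrow> 0"
    unfolding matrix_alg_psum[OF V]
  proof (rule tendsto_sandwich[OF _ _ tendsto_const exp_tail_tendsto[of "\<bar>t\<bar> * ?M"]])
    have e: "mat_psum n V \<mu> t N \<ominus>\<^bsub>matrix_alg n\<^esub> uexp n V \<mu> t = mat_psum n V \<mu> t N - uexp n V \<mu> t" for N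
      using Vc by (intro matrix_alg_minus) auto
    show "\<forall>\<^sub>F N in sequentially. 0 \<le> nrm (matrix_alg n) (mat_psum n V \<mu> t N \<ominus>\<^bsub>matrix_alg n\<^esub> uexp n V \<mu> t)"
      unfolding e by (intro always_eventually allI)
        (simp, rule mat_op_norm_nonneg, rule minus_carrier_mat, rule uexp_carrier, rule Vc)
    show "\<forall>\<^sub>F N in sequentially. nrm (matrix_alg n) (mat_psum n V \<mu> t N \<ominus>\<^bsub>matrix_alg n\<^esub> uexp n V \<mu> t) \<le> exp_tail (\<bar>t\<bar> * ?M) N"
      unfolding e by (intro always_eventually allI) (auto intro!: mat_psum_bound[OF V M] sum_nonneg)
  qed
next
  show "psum (matrix_alg n) ((\<i> * complex_of_real t) \<odot>\<^bsub>matrix_alg n\<^esub> conj_by V (rdiag n \<mu>)) N \<in> carrier (matrix_alg n)" for N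
    unfolding matrix_alg_psum[OF V] using unitaryD(1)[OF V] by simp
next
  fix x y z assume "x \<in> carrier (matrix_alg n)" "y \<in> carrier (matrix_alg n)" "z \<in> carrier (matrix_alg n)"
  then show "nrm (matrix_alg n) (y \<ominus>\<^bsub>matrix_alg n\<^esub> z) \<le> nrm (matrix_alg n) (x \<ominus>\<^bsub>matrix_alg n\<^esub> y) + nrm (matrix_alg n) (x \<ominus>\<^bsub>matrix_alg n\<^esub> z)"
    using mat_op_norm_diff_triangle[of y n x z] mat_op_norm_diff_commute[of x n y] by (simp add: matrix_alg_minus)
next
  fix y z assume yz: "y \<in> carrier (matrix_alg n)" "z \<in> carrier (matrix_alg n)"
    and le: "nrm (matrix_alg n) (y \<ominus>\<^bsub>matrix_alg n\<^esub> z) \<le> 0"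
  then have c: "y \<in> carrier_mat n n" "z \<in> carrier_mat n n" "y - z \<in> carrier_mat n n" by auto
  then have "mat_op_norm (y - z) = 0"
    using le mat_op_norm_nonneg[OF c(3)] by (simp add: matrix_alg_minus)
  then have d: "y - z = 0\<^sub>m n n" by (rule mat_op_norm_eq_0[OF c(3)])
  show "y = z"
  proof (rule eq_matI)
    fix i j assume "i < dim_row z" "j < dim_col z"
    then show "y $$ (i,j) = z $$ (i,j)" using arg_cong[OF d, of "\<lambda>X. X $$ (i,j)"] c by simp
  qed (use c in auto)
qed

lemma uexp_diff_norm:
  assumes V: "unitary n V" and M: "\<And>i. i < n \<Longrightarrow> \<bar>\<mu> i\<bar> \<le> M" and M0: "M \<ge> 0"
  shows "mat_op_norm (uexp n V \<mu> t - uexp n V \<mu> s) \<le> \<bar>t - s\<bar> * M"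
proof -
  note Vc = unitaryD[OF V]
  let ?f = "\<lambda>i. expi (t * \<mu> i) - expi (s * \<mu> i)"
  have "uexp n V \<mu> t - uexp n V \<mu> s = conj_by V (diagm n ?f)"
    unfolding uexp_def by (simp only: conj_by_diff[symmetric, OF Vc(1) diagm_carrier diagm_carrier] diagm_diff)
  then have "mat_op_norm (uexp n V \<mu> t - uexp n V \<mu> s) = mat_op_norm (diagm n ?f)"
    using conj_by_norm[OF V diagm_carrier] by simp
  also have "\<dots> \<le> \<bar>t - s\<bar> * M"
  proof (rule diagm_norm_le)
    fix i assume i: "i < n"
    have "cmod (?f i) \<le> \<bar>t * \<mu> i - s * \<mu> i\<bar>" by (rule cmod_exp_ii_diff_le)
    also have "\<dots> = \<bar>t - s\<bar> * \<bar>\<mu> i\<bar>" by (simp add: left_diff_distrib[symmetric] abs_mult)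
    also have "\<dots> \<le> \<bar>t - s\<bar> * M" using M[OF i] by (intro mult_left_mono) auto
    finally show "cmod (?f i) \<le> \<bar>t - s\<bar> * M" .
  qed (use M0 in simp)
  finally show ?thesis .
qed

text \<open>The difference is split as \<open>(E - F) X E* + F X (E - F)*\<close>, with the star for
  the adjoint, and unitaries have norm at most 1.\<close>

lemma conj_by_diff_norm:
  assumes "unitary n E" "unitary n F" and X: "X \<in> carrier_mat n n"
  shows "mat_op_norm (conj_by E X - conj_by F X) \<le> 2 * mat_op_norm (E - F) * mat_op_norm X"
proof -
  note c = unitaryD(1,2)[OF assms(1)] unitaryD(1,2)[OF assms(2)]
  have d: "E - F \<in> carrier_mat n n" using c by (intro minus_carrier_mat)
  have da: "mat_adjoint (E - F) = mat_adjoint E - mat_adjoint F" using c by (intro eq_matI) auto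
  have "conj_by E X - conj_by F X = (E - F) * (X * mat_adjoint E) + F * (X * mat_adjoint (E - F))"
    unfolding conj_by_def da using c X
    by (intro eq_matI)
       (auto simp: minus_mult_distrib_mat[of _ n n _ _ n] mult_minus_distrib_mat[of _ n n _ n] assoc_square[of _ n])
  then have "mat_op_norm (conj_by E X - conj_by F X) \<le>
      mat_op_norm ((E - F) * (X * mat_adjoint E)) + mat_op_norm (F * (X * mat_adjoint (E - F)))"
    using mat_op_norm_add[of "(E - F) * (X * mat_adjoint E)" n "F * (X * mat_adjoint (E - F))"] c X d by simp
  also have "mat_op_norm ((E - F) * (X * mat_adjoint E)) \<le> mat_op_norm (E - F) * (mat_op_norm X * 1)"
  proof (rule order_trans[OF mat_op_norm_mult[OF d]])
    show "X * mat_adjoint E \<in> carrier_mat n n" using c X by simp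
    have "mat_op_norm (X * mat_adjoint E) \<le> mat_op_norm X * mat_op_norm (mat_adjoint E)"
      by (rule mat_op_norm_mult[OF X c(2)])
    also have "\<dots> \<le> mat_op_norm X * 1"
      using unitary_norm_le[OF unitary_adjoint[OF assms(1)]] mat_op_norm_nonneg[OF X] by (intro mult_left_mono)
    finally show "mat_op_norm (E - F) * mat_op_norm (X * mat_adjoint E) \<le> mat_op_norm (E - F) * (mat_op_norm X * 1)"
      using mat_op_norm_nonneg[OF d] by (rule mult_left_mono)
  qed
  also have "mat_op_norm (F * (X * mat_adjoint (E - F))) \<le> 1 * (mat_op_norm X * mat_op_norm (E - F))"
  proof (rule order_trans[OF mat_op_norm_mult[OF c(3)]])
    have dc: "mat_adjoint (E - F) \<in> carrier_mat n n" using d by simp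
    then show Xd: "X * mat_adjoint (E - F) \<in> carrier_mat n n" using X by simp
    show "mat_op_norm F * mat_op_norm (X * mat_adjoint (E - F)) \<le> 1 * (mat_op_norm X * mat_op_norm (E - F))"
      using mat_op_norm_mult[OF X dc] mat_op_norm_adjoint[OF d] unitary_norm_le[OF assms(2)] mat_op_norm_nonneg[OF Xd]
      by (intro mult_mono) auto
  qed
  finally show ?thesis by (simp add: mult_ac)
qed

section \<open>The product algebra and its quotient\<close>

lemma uexp_add:
  assumes U: "unitary n U"
  shows "uexp n U l s * uexp n U l t = uexp n U l (s + t)"
proof -
  have "uexp n U l s * uexp n U l t = conj_by U (diagm n (\<lambda>i. expi (s * l i) * expi (t * l i)))"
    unfolding uexp_def by (simp only: conj_by_mult[OF U diagm_carrier diagm_carrier] diagm_mult)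
  also have "(\<lambda>i. expi (s * l i) * expi (t * l i)) = (\<lambda>i. expi ((s + t) * l i))"
    unfolding exp_add[symmetric] by (simp add: algebra_simps)
  finally show ?thesis unfolding uexp_def .
qed

lemma uexp_zero: "unitary n U \<Longrightarrow> uexp n U l 0 = 1\<^sub>m n"
  unfolding uexp_def by (simp add: diagm_one conj_by_one)

text \<open>The flows are given by spectral data \<open>U\<close>, \<open>l\<close> of their
  generators, since every estimate is made in the eigenbases. The final theorem obtains these data
  by diagonalising each \<open>h n\<close>.\<close>

locale block_flow =
  fixes k :: "nat \<Rightarrow> nat" and U :: "nat \<Rightarrow> complex mat" and l :: "nat \<Rightarrow> nat \<Rightarrow> real"
    and \<beta> :: "nat \<Rightarrow> real \<Rightarrow> complex mat \<Rightarrow> complex mat"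
  assumes U: "\<And>n. unitary (k n) (U n)"
    and beta: "\<And>n t X. X \<in> carrier_mat (k n) (k n) \<Longrightarrow> \<beta> n t X = conj_by (uexp (k n) (U n) (l n) t) X"
begin

abbreviation "C n \<equiv> carrier_mat (k n) (k n)"
abbreviation "B \<equiv> product_alg (\<lambda>n. matrix_alg (k n))"
abbreviation "I \<equiv> c0_direct_sum (\<lambda>n. matrix_alg (k n))"
abbreviation "Bb \<equiv> continuous_part B (product_flow \<beta>)"
abbreviation "Q \<equiv> quotient_alg Bb I"

definition bounded_seq :: "(nat \<Rightarrow> complex mat) \<Rightarrow> bool" where
  "bounded_seq x \<longleftrightarrow> (\<forall>n. x n \<in> C n) \<and> (\<exists>K. \<forall>n. mat_op_norm (x n) \<le> K)"

text \<open>Norm continuity of the orbit in the product, rewritten as continuity at time 0 uniformly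
  over the blocks; see \<open>norm_continuous_orbit_iff\<close>. The bound is not strict, so that it
  passes through the supremum norm.\<close>

definition equicont :: "(nat \<Rightarrow> complex mat) \<Rightarrow> bool" where
  "equicont x \<longleftrightarrow> (\<forall>e>0. \<exists>d>0. \<forall>t. \<bar>t\<bar> < d \<longrightarrow> (\<forall>n. mat_op_norm (\<beta> n t (x n) - x n) \<le> e))"

lemma bounded_seqD: "bounded_seq x \<Longrightarrow> x n \<in> C n"
  unfolding bounded_seq_def by blast

lemma bounded_seqE:
  assumes "bounded_seq x"
  obtains K where "K > 0" "\<And>n. mat_op_norm (x n) \<le> K"
proof -
  obtain K where K: "\<And>n. mat_op_norm (x n) \<le> K" using assms unfolding bounded_seq_def by blast
  have "mat_op_norm (x n) \<le> max K 1" for n using K[of n] by simp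
  then show thesis by (intro that[of "max K 1"]) simp_all
qed

lemma bounded_seqI: "(\<And>n. x n \<in> C n) \<Longrightarrow> (\<And>n. mat_op_norm (x n) \<le> K) \<Longrightarrow> bounded_seq x"
  unfolding bounded_seq_def by blast

lemma carrier_B: "x \<in> carrier B \<longleftrightarrow> bounded_seq x"
  unfolding product_alg_def bounded_seq_def bdd_above_def by auto

lemma B_simps:
  "x \<otimes>\<^bsub>B\<^esub> y = (\<lambda>n. x n * y n)" "x \<oplus>\<^bsub>B\<^esub> y = (\<lambda>n. x n + y n)"
  "\<one>\<^bsub>B\<^esub> = (\<lambda>n. 1\<^sub>m (k n))" "\<zero>\<^bsub>B\<^esub> = (\<lambda>n. 0\<^sub>m (k n) (k n))"
  "z \<odot>\<^bsub>B\<^esub> x = (\<lambda>n. z \<cdot>\<^sub>m x n)" "star B x = (\<lambda>n. mat_adjoint (x n))"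
  "nrm B x = (SUP n. mat_op_norm (x n))"
  unfolding product_alg_def by simp_all

lemma bounded_seq_add: "bounded_seq x \<Longrightarrow> bounded_seq y \<Longrightarrow> bounded_seq (\<lambda>n. x n + y n)"
proof -
  assume x: "bounded_seq x" and y: "bounded_seq y"
  from x obtain K where K: "K > 0" "\<And>n. mat_op_norm (x n) \<le> K" by (rule bounded_seqE) blast
  from y obtain L where L: "L > 0" "\<And>n. mat_op_norm (y n) \<le> L" by (rule bounded_seqE) blast
  show ?thesis
  proof (rule bounded_seqI)
    show "x n + y n \<in> C n" for n using bounded_seqD[OF x] bounded_seqD[OF y] by simp
    show "mat_op_norm (x n + y n) \<le> K + L" for n
      using mat_op_norm_add[OF bounded_seqD[OF x] bounded_seqD[OF y], of n] K(2)[of n] L(2)[of n] by linarith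
  qed
qed

lemma bounded_seq_mult: "bounded_seq x \<Longrightarrow> bounded_seq y \<Longrightarrow> bounded_seq (\<lambda>n. x n * y n)"
proof -
  assume x: "bounded_seq x" and y: "bounded_seq y"
  from x obtain K where K: "K > 0" "\<And>n. mat_op_norm (x n) \<le> K" by (rule bounded_seqE) blast
  from y obtain L where L: "L > 0" "\<And>n. mat_op_norm (y n) \<le> L" by (rule bounded_seqE) blast
  show ?thesis
  proof (rule bounded_seqI)
    show "x n * y n \<in> C n" for n using bounded_seqD[OF x] bounded_seqD[OF y] by simp
    fix n
    have "mat_op_norm (x n) * mat_op_norm (y n) \<le> K * L"
      using K(1) K(2)[of n] L(2)[of n] mat_op_norm_nonneg[OF bounded_seqD[OF y]] by (intro mult_mono) auto
    then show "mat_op_norm (x n * y n) \<le> K * L"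
      using mat_op_norm_mult[OF bounded_seqD[OF x] bounded_seqD[OF y], of n] by linarith
  qed
qed

lemma bounded_seq_smult:
  assumes x: "bounded_seq x"
  shows "bounded_seq (\<lambda>n. z \<cdot>\<^sub>m x n)"
proof -
  from x obtain K where K: "K > 0" "\<And>n. mat_op_norm (x n) \<le> K" by (rule bounded_seqE) blast
  show ?thesis
  proof (rule bounded_seqI)
    show "z \<cdot>\<^sub>m x n \<in> C n" for n using bounded_seqD[OF x] by simp
    show "mat_op_norm (z \<cdot>\<^sub>m x n) \<le> cmod z * K" for n
      using mat_op_norm_smult_le[OF bounded_seqD[OF x], of z n] mult_left_mono[OF K(2)[of n] norm_ge_zero[of z]] by linarith
  qed
qed

lemma uminus_eq_smult: "- X = (-1) \<cdot>\<^sub>m (X :: complex mat)"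
  by (rule eq_matI) auto

lemma bounded_seq_uminus: "bounded_seq x \<Longrightarrow> bounded_seq (\<lambda>n. - x n)"
  unfolding uminus_eq_smult by (rule bounded_seq_smult)

lemma bounded_seq_star:
  assumes x: "bounded_seq x"
  shows "bounded_seq (\<lambda>n. mat_adjoint (x n))"
proof -
  from x obtain K where K: "K > 0" "\<And>n. mat_op_norm (x n) \<le> K" by (rule bounded_seqE) blast
  show ?thesis
    by (rule bounded_seqI[of _ K]) (simp_all add: bounded_seqD[OF x] mat_op_norm_adjoint[OF bounded_seqD[OF x]] K(2))
qed

lemma mat_one_norm_le: "mat_op_norm (1\<^sub>m n) \<le> 1"
  by (rule unitary_norm_le[of n]) (simp add: unitary_def)

lemma bounded_seq_one: "bounded_seq (\<lambda>n. 1\<^sub>m (k n))"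
  by (rule bounded_seqI[of _ 1]) (simp_all add: mat_one_norm_le)

lemma bounded_seq_zero: "bounded_seq (\<lambda>n. 0\<^sub>m (k n) (k n))"
  by (rule bounded_seqI[of _ 1]) (simp_all add: mat_op_norm_zero)

lemma ring_B: "ring B"
proof (rule ringI)
  show "abelian_group B"
  proof (rule abelian_groupI)
    fix x y z assume "x \<in> carrier B" "y \<in> carrier B" "z \<in> carrier B"
    then have c: "x n \<in> C n" "y n \<in> C n" "z n \<in> C n" for n
      by (auto simp: carrier_B dest: bounded_seqD)
    show "x \<oplus>\<^bsub>B\<^esub> y \<oplus>\<^bsub>B\<^esub> z = x \<oplus>\<^bsub>B\<^esub> (y \<oplus>\<^bsub>B\<^esub> z)"
      unfolding B_simps using assoc_add_mat[OF c] by simp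
  next
    fix x y assume "x \<in> carrier B" "y \<in> carrier B"
    then have c: "x n \<in> C n" "y n \<in> C n" for n by (auto simp: carrier_B dest: bounded_seqD)
    show "x \<oplus>\<^bsub>B\<^esub> y = y \<oplus>\<^bsub>B\<^esub> x" unfolding B_simps using comm_add_mat[OF c] by simp
  next
    fix x assume x: "x \<in> carrier B"
    then have c: "x n \<in> C n" for n by (auto simp: carrier_B dest: bounded_seqD)
    show "\<zero>\<^bsub>B\<^esub> \<oplus>\<^bsub>B\<^esub> x = x" unfolding B_simps using left_add_zero_mat[OF c] by simp
    have "(\<lambda>n. - x n) \<oplus>\<^bsub>B\<^esub> x = \<zero>\<^bsub>B\<^esub>" unfolding B_simps using uminus_l_inv_mat[OF c] by simp
    moreover have "(\<lambda>n. - x n) \<in> carrier B" using x bounded_seq_uminus unfolding carrier_B by blast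
    ultimately show "\<exists>y\<in>carrier B. y \<oplus>\<^bsub>B\<^esub> x = \<zero>\<^bsub>B\<^esub>" by blast
  qed (auto simp: carrier_B B_simps bounded_seq_add bounded_seq_zero)
  show "monoid B"
  proof (rule monoidI)
    fix x y z assume "x \<in> carrier B" "y \<in> carrier B" "z \<in> carrier B"
    then have c: "x n \<in> C n" "y n \<in> C n" "z n \<in> C n" for n
      by (auto simp: carrier_B dest: bounded_seqD)
    show "x \<otimes>\<^bsub>B\<^esub> y \<otimes>\<^bsub>B\<^esub> z = x \<otimes>\<^bsub>B\<^esub> (y \<otimes>\<^bsub>B\<^esub> z)"
      unfolding B_simps using assoc_square[OF c] by simp
  next
    fix x assume x: "x \<in> carrier B"
    then have c: "x n \<in> C n" for n by (auto simp: carrier_B dest: bounded_seqD)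
    show "\<one>\<^bsub>B\<^esub> \<otimes>\<^bsub>B\<^esub> x = x" "x \<otimes>\<^bsub>B\<^esub> \<one>\<^bsub>B\<^esub> = x"
      unfolding B_simps using left_mult_one_mat[OF c] right_mult_one_mat[OF c] by simp_all
  qed (auto simp: carrier_B B_simps bounded_seq_mult bounded_seq_one)
  fix x y z assume "x \<in> carrier B" "y \<in> carrier B" "z \<in> carrier B"
  then have c: "x n \<in> C n" "y n \<in> C n" "z n \<in> C n" for n
    by (auto simp: carrier_B dest: bounded_seqD)
  show "(x \<oplus>\<^bsub>B\<^esub> y) \<otimes>\<^bsub>B\<^esub> z = x \<otimes>\<^bsub>B\<^esub> z \<oplus>\<^bsub>B\<^esub> y \<otimes>\<^bsub>B\<^esub> z"
    unfolding B_simps using add_mult_distrib_mat[OF c] by simp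
  show "z \<otimes>\<^bsub>B\<^esub> (x \<oplus>\<^bsub>B\<^esub> y) = z \<otimes>\<^bsub>B\<^esub> x \<oplus>\<^bsub>B\<^esub> z \<otimes>\<^bsub>B\<^esub> y"
    unfolding B_simps using mult_add_distrib_mat[OF c(3,1,2)] by simp
qed

lemma B_uminus: "x \<in> carrier B \<Longrightarrow> \<ominus>\<^bsub>B\<^esub> x = (\<lambda>n. - x n)"
proof -
  assume x: "x \<in> carrier B"
  interpret ring B by (rule ring_B)
  have c: "x n \<in> C n" for n using x by (auto simp: carrier_B dest: bounded_seqD)
  show ?thesis
  proof (rule minus_equality)
    show "(\<lambda>n. - x n) \<oplus>\<^bsub>B\<^esub> x = \<zero>\<^bsub>B\<^esub>" unfolding B_simps using uminus_l_inv_mat[OF c] by simp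
    show "(\<lambda>n. - x n) \<in> carrier B" using x bounded_seq_uminus unfolding carrier_B by blast
  qed (rule x)
qed

lemma B_minus:
  assumes "x \<in> carrier B" "y \<in> carrier B"
  shows "x \<ominus>\<^bsub>B\<^esub> y = (\<lambda>n. x n - y n)"
proof -
  have c: "x n \<in> C n" "y n \<in> C n" for n using assms by (auto simp: carrier_B dest: bounded_seqD)
  show ?thesis unfolding a_minus_def B_uminus[OF assms(2)] B_simps using add_uminus_minus_mat[OF c] by simp
qed

lemma nrm_B_le_iff:
  assumes "bounded_seq x"
  shows "nrm B x \<le> e \<longleftrightarrow> (\<forall>n. mat_op_norm (x n) \<le> e)"
proof -
  have "bdd_above (range (\<lambda>n. mat_op_norm (x n)))"
    using assms unfolding bounded_seq_def bdd_above_def by auto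
  then show ?thesis unfolding B_simps by (subst cSUP_le_iff) auto
qed

lemma nrm_B_nonneg: "bounded_seq x \<Longrightarrow> nrm B x \<ge> 0"
  by (rule order_trans[OF mat_op_norm_nonneg[OF bounded_seqD[of x 0]]]) (use nrm_B_le_iff[of x "nrm B x"] in auto)

lemma Ebeta: "unitary (k n) (uexp (k n) (U n) (l n) t)"
  by (rule uexp_unitary[OF U])

lemma beta_C: "X \<in> C n \<Longrightarrow> \<beta> n t X \<in> C n"
  using unitaryD(1)[OF Ebeta] by (simp add: beta)

lemma beta_norm: "X \<in> C n \<Longrightarrow> mat_op_norm (\<beta> n t X) = mat_op_norm X"
  by (simp add: beta conj_by_norm[OF Ebeta])

lemma beta_mult: "X \<in> C n \<Longrightarrow> Y \<in> C n \<Longrightarrow> \<beta> n t (X * Y) = \<beta> n t X * \<beta> n t Y"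
  by (simp add: beta conj_by_mult[OF Ebeta])

lemma beta_add: "X \<in> C n \<Longrightarrow> Y \<in> C n \<Longrightarrow> \<beta> n t (X + Y) = \<beta> n t X + \<beta> n t Y"
  by (simp add: beta conj_by_add[OF unitaryD(1)[OF Ebeta]])

lemma beta_diff: "X \<in> C n \<Longrightarrow> Y \<in> C n \<Longrightarrow> \<beta> n t (X - Y) = \<beta> n t X - \<beta> n t Y"
  by (simp add: beta conj_by_diff[OF unitaryD(1)[OF Ebeta]] minus_carrier_mat)

lemma beta_smult: "X \<in> C n \<Longrightarrow> \<beta> n t (z \<cdot>\<^sub>m X) = z \<cdot>\<^sub>m \<beta> n t X"
  by (simp add: beta conj_by_smult[OF unitaryD(1)[OF Ebeta]])

lemma beta_adjoint: "X \<in> C n \<Longrightarrow> \<beta> n t (mat_adjoint X) = mat_adjoint (\<beta> n t X)"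
  by (simp add: beta conj_by_adjoint[OF unitaryD(1)[OF Ebeta]])

lemma beta_one: "\<beta> n t (1\<^sub>m (k n)) = 1\<^sub>m (k n)"
  by (simp add: beta conj_by_one[OF Ebeta])

lemma beta_0: "X \<in> C n \<Longrightarrow> \<beta> n 0 X = X"
  by (simp add: beta uexp_zero[OF U] conj_by_def left_mult_one_mat[of _ "k n" "k n"] right_mult_one_mat[of _ "k n" "k n"])

lemma beta_beta: "X \<in> C n \<Longrightarrow> \<beta> n s (\<beta> n t X) = \<beta> n (s + t) X"
  using unitaryD(1)[OF Ebeta]
  by (simp add: beta conj_by_conj_by[of _ "k n"] uexp_add[OF U])

text \<open>Each \<open>\<beta> n s\<close> is isometric, so continuity at any time is continuity at
  time 0.\<close>

lemma beta_diff_norm: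
  assumes X: "X \<in> C n"
  shows "mat_op_norm (\<beta> n t X - \<beta> n s X) = mat_op_norm (\<beta> n (t - s) X - X)"
proof -
  have "\<beta> n t X - \<beta> n s X = \<beta> n s (\<beta> n (t - s) X - X)"
    using beta_diff[OF beta_C[OF X] X, of s "t - s"] beta_beta[OF X, of s "t - s"] by simp
  then show ?thesis using beta_norm[OF minus_carrier_mat[OF X]] by simp
qed

lemma bounded_seq_beta:
  assumes x: "bounded_seq x"
  shows "bounded_seq (\<lambda>n. \<beta> n t (x n))"
proof -
  from x obtain K where K: "K > 0" "\<And>n. mat_op_norm (x n) \<le> K" by (rule bounded_seqE) blast
  show ?thesis
    by (rule bounded_seqI[of _ K]) (simp_all add: beta_C[OF bounded_seqD[OF x]] beta_norm[OF bounded_seqD[OF x]] K(2))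
qed

lemma bounded_seq_diff:
  assumes "bounded_seq x" "bounded_seq y"
  shows "bounded_seq (\<lambda>n. x n - y n)"
proof -
  have "(\<lambda>n. x n - y n) = (\<lambda>n. x n + - y n)"
    using add_uminus_minus_mat[OF bounded_seqD[OF assms(1)] bounded_seqD[OF assms(2)]] by simp
  then show ?thesis using bounded_seq_add[OF assms(1) bounded_seq_uminus[OF assms(2)]] by simp
qed

lemma norm_continuous_orbit_iff:
  assumes x: "bounded_seq x"
  shows "norm_continuous_orbit B (product_flow \<beta>) x \<longleftrightarrow> equicont x"
proof -
  note xc = bounded_seqD[OF x]
  let ?f = "\<lambda>t s. nrm B (product_flow \<beta> t x \<ominus>\<^bsub>B\<^esub> product_flow \<beta> s x)"
  have e: "product_flow \<beta> t x \<ominus>\<^bsub>B\<^esub> product_flow \<beta> s x = (\<lambda>n. \<beta> n t (x n) - \<beta> n s (x n))" for t s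
    unfolding product_flow_def by (rule B_minus) (simp_all add: carrier_B bounded_seq_beta[OF x])
  have bs: "bounded_seq (\<lambda>n. \<beta> n t (x n) - \<beta> n s (x n))" for t s
    by (intro bounded_seq_diff bounded_seq_beta x)
  have le: "?f t s \<le> a \<longleftrightarrow> (\<forall>n. mat_op_norm (\<beta> n (t - s) (x n) - x n) \<le> a)" for t s a
    unfolding e nrm_B_le_iff[OF bs] beta_diff_norm[OF xc] ..
  have pos: "?f t s \<ge> 0" for t s unfolding e by (rule nrm_B_nonneg[OF bs])
  show ?thesis
  proof
    assume "norm_continuous_orbit B (product_flow \<beta>) x"
    then have lim: "((\<lambda>t. ?f t 0) \<longlongrightarrow> 0) (at 0)" unfolding norm_continuous_orbit_def by blast
    show "equicont x"
      unfolding equicont_def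
    proof (intro allI impI)
      fix a :: real assume a: "a > 0"
      then have "\<forall>\<^sub>F t in at 0. dist (?f t 0) 0 < a" using lim by (rule tendstoD[rotated])
      then obtain d where d: "d > 0" and near: "\<And>t. t \<noteq> 0 \<Longrightarrow> \<bar>t\<bar> < d \<Longrightarrow> ?f t 0 < a"
        unfolding eventually_at using pos by (auto simp: dist_real_def)
      have "mat_op_norm (\<beta> n t (x n) - x n) \<le> a" if t: "\<bar>t\<bar> < d" for t n
      proof (cases "t = 0")
        case True
        have "x n - x n = 0\<^sub>m (k n) (k n)" using minus_r_inv_mat[OF xc] .
        then show ?thesis using True beta_0[OF xc] a by (simp add: mat_op_norm_zero)
      next
        case False
        then show ?thesis using le[of t 0 a] near[OF False t] by (simp add: less_imp_le)
      qed
      then show "\<exists>d>0. \<forall>t. \<bar>t\<bar> < d \<longrightarrow> (\<forall>n. mat_op_norm (\<beta> n t (x n) - x n) \<le> a)" using d by blast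
    qed
  next
    assume eq: "equicont x"
    show "norm_continuous_orbit B (product_flow \<beta>) x"
      unfolding norm_continuous_orbit_def
    proof (intro allI tendstoI)
      fix s a :: real assume a: "a > 0"
      then obtain d where d: "d > 0" "\<forall>t. \<bar>t\<bar> < d \<longrightarrow> (\<forall>n. mat_op_norm (\<beta> n t (x n) - x n) \<le> a / 2)"
        using eq unfolding equicont_def by (meson half_gt_zero)
      show "\<forall>\<^sub>F t in at s. dist (?f t s) 0 < a"
        unfolding eventually_at
      proof (intro exI[of _ d] conjI ballI impI d(1))
        fix t assume "t \<noteq> s \<and> dist t s < d"
        then have "?f t s \<le> a / 2" unfolding le using d(2) by (simp add: dist_real_def)
        then show "dist (?f t s) 0 < a" using a pos[of t s] by (simp add: dist_real_def)
      qed
    qed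
  qed
qed

lemma carrier_Bb: "x \<in> carrier Bb \<longleftrightarrow> bounded_seq x \<and> equicont x"
  unfolding continuous_part_def using norm_continuous_orbit_iff[of x] carrier_B[of x] by auto

lemma equicontI:
  assumes "\<And>e. e > 0 \<Longrightarrow> \<exists>d>0. \<forall>t. \<bar>t\<bar> < d \<longrightarrow> (\<forall>n. mat_op_norm (\<beta> n t (x n) - x n) \<le> e)"
  shows "equicont x"
  unfolding equicont_def using assms by blast

lemma equicontE:
  assumes "equicont x" "e > 0"
  obtains d where "d > 0" "\<And>t n. \<bar>t\<bar> < d \<Longrightarrow> mat_op_norm (\<beta> n t (x n) - x n) \<le> e"
  using assms unfolding equicont_def by blast

text \<open>One criterion for sums, products, scalar multiples and adjoints; the unary operations
  take \<open>y\<close> and \<open>z\<close> equal.\<close>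

lemma equicont_combine:
  assumes y: "equicont y" and z: "equicont z" and K: "K > 0"
    and le: "\<And>n t. mat_op_norm (\<beta> n t (x n) - x n) \<le> K * mat_op_norm (\<beta> n t (y n) - y n) + K * mat_op_norm (\<beta> n t (z n) - z n)"
  shows "equicont x"
proof (rule equicontI)
  fix e :: real assume "e > 0"
  then have e: "e / (2 * K) > 0" using K by simp
  obtain d where d: "d > 0" "\<And>t n. \<bar>t\<bar> < d \<Longrightarrow> mat_op_norm (\<beta> n t (y n) - y n) \<le> e / (2 * K)"
    using equicontE[OF y e] by blast
  obtain d' where d': "d' > 0" "\<And>t n. \<bar>t\<bar> < d' \<Longrightarrow> mat_op_norm (\<beta> n t (z n) - z n) \<le> e / (2 * K)"
    using equicontE[OF z e] by blast
  have "mat_op_norm (\<beta> n t (x n) - x n) \<le> e" if "\<bar>t\<bar> < min d d'" for t n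
  proof -
    have "mat_op_norm (\<beta> n t (x n) - x n) \<le> K * (e / (2 * K)) + K * (e / (2 * K))"
      using le[of n t] d(2)[of t n] d'(2)[of t n] that K
      by (meson add_mono less_imp_le min_less_iff_conj mult_left_mono order_trans)
    also have "\<dots> = e" using K by simp
    finally show ?thesis .
  qed
  then show "\<exists>d>0. \<forall>t. \<bar>t\<bar> < d \<longrightarrow> (\<forall>n. mat_op_norm (\<beta> n t (x n) - x n) \<le> e)"
    using d(1) d'(1) by (intro exI[of _ "min d d'"]) simp
qed

lemma equicont_add:
  assumes x: "bounded_seq x" and y: "bounded_seq y" and "equicont x" "equicont y"
  shows "equicont (\<lambda>n. x n + y n)"
proof (rule equicont_combine[of x y 1])
  fix n t
  note c = bounded_seqD[OF x, of n] bounded_seqD[OF y, of n]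
  note b = beta_C[OF c(1), of t] beta_C[OF c(2), of t]
  have "\<beta> n t (x n + y n) - (x n + y n) = (\<beta> n t (x n) - x n) + (\<beta> n t (y n) - y n)"
    unfolding beta_add[OF c] using c b by (intro eq_matI) auto
  then show "mat_op_norm (\<beta> n t (x n + y n) - (x n + y n)) \<le> 1 * mat_op_norm (\<beta> n t (x n) - x n) + 1 * mat_op_norm (\<beta> n t (y n) - y n)"
    using mat_op_norm_add[OF minus_carrier_mat[OF c(1)] minus_carrier_mat[OF c(2)]] by simp
qed (use assms in auto)

lemma equicont_mult:
  assumes x: "bounded_seq x" and y: "bounded_seq y" and "equicont x" "equicont y"
  shows "equicont (\<lambda>n. x n * y n)"
proof -
  obtain K where K: "K > 0" "\<And>n. mat_op_norm (x n) \<le> K" using bounded_seqE[OF x] by blast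
  obtain L where L: "L > 0" "\<And>n. mat_op_norm (y n) \<le> L" using bounded_seqE[OF y] by blast
  show ?thesis
  proof (rule equicont_combine[of x y "K + L"])
    fix n t
    note c = bounded_seqD[OF x, of n] bounded_seqD[OF y, of n]
    note b = beta_C[OF c(1), of t] beta_C[OF c(2), of t]
    note d = minus_carrier_mat[OF c(1), of "\<beta> n t (x n)"] minus_carrier_mat[OF c(2), of "\<beta> n t (y n)"]
    have "\<beta> n t (x n * y n) - x n * y n = (\<beta> n t (x n) - x n) * \<beta> n t (y n) + x n * (\<beta> n t (y n) - y n)"
      unfolding beta_mult[OF c] minus_mult_distrib_mat[OF b(1) c(1) b(2)] mult_minus_distrib_mat[OF c(1) b(2) c(2)]
      using c b by (intro eq_matI) auto
    also have "mat_op_norm \<dots> \<le> mat_op_norm ((\<beta> n t (x n) - x n) * \<beta> n t (y n)) + mat_op_norm (x n * (\<beta> n t (y n) - y n))"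
      by (rule mat_op_norm_add[OF mult_carrier_mat[OF d(1) b(2)] mult_carrier_mat[OF c(1) d(2)]])
    also have "\<dots> \<le> mat_op_norm (\<beta> n t (x n) - x n) * mat_op_norm (y n) + mat_op_norm (x n) * mat_op_norm (\<beta> n t (y n) - y n)"
      using mat_op_norm_mult[OF d(1) b(2)] mat_op_norm_mult[OF c(1) d(2)] beta_norm[OF c(2)] by (intro add_mono) auto
    also have "\<dots> \<le> mat_op_norm (\<beta> n t (x n) - x n) * (K + L) + (K + L) * mat_op_norm (\<beta> n t (y n) - y n)"
      using K(1) K(2)[of n] L(1) L(2)[of n] mat_op_norm_nonneg[OF d(1)] mat_op_norm_nonneg[OF d(2)]
      by (intro add_mono mult_left_mono mult_right_mono) auto
    finally show "mat_op_norm (\<beta> n t (x n * y n) - x n * y n) \<le>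
      (K + L) * mat_op_norm (\<beta> n t (x n) - x n) + (K + L) * mat_op_norm (\<beta> n t (y n) - y n)"
      by (simp add: mult.commute)
  qed (use assms K L in auto)
qed

lemma equicont_smult:
  assumes x: "bounded_seq x" and "equicont x"
  shows "equicont (\<lambda>n. z \<cdot>\<^sub>m x n)"
proof (rule equicont_combine[of x x "cmod z + 1"])
  fix n t
  note c = bounded_seqD[OF x, of n]
  note d = minus_carrier_mat[OF c, of "\<beta> n t (x n)"]
  have "\<beta> n t (z \<cdot>\<^sub>m x n) - z \<cdot>\<^sub>m x n = z \<cdot>\<^sub>m (\<beta> n t (x n) - x n)"
    unfolding beta_smult[OF c] using c beta_C[OF c, of t] by (intro eq_matI) (auto simp: right_diff_distrib)
  then have "mat_op_norm (\<beta> n t (z \<cdot>\<^sub>m x n) - z \<cdot>\<^sub>m x n) \<le> cmod z * mat_op_norm (\<beta> n t (x n) - x n)"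
    using mat_op_norm_smult_le[OF d] by simp
  also have "\<dots> \<le> (cmod z + 1) * mat_op_norm (\<beta> n t (x n) - x n) + (cmod z + 1) * mat_op_norm (\<beta> n t (x n) - x n)"
    using mat_op_norm_nonneg[OF d] mult_nonneg_nonneg[OF norm_ge_zero[of z] mat_op_norm_nonneg[OF d]]
    by (simp add: distrib_right)
  finally show "mat_op_norm (\<beta> n t (z \<cdot>\<^sub>m x n) - z \<cdot>\<^sub>m x n) \<le> (cmod z + 1) * mat_op_norm (\<beta> n t (x n) - x n) + (cmod z + 1) * mat_op_norm (\<beta> n t (x n) - x n)" .
qed (use assms in \<open>auto simp: add_nonneg_pos\<close>)

lemma equicont_star:
  assumes x: "bounded_seq x" and "equicont x"
  shows "equicont (\<lambda>n. mat_adjoint (x n))"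
proof (rule equicont_combine[of x x 1])
  fix n t
  note c = bounded_seqD[OF x, of n]
  note d = minus_carrier_mat[OF c, of "\<beta> n t (x n)"]
  have "\<beta> n t (mat_adjoint (x n)) - mat_adjoint (x n) = mat_adjoint (\<beta> n t (x n) - x n)"
    unfolding beta_adjoint[OF c] using c beta_C[OF c, of t] by (intro eq_matI) auto
  then show "mat_op_norm (\<beta> n t (mat_adjoint (x n)) - mat_adjoint (x n)) \<le> 1 * mat_op_norm (\<beta> n t (x n) - x n) + 1 * mat_op_norm (\<beta> n t (x n) - x n)"
    using mat_op_norm_adjoint[OF d] mat_op_norm_nonneg[OF d] by simp
qed (use assms in auto)

lemma equicont_fixed:
  assumes "\<And>n t. \<beta> n t (x n) = x n" "\<And>n. x n \<in> C n"
  shows "equicont x"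
proof (rule equicontI)
  fix e :: real assume "e > 0"
  then have "mat_op_norm (\<beta> n t (x n) - x n) \<le> e" for n t
    unfolding assms(1) minus_r_inv_mat[OF assms(2)] by (simp add: mat_op_norm_zero)
  then show "\<exists>d>0. \<forall>t. \<bar>t\<bar> < d \<longrightarrow> (\<forall>n. mat_op_norm (\<beta> n t (x n) - x n) \<le> e)"
    by (intro exI[of _ 1]) simp
qed

lemma beta_zero: "\<beta> n t (0\<^sub>m (k n) (k n)) = 0\<^sub>m (k n) (k n)"
  using beta_diff[of "1\<^sub>m (k n)" n "1\<^sub>m (k n)" t] beta_one by (simp add: minus_r_inv_mat[of _ "k n" "k n"])

lemma Bb_closed:
  "x \<in> carrier Bb \<Longrightarrow> y \<in> carrier Bb \<Longrightarrow> (\<lambda>n. x n + y n) \<in> carrier Bb"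
  "x \<in> carrier Bb \<Longrightarrow> y \<in> carrier Bb \<Longrightarrow> (\<lambda>n. x n * y n) \<in> carrier Bb"
  "x \<in> carrier Bb \<Longrightarrow> (\<lambda>n. z \<cdot>\<^sub>m x n) \<in> carrier Bb"
  "x \<in> carrier Bb \<Longrightarrow> (\<lambda>n. mat_adjoint (x n)) \<in> carrier Bb"
  "x \<in> carrier Bb \<Longrightarrow> (\<lambda>n. - x n) \<in> carrier Bb"
  "(\<lambda>n. 1\<^sub>m (k n)) \<in> carrier Bb"
  "(\<lambda>n. 0\<^sub>m (k n) (k n)) \<in> carrier Bb"
proof -
  show "x \<in> carrier Bb \<Longrightarrow> y \<in> carrier Bb \<Longrightarrow> (\<lambda>n. x n + y n) \<in> carrier Bb"
    unfolding carrier_Bb using bounded_seq_add equicont_add by blast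
  show "x \<in> carrier Bb \<Longrightarrow> y \<in> carrier Bb \<Longrightarrow> (\<lambda>n. x n * y n) \<in> carrier Bb"
    unfolding carrier_Bb using bounded_seq_mult equicont_mult by blast
  show sm: "x \<in> carrier Bb \<Longrightarrow> (\<lambda>n. z \<cdot>\<^sub>m x n) \<in> carrier Bb" for z
    unfolding carrier_Bb using bounded_seq_smult equicont_smult by blast
  show "x \<in> carrier Bb \<Longrightarrow> (\<lambda>n. - x n) \<in> carrier Bb"
    unfolding uminus_eq_smult by (rule sm)
  show "x \<in> carrier Bb \<Longrightarrow> (\<lambda>n. mat_adjoint (x n)) \<in> carrier Bb"
    unfolding carrier_Bb using bounded_seq_star equicont_star by blast
  show "(\<lambda>n. 1\<^sub>m (k n)) \<in> carrier Bb"
    unfolding carrier_Bb using bounded_seq_one equicont_fixed[of "\<lambda>n. 1\<^sub>m (k n)"] beta_one by simp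
  show "(\<lambda>n. 0\<^sub>m (k n) (k n)) \<in> carrier Bb"
    unfolding carrier_Bb using bounded_seq_zero equicont_fixed[of "\<lambda>n. 0\<^sub>m (k n) (k n)"] beta_zero by simp
qed

lemma Bb_simps:
  "x \<otimes>\<^bsub>Bb\<^esub> y = (\<lambda>n. x n * y n)" "x \<oplus>\<^bsub>Bb\<^esub> y = (\<lambda>n. x n + y n)"
  "\<one>\<^bsub>Bb\<^esub> = (\<lambda>n. 1\<^sub>m (k n))" "\<zero>\<^bsub>Bb\<^esub> = (\<lambda>n. 0\<^sub>m (k n) (k n))"
  "z \<odot>\<^bsub>Bb\<^esub> x = (\<lambda>n. z \<cdot>\<^sub>m x n)" "star Bb x = (\<lambda>n. mat_adjoint (x n))"
  "nrm Bb x = nrm B x"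
  unfolding continuous_part_def using B_simps by simp_all

lemma Bb_sub: "x \<in> carrier Bb \<Longrightarrow> x \<in> carrier B"
  unfolding carrier_Bb carrier_B by simp

lemma ring_Bb: "ring Bb"
proof -
  interpret ring B by (rule ring_B)
  have "subring (carrier Bb) B"
  proof (rule subringI)
    show "\<ominus>\<^bsub>B\<^esub> x \<in> carrier Bb" if "x \<in> carrier Bb" for x
      using B_uminus[OF Bb_sub[OF that]] Bb_closed(5)[OF that] by simp
  qed (use Bb_sub Bb_closed in \<open>auto simp: B_simps\<close>)
  then have "ring (B\<lparr>carrier := carrier Bb\<rparr>)" by (rule subring_is_ring)
  moreover have "B\<lparr>carrier := carrier Bb\<rparr> = Bb" unfolding continuous_part_def by simp
  ultimately show ?thesis by simp
qed

lemma Bb_uminus: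
  assumes x: "x \<in> carrier Bb"
  shows "\<ominus>\<^bsub>Bb\<^esub> x = (\<lambda>n. - x n)"
proof -
  interpret ring Bb by (rule ring_Bb)
  have c: "x n \<in> C n" for n using x by (auto simp: carrier_Bb dest: bounded_seqD)
  show ?thesis
  proof (rule minus_equality)
    show "(\<lambda>n. - x n) \<oplus>\<^bsub>Bb\<^esub> x = \<zero>\<^bsub>Bb\<^esub>" unfolding Bb_simps using uminus_l_inv_mat[OF c] by simp
  qed (use x Bb_closed in auto)
qed

lemma Bb_minus:
  assumes "x \<in> carrier Bb" "y \<in> carrier Bb"
  shows "x \<ominus>\<^bsub>Bb\<^esub> y = (\<lambda>n. x n - y n)"
proof -
  have c: "x n \<in> C n" "y n \<in> C n" for n using assms by (auto simp: carrier_Bb dest: bounded_seqD)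
  show ?thesis unfolding a_minus_def Bb_uminus[OF assms(2)] Bb_simps using add_uminus_minus_mat[OF c] by simp
qed

lemma mem_I: "x \<in> I \<longleftrightarrow> (\<forall>n. x n \<in> C n) \<and> (\<lambda>n. mat_op_norm (x n)) \<longlonglongrightarrow> 0"
  unfolding c0_direct_sum_def by simp

text \<open>An orbit in a single block is Lipschitz, but the constant involves the eigenvalues of
  that block; uniformity is available for finitely many blocks only.\<close>

lemma single_block_continuous:
  assumes X: "X \<in> C n" and e: "e > 0"
  shows "\<exists>d>0. \<forall>t. \<bar>t\<bar> < d \<longrightarrow> mat_op_norm (\<beta> n t X - X) \<le> e"
proof -
  define M where "M = (\<Sum>i<k n. \<bar>l n i\<bar>)"
  have M: "\<bar>l n i\<bar> \<le> M" if "i < k n" for i unfolding M_def using that by (intro member_le_sum) auto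
  have M0: "M \<ge> 0" unfolding M_def by (intro sum_nonneg) auto
  define N where "N = mat_op_norm X"
  have N: "N \<ge> 0" unfolding N_def by (rule mat_op_norm_nonneg[OF X])
  have le: "mat_op_norm (\<beta> n t X - X) \<le> \<bar>t\<bar> * (2 * M * N)" for t
  proof -
    have "mat_op_norm (\<beta> n t X - \<beta> n 0 X) \<le> 2 * mat_op_norm (uexp (k n) (U n) (l n) t - uexp (k n) (U n) (l n) 0) * N"
      unfolding beta[OF X] N_def by (rule conj_by_diff_norm[OF Ebeta Ebeta X])
    also have "\<dots> \<le> 2 * (\<bar>t - 0\<bar> * M) * N"
      using uexp_diff_norm[OF U M M0, where t = t and s = 0] N by (intro mult_right_mono mult_left_mono) auto
    finally show ?thesis using beta_0[OF X] by (simp add: mult_ac)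
  qed
  define d where "d = e / (2 * M * N + 1)"
  have p: "2 * M * N + 1 > 0" using M0 N by (simp add: add_nonneg_pos)
  have "mat_op_norm (\<beta> n t X - X) \<le> e" if "\<bar>t\<bar> < d" for t
  proof -
    have "\<bar>t\<bar> * (2 * M * N) \<le> d * (2 * M * N + 1)" using that M0 N by (intro mult_mono) auto
    also have "\<dots> = e" unfolding d_def using p by simp
    finally show ?thesis using le[of t] by linarith
  qed
  moreover have "d > 0" unfolding d_def using e p by simp
  ultimately show ?thesis by blast
qed

text \<open>From some block on the entries have norm below \<open>e / 2\<close>, and an isometry
  moves them by at most \<open>e\<close>. The finitely many remaining blocks are continuous one by
  one.\<close>

lemma I_sub: "x \<in> I \<Longrightarrow> x \<in> carrier Bb"
proof -
  assume x: "x \<in> I"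
  then have c: "\<And>n. x n \<in> C n" and lim: "(\<lambda>n. mat_op_norm (x n)) \<longlonglongrightarrow> 0" unfolding mem_I by auto
  have "Bseq (\<lambda>n. mat_op_norm (x n))" using lim convergentI convergent_imp_Bseq by blast
  then obtain K where K: "\<And>n. \<bar>mat_op_norm (x n)\<bar> \<le> K" unfolding Bseq_def by auto
  have "bounded_seq x" by (rule bounded_seqI[OF c abs_le_D1[OF K]])
  moreover have "equicont x"
  proof (rule equicontI)
    fix e :: real assume e: "e > 0"
    then have "\<forall>\<^sub>F n in sequentially. mat_op_norm (x n) < e / 2" using order_tendstoD(2)[OF lim, of "e / 2"] by simp
    then obtain N where N: "\<And>n. n \<ge> N \<Longrightarrow> mat_op_norm (x n) < e / 2" unfolding eventually_sequentially by blast
    have "\<forall>n. \<exists>d>0. \<forall>t. \<bar>t\<bar> < d \<longrightarrow> mat_op_norm (\<beta> n t (x n) - x n) \<le> e"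
      using single_block_continuous[OF c e] by blast
    then obtain d where d: "\<And>n. d n > 0" "\<And>n t. \<bar>t\<bar> < d n \<Longrightarrow> mat_op_norm (\<beta> n t (x n) - x n) \<le> e" by metis
    \<comment> \<open>The element 1 keeps the set non-empty when \<open>N = 0\<close>.\<close>
    define D where "D = Min (insert 1 (d ` {..<N}))"
    have D: "D > 0" unfolding D_def using d(1) by (subst Min_gr_iff) auto
    have "mat_op_norm (\<beta> n t (x n) - x n) \<le> e" if t: "\<bar>t\<bar> < D" for t n
    proof (cases "n < N")
      case True
      then have "D \<le> d n" unfolding D_def by (intro Min_le) auto
      then show ?thesis using d(2) t by simp
    next
      case False
      have "\<beta> n t (x n) - x n = \<beta> n t (x n) + - x n" using add_uminus_minus_mat[OF beta_C[OF c] c] by simp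
      then have "mat_op_norm (\<beta> n t (x n) - x n) \<le> mat_op_norm (\<beta> n t (x n)) + mat_op_norm (- x n)"
        by (simp only:, intro mat_op_norm_add[OF beta_C[OF c] uminus_carrier_mat[OF c]])
      also have "\<dots> = mat_op_norm (x n) + mat_op_norm (x n)" using beta_norm[OF c] mat_op_norm_uminus[OF c] by simp
      also have "\<dots> \<le> e" using N[of n] False by simp
      finally show ?thesis .
    qed
    then show "\<exists>d>0. \<forall>t. \<bar>t\<bar> < d \<longrightarrow> (\<forall>n. mat_op_norm (\<beta> n t (x n) - x n) \<le> e)" using D by blast
  qed
  ultimately show ?thesis unfolding carrier_Bb by blast
qed

lemma norm_tendsto_0_if_le:
  assumes "\<And>n. y n \<in> C n" "\<And>n. mat_op_norm (y n) \<le> f n" "f \<longlonglongrightarrow> 0"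
  shows "(\<lambda>n. mat_op_norm (y n)) \<longlonglongrightarrow> 0"
  by (rule tendsto_sandwich[OF always_eventually always_eventually tendsto_const assms(3)])
     (use assms(2) mat_op_norm_nonneg[OF assms(1)] in blast)+

lemma I_absorb:
  assumes a: "a \<in> I" and x: "x \<in> carrier Bb"
  shows "(\<lambda>n. x n * a n) \<in> I" "(\<lambda>n. a n * x n) \<in> I"
proof -
  have ac: "\<And>n. a n \<in> C n" and lim: "(\<lambda>n. mat_op_norm (a n)) \<longlonglongrightarrow> 0" using a unfolding mem_I by auto
  have xb: "bounded_seq x" using x unfolding carrier_Bb by blast
  note xc = bounded_seqD[OF xb]
  obtain K where K: "K > 0" "\<And>n. mat_op_norm (x n) \<le> K" using bounded_seqE[OF xb] by blast
  have K0: "(\<lambda>n. K * mat_op_norm (a n)) \<longlonglongrightarrow> 0" using tendsto_mult_left[OF lim, of K] by simp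
  have le: "mat_op_norm (x n * a n) \<le> K * mat_op_norm (a n)" "mat_op_norm (a n * x n) \<le> K * mat_op_norm (a n)" for n
    using mat_op_norm_mult[OF xc ac, of n] mat_op_norm_mult[OF ac xc, of n]
      mult_right_mono[OF K(2)[of n] mat_op_norm_nonneg[OF ac[of n]]] by (auto simp: mult.commute)
  have "(\<lambda>n. mat_op_norm (x n * a n)) \<longlonglongrightarrow> 0" "(\<lambda>n. mat_op_norm (a n * x n)) \<longlonglongrightarrow> 0"
    by (rule norm_tendsto_0_if_le[OF mult_carrier_mat[OF xc ac] le(1) K0]
        norm_tendsto_0_if_le[OF mult_carrier_mat[OF ac xc] le(2) K0])+
  then show "(\<lambda>n. x n * a n) \<in> I" "(\<lambda>n. a n * x n) \<in> I" unfolding mem_I using xc ac by auto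
qed

lemma I_add:
  assumes "a \<in> I" "b \<in> I"
  shows "(\<lambda>n. a n + b n) \<in> I"
proof -
  have c: "a n \<in> C n" "b n \<in> C n" for n using assms unfolding mem_I by auto
  have "(\<lambda>n. mat_op_norm (a n) + mat_op_norm (b n)) \<longlonglongrightarrow> 0 + 0"
    using assms unfolding mem_I by (intro tendsto_add) auto
  then have "(\<lambda>n. mat_op_norm (a n + b n)) \<longlonglongrightarrow> 0"
    using norm_tendsto_0_if_le[OF add_carrier_mat[OF c(2)] mat_op_norm_add[OF c]] by simp
  then show ?thesis unfolding mem_I using c by auto
qed

lemma ideal_I: "ideal I Bb"
proof (rule idealI[OF ring_Bb])
  interpret ring Bb by (rule ring_Bb)
  show "subgroup I (add_monoid Bb)"
  proof (rule add.subgroupI)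
    show "I \<subseteq> carrier Bb" using I_sub by blast
    have "(\<lambda>n. 0\<^sub>m (k n) (k n)) \<in> I" unfolding mem_I by (simp add: mat_op_norm_zero)
    then show "I \<noteq> {}" by blast
    show "\<ominus>\<^bsub>Bb\<^esub> a \<in> I" if "a \<in> I" for a
      unfolding Bb_uminus[OF I_sub[OF that]] using that mat_op_norm_uminus[of "a n" "k n" for n] unfolding mem_I by simp
    show "a \<oplus>\<^bsub>Bb\<^esub> b \<in> I" if "a \<in> I" "b \<in> I" for a b
      unfolding Bb_simps by (rule I_add[OF that])
  qed
qed (auto simp: Bb_simps I_absorb)

end

text \<open>Being a ring depends on five fields only. This transfers the property from the factor
  ring to the record that also carries scalars, star and norm.\<close>

lemma ring_of_fields:
  fixes E :: "('a, 'm) ring_scheme" and R :: "('a, 'p) ring_scheme"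
  assumes R: "ring R"
    and e: "carrier E = carrier R" "monoid.mult E = monoid.mult R" "one E = one R" "zero E = zero R" "add E = add R"
  shows "ring E"
proof -
  interpret R: ring R by (rule R)
  show ?thesis
  proof (rule ringI)
    show "abelian_group E"
    proof (rule abelian_groupI)
      show "\<exists>y\<in>carrier E. y \<oplus>\<^bsub>E\<^esub> x = \<zero>\<^bsub>E\<^esub>" if "x \<in> carrier E" for x
        using that unfolding e by (intro bexI[of _ "\<ominus>\<^bsub>R\<^esub> x"]) (auto simp: R.l_neg)
    qed (auto simp: e R.a_ac)
    show "monoid E" by (rule monoidI) (auto simp: e R.m_assoc)
  qed (auto simp: e R.l_distr R.r_distr)
qed

section \<open>The quotient by the null sequences and its norm\<close>

context block_flow
begin

abbreviation quot :: "(nat \<Rightarrow> complex mat) \<Rightarrow> (nat \<Rightarrow> complex mat) set" ("\<pi>") where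
  "\<pi> x \<equiv> I +>\<^bsub>Bb\<^esub> x"

lemma Q_fields:
  "carrier Q = carrier (Bb Quot I)" "monoid.mult Q = monoid.mult (Bb Quot I)" "one Q = one (Bb Quot I)"
  "zero Q = zero (Bb Quot I)" "add Q = add (Bb Quot I)"
  "smult Q = (\<lambda>z. coset_map Bb I (\<lambda>x. z \<odot>\<^bsub>Bb\<^esub> x))" "star Q = coset_map Bb I (star Bb)"
  "nrm Q X = (INF x\<in>X. nrm B x)"
  unfolding quotient_alg_def ring.extend_def by (simp_all add: Bb_simps(7))

lemma ring_Q: "ring Q"
  by (rule ring_of_fields[OF ideal.quotient_is_ring[OF ideal_I]]) (simp_all add: Q_fields)

lemma carrier_Q: "X \<in> carrier Q \<longleftrightarrow> (\<exists>x\<in>carrier Bb. X = \<pi> x)"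
  unfolding Q_fields FactRing_def A_RCOSETS_defs a_r_coset_def by auto

lemma pi_carrier [simp]: "x \<in> carrier Bb \<Longrightarrow> \<pi> x \<in> carrier Q"
  unfolding carrier_Q by blast

lemma pi_mult: "x \<in> carrier Bb \<Longrightarrow> y \<in> carrier Bb \<Longrightarrow> \<pi> x \<otimes>\<^bsub>Q\<^esub> \<pi> y = \<pi> (\<lambda>n. x n * y n)"
  unfolding Q_fields using ring_hom_mult[OF ideal.rcos_ring_hom[OF ideal_I]] by (simp add: Bb_simps)

lemma pi_add: "x \<in> carrier Bb \<Longrightarrow> y \<in> carrier Bb \<Longrightarrow> \<pi> x \<oplus>\<^bsub>Q\<^esub> \<pi> y = \<pi> (\<lambda>n. x n + y n)"
  unfolding Q_fields using ring_hom_add[OF ideal.rcos_ring_hom[OF ideal_I]] by (simp add: Bb_simps)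

lemma pi_one: "\<one>\<^bsub>Q\<^esub> = \<pi> (\<lambda>n. 1\<^sub>m (k n))"
  unfolding Q_fields using ring_hom_one[OF ideal.rcos_ring_hom[OF ideal_I]] by (simp add: Bb_simps)

lemma pi_eq_iff:
  assumes "x \<in> carrier Bb" "y \<in> carrier Bb"
  shows "\<pi> x = \<pi> y \<longleftrightarrow> (\<lambda>n. x n - y n) \<in> I"
  using ring.quotient_eq_iff_same_a_r_cos[OF ring_Bb ideal_I assms] unfolding Bb_minus[OF assms] by simp

lemma mem_pi:
  assumes x: "x \<in> carrier Bb"
  shows "y \<in> \<pi> x \<longleftrightarrow> y \<in> carrier Bb \<and> (\<lambda>n. y n - x n) \<in> I"
proof
  have xc: "x n \<in> C n" for n using x by (auto simp: carrier_Bb dest: bounded_seqD)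
  show "y \<in> carrier Bb \<and> (\<lambda>n. y n - x n) \<in> I" if "y \<in> \<pi> x"
  proof -
    obtain a where a: "a \<in> I" "y = (\<lambda>n. a n + x n)"
      using \<open>y \<in> \<pi> x\<close> unfolding a_r_coset_def' Bb_simps by blast
    have ac: "a n \<in> C n" for n using a unfolding mem_I by simp
    have "a n + x n - x n = a n" for n using ac[of n] xc[of n] by (intro eq_matI) auto
    then show ?thesis using a Bb_closed(1)[OF I_sub[OF a(1)] x] by simp
  qed
  show "y \<in> \<pi> x" if "y \<in> carrier Bb \<and> (\<lambda>n. y n - x n) \<in> I"
  proof -
    have yc: "y n \<in> C n" for n using that by (auto simp: carrier_Bb dest: bounded_seqD)
    have "(y n - x n) + x n = y n" for n using yc[of n] xc[of n] by (intro eq_matI) auto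
    then have "y = (\<lambda>n. (y n - x n) + x n)" by simp
    then show ?thesis unfolding a_r_coset_def' Bb_simps using that by blast
  qed
qed

lemma Bb_diff: "x \<in> carrier Bb \<Longrightarrow> y \<in> carrier Bb \<Longrightarrow> (\<lambda>n. x n - y n) \<in> carrier Bb"
  using ring.ring_simprules(4)[OF ring_Bb, of x y] Bb_minus[of x y] by simp

lemma diff_zero_I:
  assumes "x \<in> carrier Bb"
  shows "(\<lambda>n. x n - x n) \<in> I"
  using pi_eq_iff[OF assms assms] by simp

text \<open>\<open>coset_map\<close> is a union over all representatives; if \<open>f\<close>
  respects \<open>I\<close>, every member of the union is the same coset.\<close>

lemma coset_map_pi:
  assumes f: "\<And>y. y \<in> carrier Bb \<Longrightarrow> f y \<in> carrier Bb"
    and resp: "\<And>y z. y \<in> carrier Bb \<Longrightarrow> z \<in> carrier Bb \<Longrightarrow> (\<lambda>n. y n - z n) \<in> I \<Longrightarrow> (\<lambda>n. f y n - f z n) \<in> I"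
    and x: "x \<in> carrier Bb"
  shows "coset_map Bb I f (\<pi> x) = \<pi> (f x)"
proof -
  have "\<pi> (f y) = \<pi> (f x)" if "y \<in> \<pi> x" for y
    using that x unfolding mem_pi[OF x] by (subst pi_eq_iff) (auto intro: f resp)
  moreover have "x \<in> \<pi> x" unfolding mem_pi[OF x] using x diff_zero_I by blast
  ultimately show ?thesis unfolding coset_map_def by blast
qed

lemma pi_smult:
  assumes x: "x \<in> carrier Bb"
  shows "z \<odot>\<^bsub>Q\<^esub> \<pi> x = \<pi> (\<lambda>n. z \<cdot>\<^sub>m x n)"
proof -
  have "coset_map Bb I (\<lambda>x. z \<odot>\<^bsub>Bb\<^esub> x) (\<pi> x) = \<pi> (z \<odot>\<^bsub>Bb\<^esub> x)"
  proof (rule coset_map_pi[OF _ _ x])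
    fix y w assume y: "y \<in> carrier Bb" and w: "w \<in> carrier Bb" and i: "(\<lambda>n. y n - w n) \<in> I"
    have c: "y n \<in> C n" "w n \<in> C n" for n using y w by (auto simp: carrier_Bb dest: bounded_seqD)
    \<comment> \<open>The scalar is written as a scalar matrix, so that the absorption property of
      the ideal applies.\<close>
    have "z \<cdot>\<^sub>m y n - z \<cdot>\<^sub>m w n = (z \<cdot>\<^sub>m 1\<^sub>m (k n)) * (y n - w n)" for n
    proof -
      have "(z \<cdot>\<^sub>m 1\<^sub>m (k n)) * (y n - w n) = z \<cdot>\<^sub>m (y n - w n)"
        using c[of n] by (simp add: mult_smult_assoc_mat[of _ "k n" "k n" _ "k n"] left_mult_one_mat[of _ "k n" "k n"] minus_carrier_mat)
      also have "\<dots> = z \<cdot>\<^sub>m y n - z \<cdot>\<^sub>m w n"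
        using c[of n] by (intro eq_matI) (auto simp: right_diff_distrib)
      finally show ?thesis by simp
    qed
    then show "(\<lambda>n. (z \<odot>\<^bsub>Bb\<^esub> y) n - (z \<odot>\<^bsub>Bb\<^esub> w) n) \<in> I"
      unfolding Bb_simps using I_absorb(1)[OF i Bb_closed(3)[OF Bb_closed(6)], of z] by simp
  qed (simp add: Bb_simps Bb_closed)
  then show ?thesis unfolding Q_fields Bb_simps .
qed

lemma pi_star:
  assumes x: "x \<in> carrier Bb"
  shows "star Q (\<pi> x) = \<pi> (\<lambda>n. mat_adjoint (x n))"
proof -
  have "coset_map Bb I (star Bb) (\<pi> x) = \<pi> (star Bb x)"
  proof (rule coset_map_pi[OF _ _ x])
    fix y w assume y: "y \<in> carrier Bb" and w: "w \<in> carrier Bb" and i: "(\<lambda>n. y n - w n) \<in> I"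
    have c: "y n \<in> C n" "w n \<in> C n" for n using y w by (auto simp: carrier_Bb dest: bounded_seqD)
    have "mat_adjoint (y n) - mat_adjoint (w n) = mat_adjoint (y n - w n)" for n
      using c[of n] by (intro eq_matI) auto
    then show "(\<lambda>n. star Bb y n - star Bb w n) \<in> I"
      unfolding Bb_simps using i mat_op_norm_adjoint[of "y n - w n" "k n" for n] unfolding mem_I by simp
  qed (simp add: Bb_simps Bb_closed)
  then show ?thesis unfolding Q_fields Bb_simps .
qed

lemma Bb_beta:
  assumes x: "x \<in> carrier Bb"
  shows "product_flow \<beta> t x \<in> carrier Bb"
proof -
  have b: "bounded_seq x" and e: "equicont x" using x unfolding carrier_Bb by auto
  note c = bounded_seqD[OF b]
  have "mat_op_norm (\<beta> n s (\<beta> n t (x n)) - \<beta> n t (x n)) = mat_op_norm (\<beta> n s (x n) - x n)" for n s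
    using beta_diff_norm[OF c, of n "s + t" t] beta_beta[OF c, of n s t] by simp
  then have "equicont (\<lambda>n. \<beta> n t (x n))" using e unfolding equicont_def by simp
  then show ?thesis unfolding product_flow_def carrier_Bb using bounded_seq_beta[OF b] by blast
qed

lemma pi_flow:
  assumes x: "x \<in> carrier Bb"
  shows "coset_map Bb I (product_flow \<beta> t) (\<pi> x) = \<pi> (\<lambda>n. \<beta> n t (x n))"
proof -
  have "coset_map Bb I (product_flow \<beta> t) (\<pi> x) = \<pi> (product_flow \<beta> t x)"
  proof (rule coset_map_pi[OF Bb_beta _ x])
    fix y w assume y: "y \<in> carrier Bb" and w: "w \<in> carrier Bb" and i: "(\<lambda>n. y n - w n) \<in> I"
    have c: "y n \<in> C n" "w n \<in> C n" for n using y w by (auto simp: carrier_Bb dest: bounded_seqD)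
    have "mat_op_norm (\<beta> n t (y n) - \<beta> n t (w n)) = mat_op_norm (y n - w n)" for n
      using beta_diff[OF c] beta_norm[OF minus_carrier_mat[OF c(2)]] by metis
    then show "(\<lambda>n. product_flow \<beta> t y n - product_flow \<beta> t w n) \<in> I"
      unfolding product_flow_def using i beta_C[OF c(2)] unfolding mem_I by (simp add: minus_carrier_mat)
  qed
  then show ?thesis unfolding product_flow_def .
qed

lemma pi_minus:
  assumes "x \<in> carrier Bb" "y \<in> carrier Bb"
  shows "\<pi> x \<ominus>\<^bsub>Q\<^esub> \<pi> y = \<pi> (\<lambda>n. x n - y n)"
proof -
  interpret Q: ring Q by (rule ring_Q)
  have c: "x n \<in> C n" "y n \<in> C n" for n using assms by (auto simp: carrier_Bb dest: bounded_seqD)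
  have "\<pi> (\<lambda>n. - y n) \<oplus>\<^bsub>Q\<^esub> \<pi> y = \<zero>\<^bsub>Q\<^esub>"
  proof -
    have "\<pi> (\<lambda>n. - y n) \<oplus>\<^bsub>Q\<^esub> \<pi> y = \<pi> (\<lambda>n. 0\<^sub>m (k n) (k n))"
      unfolding pi_add[OF Bb_closed(5)[OF assms(2)] assms(2)] using uminus_l_inv_mat[OF c(2)] by simp
    moreover have "\<pi> (\<lambda>n. 0\<^sub>m (k n) (k n)) \<oplus>\<^bsub>Q\<^esub> \<pi> (\<lambda>n. 0\<^sub>m (k n) (k n)) = \<pi> (\<lambda>n. 0\<^sub>m (k n) (k n))"
      unfolding pi_add[OF Bb_closed(7) Bb_closed(7)] by simp
    then have "\<pi> (\<lambda>n. 0\<^sub>m (k n) (k n)) = \<zero>\<^bsub>Q\<^esub>"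
      using Q.add.r_cancel_one'[of "\<pi> (\<lambda>n. 0\<^sub>m (k n) (k n))" "\<pi> (\<lambda>n. 0\<^sub>m (k n) (k n))"] Bb_closed(7) by simp
    ultimately show ?thesis by simp
  qed
  then have "\<ominus>\<^bsub>Q\<^esub> \<pi> y = \<pi> (\<lambda>n. - y n)"
    by (rule Q.minus_equality) (use assms Bb_closed in auto)
  then show ?thesis
    unfolding a_minus_def using pi_add[OF assms(1) Bb_closed(5)[OF assms(2)]] add_uminus_minus_mat[OF c] by simp
qed

lemma nrm_Q_bdd: "x \<in> carrier Bb \<Longrightarrow> bdd_below (nrm B ` \<pi> x)"
  by (rule bdd_belowI2[of _ 0]) (auto simp: mem_pi carrier_Bb intro: nrm_B_nonneg)

text \<open>Replacing finitely many blocks of \<open>x\<close> by zero changes it by an element of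
  \<open>I\<close>. With \<open>nrm_Q_lessD\<close> this says that the quotient norm is the limit
  superior of the block norms.\<close>

lemma nrm_Q_le:
  assumes x: "x \<in> carrier Bb" and le: "\<forall>\<^sub>F n in sequentially. mat_op_norm (x n) \<le> e" and e: "e \<ge> 0"
  shows "nrm Q (\<pi> x) \<le> e"
proof -
  have c: "x n \<in> C n" for n using x by (auto simp: carrier_Bb dest: bounded_seqD)
  obtain N where N: "\<And>n. n \<ge> N \<Longrightarrow> mat_op_norm (x n) \<le> e" using le unfolding eventually_sequentially by blast
  define a where "a n = (if n < N then - x n else 0\<^sub>m (k n) (k n))" for n
  have aI: "a \<in> I"
    unfolding mem_I
  proof
    show "\<forall>n. a n \<in> C n" unfolding a_def using c by simp
    have "\<forall>\<^sub>F n in sequentially. mat_op_norm (a n) = 0"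
      unfolding eventually_sequentially a_def by (intro exI[of _ N]) (simp add: mat_op_norm_zero)
    then show "(\<lambda>n. mat_op_norm (a n)) \<longlonglongrightarrow> 0" by (rule tendsto_eventually)
  qed
  define y where "y n = a n + x n" for n
  have y: "y n = (if n < N then 0\<^sub>m (k n) (k n) else x n)" for n
    unfolding y_def a_def using c[of n] by (simp add: uminus_l_inv_mat)
  have "y \<in> \<pi> x" unfolding a_r_coset_def' Bb_simps y_def using aI by blast
  then have "nrm Q (\<pi> x) \<le> nrm B y" unfolding Q_fields by (intro cINF_lower nrm_Q_bdd x)
  also have "\<dots> \<le> e"
  proof (subst nrm_B_le_iff)
    show "bounded_seq y" using \<open>y \<in> \<pi> x\<close> mem_pi[OF x] carrier_Bb by blast
    show "\<forall>n. mat_op_norm (y n) \<le> e" using N e by (auto simp: y mat_op_norm_zero)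
  qed
  finally show ?thesis .
qed

text \<open>Some representative \<open>y\<close> has supremum norm below \<open>e\<close>, and
  \<open>x\<close> differs from it by a null sequence, which eventually fits into the remaining
  margin.\<close>

lemma nrm_Q_lessD:
  assumes x: "x \<in> carrier Bb" and less: "nrm Q (\<pi> x) < e"
  shows "\<forall>\<^sub>F n in sequentially. mat_op_norm (x n) < e"
proof -
  have "\<pi> x \<noteq> {}" using diff_zero_I[OF x] x mem_pi[OF x] by blast
  then obtain y where y: "y \<in> \<pi> x" "nrm B y < e"
    using less unfolding Q_fields cINF_less_iff[OF \<open>\<pi> x \<noteq> {}\<close> nrm_Q_bdd[OF x]] by blast
  have yb: "y \<in> carrier Bb" and d: "(\<lambda>n. y n - x n) \<in> I" using y(1) unfolding mem_pi[OF x] by auto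
  have c: "x n \<in> C n" "y n \<in> C n" for n using x yb by (auto simp: carrier_Bb dest: bounded_seqD)
  have yle: "mat_op_norm (y n) \<le> nrm B y" for n
    using nrm_B_le_iff[of y "nrm B y"] yb unfolding carrier_Bb by simp
  have "(\<lambda>n. mat_op_norm (y n - x n)) \<longlonglongrightarrow> 0" using d unfolding mem_I by blast
  then have "\<forall>\<^sub>F n in sequentially. mat_op_norm (y n - x n) < e - nrm B y"
    by (rule order_tendstoD(2)) (use y(2) in simp)
  then show ?thesis
  proof (rule eventually_mono)
    fix n assume less: "mat_op_norm (y n - x n) < e - nrm B y"
    have "x n = (x n - y n) + y n" using c[of n] by (intro eq_matI) auto
    moreover have "mat_op_norm ((x n - y n) + y n) \<le> mat_op_norm (x n - y n) + mat_op_norm (y n)"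
      by (rule mat_op_norm_add[OF minus_carrier_mat[OF c(2)] c(2)])
    ultimately have "mat_op_norm (x n) \<le> mat_op_norm (x n - y n) + mat_op_norm (y n)" by simp
    then show "mat_op_norm (x n) < e"
      using less yle[of n] mat_op_norm_diff_commute[OF c] by simp
  qed
qed

lemma nrm_Q_nonneg: "x \<in> carrier Bb \<Longrightarrow> nrm Q (\<pi> x) \<ge> 0"
  unfolding Q_fields using diff_zero_I[of x] mem_pi[of x x]
  by (intro cINF_greatest) (auto simp: mem_pi carrier_Bb intro: nrm_B_nonneg)

lemma nrm_Q_triangle:
  assumes "X \<in> carrier Q" "Y \<in> carrier Q" "Z \<in> carrier Q"
  shows "nrm Q (Y \<ominus>\<^bsub>Q\<^esub> Z) \<le> nrm Q (X \<ominus>\<^bsub>Q\<^esub> Y) + nrm Q (X \<ominus>\<^bsub>Q\<^esub> Z)"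
proof -
  obtain x y z where xyz: "x \<in> carrier Bb" "y \<in> carrier Bb" "z \<in> carrier Bb" "X = \<pi> x" "Y = \<pi> y" "Z = \<pi> z"
    using assms unfolding carrier_Q by blast
  have c: "x n \<in> C n" "y n \<in> C n" "z n \<in> C n" for n using xyz by (auto simp: carrier_Bb dest: bounded_seqD)
  let ?a = "nrm Q (\<pi> (\<lambda>n. x n - y n))" and ?b = "nrm Q (\<pi> (\<lambda>n. x n - z n))"
  have "nrm Q (\<pi> (\<lambda>n. y n - z n)) \<le> ?a + ?b"
  proof (rule field_le_epsilon)
    fix e :: real assume e: "e > 0"
    have "\<forall>\<^sub>F n in sequentially. mat_op_norm (x n - y n) < ?a + e / 2"
      by (rule nrm_Q_lessD[OF Bb_diff[OF xyz(1,2)]]) (use e in simp)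
    moreover have "\<forall>\<^sub>F n in sequentially. mat_op_norm (x n - z n) < ?b + e / 2"
      by (rule nrm_Q_lessD[OF Bb_diff[OF xyz(1,3)]]) (use e in simp)
    ultimately have "\<forall>\<^sub>F n in sequentially. mat_op_norm (y n - z n) \<le> ?a + ?b + e"
    proof eventually_elim
      case (elim n)
      then show ?case
        using mat_op_norm_diff_triangle[OF c(2) c(1) c(3), of n] mat_op_norm_diff_commute[OF c(1) c(2), of n] by simp
    qed
    then show "nrm Q (\<pi> (\<lambda>n. y n - z n)) \<le> ?a + ?b + e"
      using e nrm_Q_nonneg[OF Bb_diff[OF xyz(1,2)]] nrm_Q_nonneg[OF Bb_diff[OF xyz(1,3)]]
      by (intro nrm_Q_le Bb_diff xyz) auto
  qed
  then show ?thesis using xyz by (simp add: pi_minus)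
qed

lemma nrm_Q_eq_0:
  assumes "Y \<in> carrier Q" "Z \<in> carrier Q" "nrm Q (Y \<ominus>\<^bsub>Q\<^esub> Z) \<le> 0"
  shows "Y = Z"
proof -
  obtain y z where yz: "y \<in> carrier Bb" "z \<in> carrier Bb" "Y = \<pi> y" "Z = \<pi> z"
    using assms unfolding carrier_Q by blast
  have c: "y n \<in> C n" "z n \<in> C n" for n using yz by (auto simp: carrier_Bb dest: bounded_seqD)
  have le: "nrm Q (\<pi> (\<lambda>n. y n - z n)) \<le> 0" using assms(3) yz by (simp add: pi_minus)
  have "(\<lambda>n. y n - z n) \<in> I"
    unfolding mem_I
  proof
    show "\<forall>n. y n - z n \<in> C n" using minus_carrier_mat[OF c(2)] by blast
    show "(\<lambda>n. mat_op_norm (y n - z n)) \<longlonglongrightarrow> 0"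
    proof (rule tendstoI)
      fix e :: real assume "e > 0"
      then have "\<forall>\<^sub>F n in sequentially. mat_op_norm (y n - z n) < e"
        using le by (intro nrm_Q_lessD Bb_diff yz) simp
      then show "\<forall>\<^sub>F n in sequentially. dist (mat_op_norm (y n - z n)) 0 < e"
        using mat_op_norm_nonneg[OF minus_carrier_mat[OF c(2)]] by (simp add: dist_real_def)
    qed
  qed
  then show ?thesis using pi_eq_iff[OF yz(1,2)] yz by simp
qed

lemma Q_smult_closed: "X \<in> carrier Q \<Longrightarrow> z \<odot>\<^bsub>Q\<^esub> X \<in> carrier Q"
  unfolding carrier_Q using pi_smult Bb_closed(3) by blast

text \<open>The usual argument with three thirds of \<open>e\<close>. This closedness is what places
  the exponentials in the continuous part.\<close>

lemma equicont_uniform_limit: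
  fixes p :: "nat \<Rightarrow> nat \<Rightarrow> complex mat"
  assumes x: "\<And>n. x n \<in> C n" and p: "\<And>N n. p N n \<in> C n" and eq: "\<And>N. equicont (p N)"
    and lim: "\<And>e. e > 0 \<Longrightarrow> \<exists>N. \<forall>n. mat_op_norm (p N n - x n) \<le> e"
  shows "equicont x"
proof (rule equicontI)
  fix e :: real assume e: "e > 0"
  then obtain N where N: "\<And>n. mat_op_norm (p N n - x n) \<le> e / 3" using lim[of "e / 3"] by auto
  obtain d where d: "d > 0" "\<And>t n. \<bar>t\<bar> < d \<Longrightarrow> mat_op_norm (\<beta> n t (p N n) - p N n) \<le> e / 3"
    using equicontE[OF eq, of "e / 3" N] e by auto
  have "mat_op_norm (\<beta> n t (x n) - x n) \<le> e" if t: "\<bar>t\<bar> < d" for t n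
  proof -
    have bx: "\<beta> n t (x n) \<in> C n" and bp: "\<beta> n t (p N n) \<in> C n" by (rule beta_C[OF x] beta_C[OF p])+
    have "mat_op_norm (\<beta> n t (x n) - \<beta> n t (p N n)) = mat_op_norm (\<beta> n t (x n - p N n))"
      unfolding beta_diff[OF x p] ..
    also have "\<dots> = mat_op_norm (x n - p N n)" by (rule beta_norm[OF minus_carrier_mat[OF p]])
    also have "\<dots> = mat_op_norm (p N n - x n)" by (rule mat_op_norm_diff_commute[OF x p])
    finally have 1: "mat_op_norm (\<beta> n t (x n) - \<beta> n t (p N n)) \<le> e / 3"
      using N[of n] by simp
    have "mat_op_norm (\<beta> n t (x n) - x n) \<le> mat_op_norm (\<beta> n t (x n) - \<beta> n t (p N n)) + mat_op_norm (\<beta> n t (p N n) - x n)"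
      by (rule mat_op_norm_diff_triangle[OF bx bp x])
    also have "mat_op_norm (\<beta> n t (p N n) - x n) \<le> mat_op_norm (\<beta> n t (p N n) - p N n) + mat_op_norm (p N n - x n)"
      by (rule mat_op_norm_diff_triangle[OF bp p x])
    finally show ?thesis using 1 d(2)[OF t, of n] N[of n] by simp
  qed
  then show "\<exists>d>0. \<forall>t. \<bar>t\<bar> < d \<longrightarrow> (\<forall>n. mat_op_norm (\<beta> n t (x n) - x n) \<le> e)" using d(1) by blast
qed

end

section \<open>Exponentials and inner automorphisms in the quotient\<close>

context block_flow
begin

lemma Bb_C: "x \<in> carrier Bb \<Longrightarrow> x n \<in> C n"
  unfolding carrier_Bb by (blast dest: bounded_seqD)

lemma pi_pow:
  assumes y: "y \<in> carrier Bb"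
  shows "(\<lambda>n. y n ^\<^sub>m j) \<in> carrier Bb \<and> \<pi> y [^]\<^bsub>Q\<^esub> (j::nat) = \<pi> (\<lambda>n. y n ^\<^sub>m j)"
proof -
  interpret Q: ring Q by (rule ring_Q)
  have d: "dim_row (y n) = k n" for n using Bb_C[OF y, of n] by simp
  show ?thesis
  proof (induction j)
    case 0
    then show ?case by (simp add: pi_one d Bb_closed)
  next
    case (Suc j)
    then show ?case using pi_mult[of "\<lambda>n. y n ^\<^sub>m j" y] Bb_closed(2)[of "\<lambda>n. y n ^\<^sub>m j" y] y by simp
  qed
qed

lemma psum_Q:
  assumes V: "\<And>n. unitary (k n) (V n)"
    and b: "(\<lambda>n. conj_by (V n) (rdiag (k n) (\<mu> n))) \<in> carrier Bb"
  shows "(\<lambda>n. mat_psum (k n) (V n) (\<mu> n) t N) \<in> carrier Bb \<and>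
    psum Q ((\<i> * complex_of_real t) \<odot>\<^bsub>Q\<^esub> \<pi> (\<lambda>n. conj_by (V n) (rdiag (k n) (\<mu> n)))) N =
      \<pi> (\<lambda>n. mat_psum (k n) (V n) (\<mu> n) t N)"
proof -
  interpret Q: ring Q by (rule ring_Q)
  let ?b = "\<lambda>n. conj_by (V n) (rdiag (k n) (\<mu> n))"
  let ?y = "\<lambda>n. (\<i> * complex_of_real t) \<cdot>\<^sub>m ?b n"
  have y: "?y \<in> carrier Bb" by (rule Bb_closed(3)[OF b])
  have zero: "\<pi> (\<lambda>n. 0\<^sub>m (k n) (k n)) = \<zero>\<^bsub>Q\<^esub>"
  proof -
    have "\<pi> ?y \<ominus>\<^bsub>Q\<^esub> \<pi> ?y = \<pi> (\<lambda>n. 0\<^sub>m (k n) (k n))"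
      unfolding pi_minus[OF y y] minus_r_inv_mat[OF Bb_C[OF y]] ..
    then show ?thesis using Q.r_neg[OF pi_carrier[OF y]] by (simp add: a_minus_def)
  qed
  show ?thesis
    unfolding pi_smult[OF b]
  proof (induction N)
    case 0
    then show ?case using psum_rec(1)[OF ring_Q pi_carrier[OF y] Q_smult_closed] zero
      by (simp add: mat_psum_rec(1)[OF V] Bb_closed)
  next
    case (Suc N)
    let ?z = "\<lambda>n. (1 / fact N) \<cdot>\<^sub>m (?y n ^\<^sub>m N)"
    have z: "?z \<in> carrier Bb" using Bb_closed(3) pi_pow[OF y] by blast
    have "psum Q (\<pi> ?y) (Suc N) = (1 / fact N) \<odot>\<^bsub>Q\<^esub> (\<pi> ?y [^]\<^bsub>Q\<^esub> N) \<oplus>\<^bsub>Q\<^esub> psum Q (\<pi> ?y) N"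
      by (rule psum_rec(2)[OF ring_Q pi_carrier[OF y] Q_smult_closed])
    also have "(1 / fact N) \<odot>\<^bsub>Q\<^esub> (\<pi> ?y [^]\<^bsub>Q\<^esub> N) = \<pi> ?z"
      using pi_pow[OF y, of N] by (simp only: pi_smult)
    also have "\<pi> ?z \<oplus>\<^bsub>Q\<^esub> psum Q (\<pi> ?y) N = \<pi> (\<lambda>n. ?z n + mat_psum (k n) (V n) (\<mu> n) t N)"
      using Suc pi_add[OF z] by simp
    finally show ?case
      using Bb_closed(1)[OF z, of "\<lambda>n. mat_psum (k n) (V n) (\<mu> n) t N"] Suc unfolding mat_psum_rec(2)[OF V] by simp
  qed
qed

lemma exp_tail_small: "e > 0 \<Longrightarrow> \<exists>N. exp_tail R N \<le> e"
  using order_tendstoD(2)[OF exp_tail_tendsto[of R], of e] unfolding eventually_sequentially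
  by (meson less_imp_le order_refl)

text \<open>The partial sums are polynomials in an element of the continuous part, and they converge
  uniformly over the blocks because one \<open>M\<close> bounds all eigenvalues.\<close>

lemma uexp_mem_Bb:
  assumes V: "\<And>n. unitary (k n) (V n)"
    and b: "(\<lambda>n. conj_by (V n) (rdiag (k n) (\<mu> n))) \<in> carrier Bb"
    and M: "\<And>n. \<forall>i<k n. \<bar>\<mu> n i\<bar> \<le> M" "M \<ge> 0"
  shows "(\<lambda>n. uexp (k n) (V n) (\<mu> n) t) \<in> carrier Bb"
proof -
  have c: "uexp (k n) (V n) (\<mu> n) t \<in> C n" for n using unitaryD(1)[OF V] by simp
  have "bounded_seq (\<lambda>n. uexp (k n) (V n) (\<mu> n) t)"
    by (rule bounded_seqI[OF c]) (rule unitary_norm_le[OF uexp_unitary[OF V]])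
  moreover have "equicont (\<lambda>n. uexp (k n) (V n) (\<mu> n) t)"
  proof (rule equicont_uniform_limit[where p = "\<lambda>N n. mat_psum (k n) (V n) (\<mu> n) t N"])
    show "mat_psum (k n) (V n) (\<mu> n) t N \<in> C n" for N n using unitaryD(1)[OF V] by simp
    show "equicont (\<lambda>n. mat_psum (k n) (V n) (\<mu> n) t N)" for N
      using psum_Q[OF V b, of t N] unfolding carrier_Bb by blast
    fix e :: real assume "e > 0"
    then obtain N where "exp_tail (\<bar>t\<bar> * M) N \<le> e" using exp_tail_small by blast
    then have "mat_op_norm (mat_psum (k n) (V n) (\<mu> n) t N - uexp (k n) (V n) (\<mu> n) t) \<le> e" for n
      using mat_psum_bound[OF V, of n "\<mu> n" M t N] M by fastforce
    then show "\<exists>N. \<forall>n. mat_op_norm (mat_psum (k n) (V n) (\<mu> n) t N - uexp (k n) (V n) (\<mu> n) t) \<le> e" by blast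
  qed (rule c)
  ultimately show ?thesis unfolding carrier_Bb by blast
qed

lemma alg_exp_Q:
  assumes V: "\<And>n. unitary (k n) (V n)"
    and b: "(\<lambda>n. conj_by (V n) (rdiag (k n) (\<mu> n))) \<in> carrier Bb"
    and M: "\<And>n. \<forall>i<k n. \<bar>\<mu> n i\<bar> \<le> M" "M \<ge> 0"
  shows "alg_exp Q ((\<i> * complex_of_real t) \<odot>\<^bsub>Q\<^esub> \<pi> (\<lambda>n. conj_by (V n) (rdiag (k n) (\<mu> n)))) =
    \<pi> (\<lambda>n. uexp (k n) (V n) (\<mu> n) t)"
proof -
  let ?b = "(\<i> * complex_of_real t) \<odot>\<^bsub>Q\<^esub> \<pi> (\<lambda>n. conj_by (V n) (rdiag (k n) (\<mu> n)))"
  let ?E = "\<lambda>n. uexp (k n) (V n) (\<mu> n) t" and ?P = "\<lambda>N n. mat_psum (k n) (V n) (\<mu> n) t N"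
  note E = uexp_mem_Bb[OF V b M, of t]
  note P = psum_Q[OF V b, of t, THEN conjunct1] and P_eq = psum_Q[OF V b, of t, THEN conjunct2]
  have bd: "mat_op_norm (?P N n - ?E n) \<le> exp_tail (\<bar>t\<bar> * M) N" for N n
    by (rule mat_psum_bound[OF V]) (use M in auto)
  have pos: "exp_tail (\<bar>t\<bar> * M) N \<ge> 0" for N
    using order_trans[OF mat_op_norm_nonneg[OF minus_carrier_mat[OF Bb_C[OF E]]] bd] .
  have le: "nrm Q (psum Q ?b N \<ominus>\<^bsub>Q\<^esub> \<pi> ?E) \<le> exp_tail (\<bar>t\<bar> * M) N" for N
    unfolding P_eq pi_minus[OF P E] by (rule nrm_Q_le[OF Bb_diff[OF P E] always_eventually pos]) (intro allI bd)
  have ge: "0 \<le> nrm Q (psum Q ?b N \<ominus>\<^bsub>Q\<^esub> \<pi> ?E)" for N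
    unfolding P_eq pi_minus[OF P E] by (rule nrm_Q_nonneg[OF Bb_diff[OF P E]])
  have lim: "(\<lambda>N. nrm Q (psum Q ?b N \<ominus>\<^bsub>Q\<^esub> \<pi> ?E)) \<longlonglongrightarrow> 0"
    by (rule tendsto_sandwich[OF always_eventually always_eventually tendsto_const exp_tail_tendsto[of "\<bar>t\<bar> * M"]])
       (intro allI ge le)+
  have "psum Q ?b N \<in> carrier Q" for N unfolding P_eq by (rule pi_carrier[OF P])
  from alg_exp_eqI[OF pi_carrier[OF E] lim this nrm_Q_triangle nrm_Q_eq_0]
  show ?thesis by blast
qed

text \<open>Turns the condition in \<open>implements_flow\<close> into one on block sequences, to
  which \<open>nrm_Q_le\<close> and \<open>nrm_Q_lessD\<close> apply.\<close>

lemma Ad_Q_minus_flow: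
  assumes V: "\<And>n. unitary (k n) (V n)"
    and b: "(\<lambda>n. conj_by (V n) (rdiag (k n) (\<mu> n))) \<in> carrier Bb"
    and M: "\<And>n. \<forall>i<k n. \<bar>\<mu> n i\<bar> \<le> M" "M \<ge> 0"
    and x: "x \<in> carrier Bb"
  defines "X \<equiv> \<pi> x" and "b\<pi> \<equiv> \<pi> (\<lambda>n. conj_by (V n) (rdiag (k n) (\<mu> n)))"
  shows "(\<lambda>n. conj_by (uexp (k n) (V n) (\<mu> n) t) (x n) - \<beta> n t (x n)) \<in> carrier Bb"
    "Ad Q (alg_exp Q ((\<i> * complex_of_real t) \<odot>\<^bsub>Q\<^esub> b\<pi>)) X \<ominus>\<^bsub>Q\<^esub> coset_map Bb I (product_flow \<beta> t) X =
      \<pi> (\<lambda>n. conj_by (uexp (k n) (V n) (\<mu> n) t) (x n) - \<beta> n t (x n))"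
proof -
  let ?E = "\<lambda>n. uexp (k n) (V n) (\<mu> n) t"
  note E = uexp_mem_Bb[OF V b M, of t]
  note Ex = Bb_closed(2)[OF E x] and Es = Bb_closed(4)[OF E]
  have c: "(\<lambda>n. conj_by (?E n) (x n)) \<in> carrier Bb" unfolding conj_by_def by (rule Bb_closed(2)[OF Ex Es])
  have bx: "(\<lambda>n. \<beta> n t (x n)) \<in> carrier Bb" using Bb_beta[OF x, of t] unfolding product_flow_def .
  show "(\<lambda>n. conj_by (?E n) (x n) - \<beta> n t (x n)) \<in> carrier Bb" by (rule Bb_diff[OF c bx])
  have "Ad Q (alg_exp Q ((\<i> * complex_of_real t) \<odot>\<^bsub>Q\<^esub> b\<pi>)) X = \<pi> (\<lambda>n. conj_by (?E n) (x n))"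
    unfolding Ad_def X_def b\<pi>_def alg_exp_Q[OF V b M] pi_star[OF E] pi_mult[OF E x] pi_mult[OF Ex Es]
      conj_by_def[of "uexp (k n) (V n) (\<mu> n) t" for n] ..
  then show "Ad Q (alg_exp Q ((\<i> * complex_of_real t) \<odot>\<^bsub>Q\<^esub> b\<pi>)) X \<ominus>\<^bsub>Q\<^esub> coset_map Bb I (product_flow \<beta> t) X =
      \<pi> (\<lambda>n. conj_by (?E n) (x n) - \<beta> n t (x n))"
    unfolding X_def pi_flow[OF x] by (simp only: pi_minus[OF c bx])
qed

text \<open>The self-adjoint part of a representative differs from it by half of an element of
  \<open>I\<close>. Exact self-adjointness in each block is needed in order to diagonalise
  there.\<close>

lemma selfadjoint_lift:
  assumes "selfadjoint Q X"
  obtains b where "b \<in> carrier Bb" "X = \<pi> b" "\<And>n. mat_adjoint (b n) = b n"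
proof -
  obtain a where a: "a \<in> carrier Bb" "X = \<pi> a" and sa: "star Q X = X"
    using assms unfolding selfadjoint_def carrier_Q by blast
  note c = Bb_C[OF a(1)]
  have "\<pi> (\<lambda>n. mat_adjoint (a n)) = \<pi> a" using sa pi_star[OF a(1)] a(2) by simp
  then have d: "(\<lambda>n. mat_adjoint (a n) - a n) \<in> I" using pi_eq_iff[OF Bb_closed(4)[OF a(1)] a(1)] by simp
  define b where "b n = (1/2) \<cdot>\<^sub>m (a n + mat_adjoint (a n))" for n
  have b: "b \<in> carrier Bb" unfolding b_def by (intro Bb_closed a)
  have adj: "mat_adjoint (b n) = b n" for n
    unfolding b_def mat_adjoint_smult using c[of n] by (intro eq_matI) auto
  have "b n - a n = ((1/2) \<cdot>\<^sub>m 1\<^sub>m (k n)) * (mat_adjoint (a n) - a n)" for n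
  proof -
    have "((1/2) \<cdot>\<^sub>m 1\<^sub>m (k n)) * (mat_adjoint (a n) - a n) = (1/2) \<cdot>\<^sub>m (mat_adjoint (a n) - a n)"
      using c[of n] by (simp add: mult_smult_assoc_mat[of _ "k n" "k n" _ "k n"] left_mult_one_mat[of _ "k n" "k n"] minus_carrier_mat)
    also have "\<dots> = b n - a n"
      unfolding b_def using c[of n] by (intro eq_matI) (auto simp: field_simps)
    finally show ?thesis by simp
  qed
  then have "(\<lambda>n. b n - a n) \<in> I" using I_absorb(1)[OF d Bb_closed(3)[OF Bb_closed(6)], of "1/2"] by simp
  then have "\<pi> b = \<pi> a" using pi_eq_iff[OF b a(1)] by simp
  then show thesis using that[OF b] a(2) adj by simp
qed

end

section \<open>Bounded gap lengths imply approximate innerness\<close>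

text \<open>Both unitary groups are diagonal in the same eigenbasis, so the difference of the two
  orbits acts there entry by entry.\<close>

lemma conj_difference_kernel:
  assumes U: "unitary n U" and X: "X \<in> carrier_mat n n" and K: "K \<ge> 0"
  shows "mat_op_norm (conj_by (uexp n U \<mu> t) X - conj_by (uexp n U l s) X) \<le> K \<longleftrightarrow>
    form_bd n (\<lambda>i j. expi (t * (\<mu> i - \<mu> j)) * conj_by (mat_adjoint U) X $$ (i,j) -
      expi (s * (l i - l j)) * conj_by (mat_adjoint U) X $$ (i,j)) K"
proof -
  note Uc = unitaryD[OF U]
  let ?A = "conj_by (uexp n U \<mu> t) X" and ?B = "conj_by (uexp n U l s) X"
  have c: "?A \<in> carrier_mat n n" "?B \<in> carrier_mat n n" using Uc X by simp_all
  have d: "?A - ?B \<in> carrier_mat n n" by (rule minus_carrier_mat[OF c(2)])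
  have dU: "conj_by (mat_adjoint U) (?A - ?B) \<in> carrier_mat n n" by (rule conj_by_carrier[OF Uc(2) d])
  have "(conj_by (mat_adjoint U) (?A - ?B)) $$ (i,j) =
      expi (t * (\<mu> i - \<mu> j)) * conj_by (mat_adjoint U) X $$ (i,j) -
      expi (s * (l i - l j)) * conj_by (mat_adjoint U) X $$ (i,j)" if "i < n" "j < n" for i j
  proof -
    have cc: "conj_by (mat_adjoint U) ?A \<in> carrier_mat n n" "conj_by (mat_adjoint U) ?B \<in> carrier_mat n n"
      by (rule conj_by_carrier[OF Uc(2) c(1)], rule conj_by_carrier[OF Uc(2) c(2)])
    have "(conj_by (mat_adjoint U) (?A - ?B)) $$ (i,j) = conj_by (mat_adjoint U) ?A $$ (i,j) - conj_by (mat_adjoint U) ?B $$ (i,j)"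
      unfolding conj_by_diff[OF Uc(2) c] using cc that by (simp add: index_minus_mat)
    then show ?thesis using conj_by_uexp_index[OF U X that] by simp
  qed
  then have "form_bd n (\<lambda>i j. conj_by (mat_adjoint U) (?A - ?B) $$ (i,j)) K \<longleftrightarrow>
    form_bd n (\<lambda>i j. expi (t * (\<mu> i - \<mu> j)) * conj_by (mat_adjoint U) X $$ (i,j) -
      expi (s * (l i - l j)) * conj_by (mat_adjoint U) X $$ (i,j)) K"
    by (rule form_bd_cong)
  then show ?thesis
    using mat_op_norm_le_iff[OF dU K] conj_by_norm[OF unitary_adjoint[OF U] d] by simp
qed

text \<open>The two evolutions agree on the band matrix \<open>Z\<close>: where
  \<open>\<bar>l i - l j\<bar> < c\<close> the phases coincide, elsewhere \<open>Z\<close> is zero.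
  The rest \<open>X - Z\<close> is moved by two norm preserving evolutions, which doubles its bound,
  whatever \<open>t\<close> is.\<close>

lemma inner_approximation_of_band:
  assumes U: "unitary n U" and X: "X \<in> carrier_mat n n" and T: "T > 0" and c: "c > 0" and w: "w \<ge> 0"
    and osc: "\<And>t. t \<in> {0..T} \<Longrightarrow> mat_op_norm (conj_by (uexp n U l t) X - X) \<le> w"
    and \<mu>: "\<And>i j. i < n \<Longrightarrow> j < n \<Longrightarrow> \<bar>l i - l j\<bar> \<le> c \<Longrightarrow> \<mu> i - \<mu> j = l i - l j"
  shows "mat_op_norm (conj_by (uexp n U \<mu> t) X - conj_by (uexp n U l t) X) \<le> 2 * (2 * w + 6 / c\<^sup>2 * (2 * w / T\<^sup>2))"
proof -
  define a where "a i j = conj_by (mat_adjoint U) X $$ (i,j)" for i j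
  have X0: "conj_by (uexp n U l 0) X = X"
    unfolding uexp_zero[OF U] conj_by_def using X by (simp add: left_mult_one_mat[of _ n n] right_mult_one_mat[of _ n n])
  have "form_bd n (\<lambda>i j. (expi (t * (l i - l j)) - 1) * a i j) w" if t: "t \<in> {0..T}" for t
    using osc[OF t] conj_difference_kernel[OF U X w, of l t l 0] unfolding X0 a_def by (simp add: left_diff_distrib)
  from band_limited_approximation[OF T c w this] obtain Z where
    Z: "\<And>i j. \<bar>l i - l j\<bar> \<ge> c \<Longrightarrow> Z i j = 0"
    and aZ: "form_bd n (\<lambda>i j. a i j - Z i j) (2 * w + 6 / c\<^sup>2 * (2 * w / T\<^sup>2))" by blast
  let ?K = "2 * w + 6 / c\<^sup>2 * (2 * w / T\<^sup>2)"
  have K: "?K \<ge> 0" using w by simp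
  have "form_bd n (\<lambda>i j. expi (t * (\<mu> i - \<mu> j)) * (a i j - Z i j) -
      expi (t * (l i - l j)) * (a i j - Z i j)) (?K + ?K)"
    by (intro form_bd_diff unimodular_diff_multiplier aZ K)
  moreover have "expi (t * (\<mu> i - \<mu> j)) * (a i j - Z i j) -
      expi (t * (l i - l j)) * (a i j - Z i j) =
      expi (t * (\<mu> i - \<mu> j)) * a i j - expi (t * (l i - l j)) * a i j"
    if "i < n" "j < n" for i j
  proof (cases "\<bar>l i - l j\<bar> \<ge> c")
    case True
    then show ?thesis using Z by simp
  next
    case False
    then have "\<mu> i - \<mu> j = l i - l j" using \<mu>[OF that] by simp
    then show ?thesis by simp
  qed
  ultimately have "form_bd n (\<lambda>i j. expi (t * (\<mu> i - \<mu> j)) * a i j -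
      expi (t * (l i - l j)) * a i j) (?K + ?K)"
    using form_bd_cong[of n "\<lambda>i j. expi (t * (\<mu> i - \<mu> j)) * (a i j - Z i j) -
      expi (t * (l i - l j)) * (a i j - Z i j)"] by simp
  then have "mat_op_norm (conj_by (uexp n U \<mu> t) X - conj_by (uexp n U l t) X) \<le> ?K + ?K"
    unfolding a_def by (rule conj_difference_kernel[OF U X add_nonneg_nonneg[OF K K], THEN iffD2])
  then show ?thesis by (simp only: mult_2)
qed

text \<open>Diagonal matrices in the eigenbasis commute with the group. Hence the implementing
  elements built from \<open>block_level\<close> are fixed by the flow and lie in its continuous
  part.\<close>

lemma uexp_fixes_diag:
  assumes U: "unitary n U"
  shows "conj_by (uexp n U l t) (conj_by U (diagm n f)) = conj_by U (diagm n f)"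
proof -
  note Uc = unitaryD[OF U]
  let ?e = "\<lambda>i. expi (t * l i)"
  have "conj_by (uexp n U l t) (conj_by U (diagm n f)) = conj_by U (diagm n (\<lambda>i. ?e i * f i * cnj (?e i)))"
    unfolding conj_by_def[of "uexp n U l t"] unfolding uexp_def conj_by_adjoint[OF Uc(1) diagm_carrier] diagm_adjoint
      conj_by_mult[OF U diagm_carrier diagm_carrier] diagm_mult ..
  also have "diagm n (\<lambda>i. ?e i * f i * cnj (?e i)) = diagm n f"
  proof (rule diagm_cong)
    fix i
    have "?e i * f i * cnj (?e i) = (?e i * cnj (?e i)) * f i" by (simp only: mult_ac)
    then show "?e i * f i * cnj (?e i) = f i" unfolding exp_ii_cnj_mult by simp
  qed
  finally show ?thesis .
qed

context block_flow
begin

abbreviation "H n \<equiv> conj_by (U n) (rdiag (k n) (l n))"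

lemma spectrum_H: "real_spectrum (H n) = l n ` {..<k n}"
  by (rule real_spectrum_diag[OF U])

lemma ell_H:
  assumes "k n > 0" "c > 0"
  shows "\<exists>a b. a \<le> b \<and> {a..b} \<subseteq> thicken (l n ` {..<k n}) c \<and> ell (H n) c = b - a - c"
    "\<And>a b. a \<le> b \<Longrightarrow> {a..b} \<subseteq> thicken (l n ` {..<k n}) c \<Longrightarrow> b - a - c \<le> ell (H n) c"
proof -
  have S: "finite (real_spectrum (H n))" "real_spectrum (H n) \<noteq> {}"
    unfolding spectrum_H using assms(1) by auto
  show "\<exists>a b. a \<le> b \<and> {a..b} \<subseteq> thicken (l n ` {..<k n}) c \<and> ell (H n) c = b - a - c"
    by (rule ell_greatest(1)[OF S assms(2), unfolded spectrum_H])
  show "\<And>a b. a \<le> b \<Longrightarrow> {a..b} \<subseteq> thicken (l n ` {..<k n}) c \<Longrightarrow> b - a - c \<le> ell (H n) c"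
    by (rule ell_greatest(2)[OF S assms(2), unfolded spectrum_H])
qed

lemma ell_H_nonneg:
  assumes "k n > 0" "c > 0"
  shows "ell (H n) c \<ge> 0"
proof -
  have "{l n 0..l n 0 + c} \<subseteq> thicken (l n ` {..<k n}) c"
    by (rule thicken_interval) (use assms in auto)
  then show ?thesis using ell_H(2)[OF assms, of "l n 0" "l n 0 + c"] assms by simp
qed

definition block_level :: "real \<Rightarrow> nat \<Rightarrow> nat \<Rightarrow> real" where
  "block_level c n i = l n i - component_start (l n ` {..<k n}) c (l n i)"

text \<open>The interval from the start of the component to \<open>l n i + c\<close> is covered, so
  \<open>ell\<close> bounds its length minus \<open>c\<close>, and this is the level.\<close>

lemma block_level_bound:
  assumes c: "c > 0" and i: "i < k n"
  shows "0 \<le> block_level c n i \<and> block_level c n i \<le> ell (H n) c"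
proof -
  have fin: "finite (l n ` {..<k n})" and mem: "l n i \<in> l n ` {..<k n}" using i by auto
  note cs = component_start[OF fin mem c]
  have "k n > 0" using i by simp
  from ell_H(2)[OF this c, of "component_start (l n ` {..<k n}) c (l n i)" "l n i + c"] cs c
  show ?thesis unfolding block_level_def by simp
qed

lemma block_level_diff:
  assumes "c > 0" "i < k n" "j < k n" "\<bar>l n i - l n j\<bar> \<le> c"
  shows "block_level c n i - block_level c n j = l n i - l n j"
proof -
  have "component_start (l n ` {..<k n}) c (l n i) = component_start (l n ` {..<k n}) c (l n j)"
    by (rule component_start_eq) (use assms in auto)
  then show ?thesis unfolding block_level_def by simp
qed

theorem approximately_inner_if_ell_bounded:
  assumes k_pos: "\<And>n. k n > 0" and ell: "\<And>c. c > 0 \<Longrightarrow> Bseq (\<lambda>n. ell (H n) c)"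
  shows "approximately_inner Q (\<lambda>t. coset_map Bb I (product_flow \<beta> t))"
proof -
  define b where "b c n = conj_by (U n) (rdiag (k n) (block_level c n))" for c n
  have bc: "b c n \<in> C n" for c n unfolding b_def using unitaryD(1)[OF U] by simp
  have bd: "\<exists>M\<ge>0. \<forall>n. \<forall>i<k n. \<bar>block_level c n i\<bar> \<le> M" if c: "c > 0" for c
  proof -
    obtain K where K: "K > 0" "\<And>n. \<bar>ell (H n) c\<bar> \<le> K" using ell[OF c] unfolding Bseq_def by auto
    have "\<bar>block_level c n i\<bar> \<le> K" if "i < k n" for n i
      using block_level_bound[OF c that] K(2)[of n] by auto
    then show ?thesis using K(1) by (intro exI[of _ K]) auto
  qed
  have b_mem: "b c \<in> carrier Bb" if c: "c > 0" for c
    unfolding carrier_Bb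
  proof
    obtain M where M: "M \<ge> 0" "\<forall>n. \<forall>i<k n. \<bar>block_level c n i\<bar> \<le> M" using bd[OF c] by blast
    have "mat_op_norm (b c n) \<le> M" for n
      unfolding b_def conj_by_norm[OF U diagm_carrier] using M by (intro diagm_norm_le) auto
    then show "bounded_seq (b c)" by (rule bounded_seqI[OF bc])
    show "equicont (b c)"
      by (rule equicont_fixed[OF _ bc]) (simp add: beta[OF bc], simp add: b_def uexp_fixes_diag[OF U])
  qed
  have b_adj: "mat_adjoint (b c n) = b c n" for c n
    unfolding b_def conj_by_adjoint[OF unitaryD(1)[OF U] diagm_carrier] diagm_adjoint by simp
  \<comment> \<open>The net is a sequence, with index \<open>m\<close> standing for
    \<open>c = m + 1\<close> so that \<open>c\<close> is positive. The estimate below does not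
    involve \<open>t\<close>, so the interval of times is arbitrary.\<close>
  have "implements_flow Q (\<lambda>t. coset_map Bb I (product_flow \<beta> t)) UNIV (\<le>) (\<lambda>m :: nat. \<pi> (b (real m + 1)))"
    unfolding implements_flow_def
  proof (intro conjI ballI allI impI)
    show "directed (UNIV :: nat set) (\<le>)"
      unfolding directed_def by (auto intro: max.cobounded1 max.cobounded2)
    fix m :: nat
    have m: "b (real m + 1) \<in> carrier Bb" by (rule b_mem) simp
    show "selfadjoint Q (\<pi> (b (real m + 1)))"
      unfolding selfadjoint_def pi_star[OF m] b_adj using pi_carrier[OF m] by simp
  next
    fix X and s0 s1 \<epsilon> :: real assume X: "X \<in> carrier Q" and \<epsilon>: "\<epsilon> > 0"
    then obtain x where x: "x \<in> carrier Bb" "X = \<pi> x" unfolding carrier_Q by blast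
    have xe: "equicont x" using x(1) unfolding carrier_Bb by blast
    \<comment> \<open>Chosen so that \<open>2 * (2 * w + \<epsilon> / 8) = \<epsilon> / 2\<close>;
      the second summand is made small through \<open>c\<close>.\<close>
    define w where "w = \<epsilon> / 16"
    have w: "w > 0" unfolding w_def using \<epsilon> by simp
    obtain d where d: "d > 0" "\<And>t n. \<bar>t\<bar> < d \<Longrightarrow> mat_op_norm (\<beta> n t (x n) - x n) \<le> w"
      using equicontE[OF xe w] by blast
    define T where "T = d / 2"
    have T: "T > 0" "T < d" unfolding T_def using d by auto
    \<comment> \<open>With \<open>c \<ge> 1\<close> and \<open>c \<ge> m0\<close> also
      \<open>c\<^sup>2 \<ge> m0\<close>, which brings the term with \<open>6 / c\<^sup>2\<close>
      below \<open>\<epsilon> / 8\<close>.\<close>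
    obtain m0 :: nat where m0: "6 * (2 * w / T\<^sup>2) / (\<epsilon> / 8) \<le> real m0" using real_arch_simple by blast
    have main: "nrm Q (Ad Q (alg_exp Q ((\<i> * complex_of_real t) \<odot>\<^bsub>Q\<^esub> \<pi> (b (real m + 1)))) X
        \<ominus>\<^bsub>Q\<^esub> coset_map Bb I (product_flow \<beta> t) X) < \<epsilon>" if m: "m0 \<le> m" for m t
    proof -
      define c where "c = real m + 1"
      have c: "c > 0" "c \<ge> 1" unfolding c_def by auto
      have "6 * (2 * w / T\<^sup>2) = 6 * (2 * w / T\<^sup>2) / (\<epsilon> / 8) * (\<epsilon> / 8)" using \<epsilon> by simp
      also have "\<dots> \<le> real m0 * (\<epsilon> / 8)" by (rule mult_right_mono[OF m0]) (use \<epsilon> in simp)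
      also have "\<dots> \<le> (\<epsilon> / 8) * c\<^sup>2"
      proof (subst mult.commute, rule mult_left_mono)
        have "real m0 \<le> c" using m unfolding c_def by simp
        also have "c \<le> c\<^sup>2" using c by (simp add: power2_eq_square)
        finally show "real m0 \<le> c\<^sup>2" .
      qed (use \<epsilon> in simp)
      finally have "6 * (2 * w / T\<^sup>2) / c\<^sup>2 \<le> \<epsilon> / 8"
        by (subst pos_divide_le_eq) (use c in simp_all)
      then have small: "6 / c\<^sup>2 * (2 * w / T\<^sup>2) \<le> \<epsilon> / 8" by (simp only: times_divide_eq_left)
      obtain M where M: "M \<ge> 0" and "\<forall>n. \<forall>i<k n. \<bar>block_level c n i\<bar> \<le> M" using bd[OF c(1)] by blast
      then have M': "\<forall>i<k n. \<bar>block_level c n i\<bar> \<le> M" for n by blast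
      note bm = b_mem[OF c(1), unfolded b_def]
      note ad = Ad_Q_minus_flow[OF U bm M' M x(1), where t = t]
      have osc: "mat_op_norm (conj_by (uexp (k n) (U n) (l n) s) (x n) - x n) \<le> w" if "s \<in> {0..T}" for n s
        using d(2)[of s n] that T beta[OF Bb_C[OF x(1)]] by auto
      have "mat_op_norm (conj_by (uexp (k n) (U n) (block_level c n) t) (x n) - \<beta> n t (x n)) \<le> \<epsilon> / 2" for n
      proof -
        have "mat_op_norm (conj_by (uexp (k n) (U n) (block_level c n) t) (x n) - conj_by (uexp (k n) (U n) (l n) t) (x n)) \<le>
            2 * (2 * w + 6 / c\<^sup>2 * (2 * w / T\<^sup>2))"
          using w by (intro inner_approximation_of_band[OF U Bb_C[OF x(1)] T(1) c(1) _ osc] block_level_diff c) auto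
        also have "\<dots> \<le> 2 * (2 * w + \<epsilon> / 8)" using small by simp
        also have "\<dots> = \<epsilon> / 2" unfolding w_def by simp
        finally show ?thesis unfolding beta[OF Bb_C[OF x(1)]] .
      qed
      then have "nrm Q (\<pi> (\<lambda>n. conj_by (uexp (k n) (U n) (block_level c n) t) (x n) - \<beta> n t (x n))) \<le> \<epsilon> / 2"
        using \<epsilon> by (intro nrm_Q_le ad(1) always_eventually allI) auto
      then show ?thesis using \<epsilon> unfolding x(2) c_def[symmetric] b_def ad(2) by simp
    qed
    then show "\<exists>m0\<in>UNIV. \<forall>m\<in>UNIV. m0 \<le> m \<longrightarrow> (\<forall>t\<in>{s0..s1}.
        nrm Q (Ad Q (alg_exp Q ((\<i> * complex_of_real t) \<odot>\<^bsub>Q\<^esub> \<pi> (b (real m + 1)))) X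
        \<ominus>\<^bsub>Q\<^esub> coset_map Bb I (product_flow \<beta> t) X) < \<epsilon>)" by blast
  qed
  then show ?thesis by (rule approximately_inner_any_net)
qed

end

section \<open>Approximate innerness implies bounded gap lengths\<close>

lemma inj_on_of_increasing:
  fixes x :: "nat \<Rightarrow> real"
  assumes "\<And>i. i < N \<Longrightarrow> x i < x (Suc i)" and \<sigma>: "\<And>i. i \<le> N \<Longrightarrow> f (\<sigma> i) = x i"
  shows "inj_on \<sigma> {..N}"
proof (rule inj_onI)
  have less: "x i < x (i + Suc d)" if "i + Suc d \<le> N" for i d
    using that
  proof (induction d)
    case 0
    then show ?case using assms(1)[of i] by simp
  next
    case (Suc d)
    then have "x i < x (i + Suc d)" by simp
    also have "\<dots> < x (Suc (i + Suc d))" using Suc by (intro assms(1)) simp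
    finally show ?case by simp
  qed
  have lt: "x i < x j" if "i < j" "j \<le> N" for i j
    using less[of i "j - i - 1"] that by simp
  fix i j assume ij: "i \<in> {..N}" "j \<in> {..N}" "\<sigma> i = \<sigma> j"
  then have "x i = x j" using \<sigma>[of i] \<sigma>[of j] by simp
  then show "i = j" using lt[of i j] lt[of j i] ij by (cases i j rule: linorder_cases) auto
qed

text \<open>Only the gaps along the chain enter the phases, not the eigenvalues themselves. So
  shifts with bounded gaps have equicontinuous orbits and form an element of the continuous part,
  however large the spectra are.\<close>

lemma shift_orbit_lipschitz:
  assumes U: "unitary n U" and inj: "inj_on \<sigma> {..N}" and G: "G \<ge> 0"
    and gap: "\<And>k. k < N \<Longrightarrow> \<bar>l (\<sigma> (Suc k)) - l (\<sigma> k)\<bar> \<le> G"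
  shows "mat_op_norm (conj_by (uexp n U l t) (conj_by U (shift_mat n N \<sigma>)) - conj_by (uexp n U l s) (conj_by U (shift_mat n N \<sigma>))) \<le> \<bar>t - s\<bar> * G"
proof -
  let ?S = "conj_by U (shift_mat n N \<sigma>)"
  have S: "?S \<in> carrier_mat n n" using unitaryD[OF U] by simp
  have US: "conj_by (mat_adjoint U) ?S = shift_mat n N \<sigma>" by (rule conj_by_adjoint_cancel(1)[OF U shift_mat_carrier])
  have "form_bd n (\<lambda>i j. if shift_rel N \<sigma> i j then expi (t * (l i - l j)) - expi (s * (l i - l j)) else 0) (\<bar>t - s\<bar> * G)"
  proof (rule weighted_shift_bd[OF inj])
    fix i j assume "shift_rel N \<sigma> i j"
    then obtain k where k: "k < N" "i = \<sigma> (Suc k)" "j = \<sigma> k" by (rule shift_relE)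
    have "cmod (expi (t * (l i - l j)) - expi (s * (l i - l j))) \<le> \<bar>t * (l i - l j) - s * (l i - l j)\<bar>"
      by (rule cmod_exp_ii_diff_le)
    also have "\<dots> = \<bar>t - s\<bar> * \<bar>l i - l j\<bar>" by (simp only: left_diff_distrib[symmetric] abs_mult)
    also have "\<dots> \<le> \<bar>t - s\<bar> * G" using gap[OF k(1)] unfolding k by (intro mult_left_mono) auto
    finally show "cmod (expi (t * (l i - l j)) - expi (s * (l i - l j))) \<le> \<bar>t - s\<bar> * G" .
  qed (use G in simp)
  moreover have "expi (t * (l i - l j)) * shift_mat n N \<sigma> $$ (i,j) - expi (s * (l i - l j)) * shift_mat n N \<sigma> $$ (i,j) =
      (if shift_rel N \<sigma> i j then expi (t * (l i - l j)) - expi (s * (l i - l j)) else 0)"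
    if "i < n" "j < n" for i j using that by (simp add: shift_mat_index)
  ultimately have "form_bd n (\<lambda>i j. expi (t * (l i - l j)) * shift_mat n N \<sigma> $$ (i,j) -
      expi (s * (l i - l j)) * shift_mat n N \<sigma> $$ (i,j)) (\<bar>t - s\<bar> * G)"
    using form_bd_cong[of n "\<lambda>i j. expi (t * (l i - l j)) * shift_mat n N \<sigma> $$ (i,j) -
      expi (s * (l i - l j)) * shift_mat n N \<sigma> $$ (i,j)"] by simp
  then show ?thesis using conj_difference_kernel[OF U S, of "\<bar>t - s\<bar> * G" l t l s] G unfolding US by simp
qed

context block_flow
begin

lemma long_chain:
  assumes kn: "k n > 0" and c: "c > 0"
  shows "\<exists>N \<sigma>. inj_on \<sigma> {..N} \<and> \<sigma> ` {..N} \<subseteq> {..<k n} \<and>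
    (\<forall>r<N. 24 * c \<le> l n (\<sigma> (Suc r)) - l n (\<sigma> r) \<and> l n (\<sigma> (Suc r)) - l n (\<sigma> r) \<le> 25 * c) \<and>
    ell (H n) c \<le> (real N + 1) * (25 * c)"
proof -
  let ?S = "l n ` {..<k n}"
  obtain a b where ab: "a \<le> b" "{a..b} \<subseteq> thicken ?S c" "ell (H n) c = b - a - c" using ell_H(1)[OF kn c] by blast
  \<comment> \<open>The number of steps of length \<open>25 * c\<close> that fit into the interval.
    Rounding down loses less than one step, hence the \<open>N + 1\<close> in the bound for
    \<open>ell\<close>.\<close>
  define N where "N = nat \<lfloor>(b - a) / (25 * c)\<rfloor>"
  have q: "0 \<le> (b - a) / (25 * c)" using ab c by simp
  have N: "real N \<le> (b - a) / (25 * c)" "(b - a) / (25 * c) \<le> real N + 1"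
    unfolding N_def using q of_nat_floor[OF q] by linarith+
  have "a + real N * (24 * c + c) \<le> b" using N(1) c by (simp add: field_simps)
  from thicken_chain[OF ab(2) c _ this] obtain x :: "nat \<Rightarrow> real" where
    x: "\<And>r. r \<le> N \<Longrightarrow> x r \<in> ?S" and gap: "\<And>r. r < N \<Longrightarrow> 24 * c \<le> x (Suc r) - x r \<and> x (Suc r) - x r \<le> 24 * c + c"
    using c by auto
  have "\<forall>r. \<exists>i. r \<le> N \<longrightarrow> i < k n \<and> l n i = x r" using x by (force simp: image_iff)
  then obtain \<sigma> where \<sigma>: "\<And>r. r \<le> N \<Longrightarrow> \<sigma> r < k n \<and> l n (\<sigma> r) = x r" by metis
  have "x r < x (Suc r)" if "r < N" for r using gap[OF that] c by linarith
  then have "inj_on \<sigma> {..N}" by (rule inj_on_of_increasing[where f = "l n"]) (use \<sigma> in auto)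
  moreover have "\<sigma> ` {..N} \<subseteq> {..<k n}" using \<sigma> by auto
  moreover have "24 * c \<le> l n (\<sigma> (Suc r)) - l n (\<sigma> r) \<and> l n (\<sigma> (Suc r)) - l n (\<sigma> r) \<le> 25 * c" if "r < N" for r
    using gap[OF that] \<sigma>[of r] \<sigma>[of "Suc r"] that by simp
  moreover have "ell (H n) c \<le> (real N + 1) * (25 * c)"
    using N(2) c unfolding ab(3) by (simp add: pos_divide_le_eq)
  ultimately show ?thesis by blast
qed

theorem ell_bounded_if_approximately_inner:
  assumes k_pos: "\<And>n. k n > 0" and c: "c > 0"
    and inner: "approximately_inner Q (\<lambda>t. coset_map Bb I (product_flow \<beta> t))"
  shows "Bseq (\<lambda>n. ell (H n) c)"
proof -
  have "\<forall>n. \<exists>N \<sigma>. inj_on \<sigma> {..N} \<and> \<sigma> ` {..N} \<subseteq> {..<k n} \<and>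
    (\<forall>r<N. 24 * c \<le> l n (\<sigma> (Suc r)) - l n (\<sigma> r) \<and> l n (\<sigma> (Suc r)) - l n (\<sigma> r) \<le> 25 * c) \<and>
    ell (H n) c \<le> (real N + 1) * (25 * c)" using long_chain[OF k_pos c] by blast
  then obtain N \<sigma> where inj: "\<And>n. inj_on (\<sigma> n) {..N n}" and sub: "\<And>n. \<sigma> n ` {..N n} \<subseteq> {..<k n}"
    and gap: "\<And>n r. r < N n \<Longrightarrow> 24 * c \<le> l n (\<sigma> n (Suc r)) - l n (\<sigma> n r) \<and> l n (\<sigma> n (Suc r)) - l n (\<sigma> n r) \<le> 25 * c"
    and ell: "\<And>n. ell (H n) c \<le> (real (N n) + 1) * (25 * c)" by metis
  define S where "S n = conj_by (U n) (shift_mat (k n) (N n) (\<sigma> n))" for n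
  have Sc: "S n \<in> C n" for n unfolding S_def using unitaryD(1)[OF U] by simp
  have S_lip: "mat_op_norm (conj_by (uexp (k n) (U n) (l n) t) (S n) - conj_by (uexp (k n) (U n) (l n) s) (S n)) \<le> \<bar>t - s\<bar> * (25 * c)" for n t s
    unfolding S_def by (rule shift_orbit_lipschitz[OF U inj]) (use c gap in \<open>auto simp: abs_if dest: gap\<close>)
  have S_norm: "mat_op_norm (S n) \<le> 1" for n
    unfolding S_def conj_by_norm[OF U shift_mat_carrier] by (rule shift_mat_norm[OF inj])
  have "equicont S"
  proof (rule equicontI)
    fix e :: real assume e: "e > 0"
    have "mat_op_norm (\<beta> n t (S n) - S n) \<le> e" if t: "\<bar>t\<bar> < e / (25 * c)" for t n
    proof -
      have "mat_op_norm (\<beta> n t (S n) - \<beta> n 0 (S n)) \<le> \<bar>t - 0\<bar> * (25 * c)" unfolding beta[OF Sc] by (rule S_lip)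
      also have "\<dots> \<le> e" using t c by (simp add: field_simps)
      finally show ?thesis unfolding beta_0[OF Sc] .
    qed
    then show "\<exists>d>0. \<forall>t. \<bar>t\<bar> < d \<longrightarrow> (\<forall>n. mat_op_norm (\<beta> n t (S n) - S n) \<le> e)"
      using e c by (intro exI[of _ "e / (25 * c)"]) simp
  qed
  then have S: "S \<in> carrier Bb" unfolding carrier_Bb using bounded_seqI[OF Sc S_norm] by blast
  \<comment> \<open>The range of times on which \<open>chain_length_bound\<close> compares the two
    orbits of the shift.\<close>
  define T where "T = 1 / (24 * c)"
  have T: "T > 0" unfolding T_def using c by simp
  obtain D :: "((nat \<Rightarrow> complex mat) set set \<times> (nat \<Rightarrow> complex mat) set) set" and R bb
    where impl: "implements_flow Q (\<lambda>t. coset_map Bb I (product_flow \<beta> t)) D R bb"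
    using inner unfolding approximately_inner_def by blast
  \<comment> \<open>A single member of the net is used, with one test element and one fixed
    tolerance. Its norm then bounds all chains.\<close>
  have "\<exists>\<nu>\<^sub>0\<in>D. \<forall>\<nu>\<in>D. R \<nu>\<^sub>0 \<nu> \<longrightarrow> (\<forall>t\<in>{0..T}.
      nrm Q (Ad Q (alg_exp Q ((\<i> * complex_of_real t) \<odot>\<^bsub>Q\<^esub> bb \<nu>)) (\<pi> S) \<ominus>\<^bsub>Q\<^esub> coset_map Bb I (product_flow \<beta> t) (\<pi> S)) < 1 / 100)"
  proof -
    have "0 < (1 / 100 :: real)" by simp
    then show ?thesis using impl pi_carrier[OF S] unfolding implements_flow_def by blast
  qed
  then obtain \<nu> where \<nu>: "\<nu> \<in> D" and step: "\<forall>\<nu>'\<in>D. R \<nu> \<nu>' \<longrightarrow> (\<forall>t\<in>{0..T}.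
      nrm Q (Ad Q (alg_exp Q ((\<i> * complex_of_real t) \<odot>\<^bsub>Q\<^esub> bb \<nu>')) (\<pi> S) \<ominus>\<^bsub>Q\<^esub> coset_map Bb I (product_flow \<beta> t) (\<pi> S)) < 1 / 100)"
    by (rule bexE)
  have "directed D R" using impl unfolding implements_flow_def by (rule conjunct1)
  then have "R \<nu> \<nu>" using \<nu> unfolding directed_def by simp
  with step \<nu> have near: "\<And>t. t \<in> {0..T} \<Longrightarrow>
      nrm Q (Ad Q (alg_exp Q ((\<i> * complex_of_real t) \<odot>\<^bsub>Q\<^esub> bb \<nu>)) (\<pi> S) \<ominus>\<^bsub>Q\<^esub> coset_map Bb I (product_flow \<beta> t) (\<pi> S)) < 1 / 100"
    by blast
  have "selfadjoint Q (bb \<nu>)" using impl \<nu> unfolding implements_flow_def by blast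
  then obtain b where b: "b \<in> carrier Bb" "bb \<nu> = \<pi> b" "\<And>n. mat_adjoint (b n) = b n" by (rule selfadjoint_lift) blast
  have "\<forall>n. \<exists>V \<mu>. unitary (k n) V \<and> b n = conj_by V (rdiag (k n) \<mu>)"
    using hermitian_diagonalisation[OF Bb_C[OF b(1)] b(3)] by blast
  then obtain V \<mu> where V: "\<And>n. unitary (k n) (V n)" and bV: "\<And>n. b n = conj_by (V n) (rdiag (k n) (\<mu> n))"
    by metis
  have b_eq: "b = (\<lambda>n. conj_by (V n) (rdiag (k n) (\<mu> n)))" by (rule ext) (rule bV)
  have bm: "(\<lambda>n. conj_by (V n) (rdiag (k n) (\<mu> n))) \<in> carrier Bb"
    using b(1) unfolding b_eq .
  have "bounded_seq b" using b(1) unfolding carrier_Bb by blast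
  then obtain M where M0: "M > 0" and bM: "\<And>n. mat_op_norm (b n) \<le> M" by (rule bounded_seqE) blast
  have M: "\<bar>\<mu> n i\<bar> \<le> M" if "i < k n" for n i
  proof -
    have "\<bar>\<mu> n i\<bar> = cmod (rdiag (k n) (\<mu> n) $$ (i,i))" using that by simp
    also have "\<dots> \<le> mat_op_norm (rdiag (k n) (\<mu> n))"
      by (rule entry_le_mat_op_norm[OF diagm_carrier that that])
    also have "\<dots> = mat_op_norm (b n)" unfolding bV conj_by_norm[OF V diagm_carrier] ..
    finally show ?thesis using bM[of n] by simp
  qed
  have "\<forall>i<k n. \<bar>\<mu> n i\<bar> \<le> M" for n using M by blast
  note ad = Ad_Q_minus_flow[OF V bm this less_imp_le[OF M0] S]
  define f where "f n t = conj_by (uexp (k n) (V n) (\<mu> n) t) (S n) - conj_by (uexp (k n) (U n) (l n) t) (S n)" for n t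
  have f: "f n t \<in> C n" for n t unfolding f_def using unitaryD(1)[OF U] unitaryD(1)[OF V] Sc by (simp add: minus_carrier_mat)
  \<comment> \<open>The blocks excluded here depend on \<open>t\<close>, so this cannot be used for
    all \<open>t\<close> at once.\<close>
  have pointwise: "\<forall>\<^sub>F n in sequentially. mat_op_norm (f n t) < 1 / 100" if t: "t \<in> {0..T}" for t
  proof -
    have "nrm Q (\<pi> (\<lambda>n. conj_by (uexp (k n) (V n) (\<mu> n) t) (S n) - \<beta> n t (S n))) < 1 / 100"
      using near[OF t] unfolding b(2) b_eq ad(2) .
    then have "\<forall>\<^sub>F n in sequentially. mat_op_norm (conj_by (uexp (k n) (V n) (\<mu> n) t) (S n) - \<beta> n t (S n)) < 1 / 100"
      by (rule nrm_Q_lessD[OF ad(1)])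
    then show ?thesis unfolding f_def beta[OF Sc] .
  qed
  \<comment> \<open>A Lipschitz constant valid in every block: \<open>2 * M\<close> for the orbit
    under \<open>b\<close>, and \<open>25 * c\<close>, the largest gap, for the orbit under the
    flow.\<close>
  define \<Lambda> where "\<Lambda> = 2 * M + 25 * c"
  have \<Lambda>: "\<Lambda> > 0" unfolding \<Lambda>_def using M0 c by simp
  have lip: "mat_op_norm (f n t) \<le> mat_op_norm (f n s) + \<bar>t - s\<bar> * \<Lambda>" for n t s
  proof -
    let ?A = "\<lambda>t. conj_by (uexp (k n) (V n) (\<mu> n) t) (S n)" and ?B = "\<lambda>t. conj_by (uexp (k n) (U n) (l n) t) (S n)"
    have A: "?A t \<in> C n" and B: "?B t \<in> C n" for t using unitaryD(1)[OF U] unitaryD(1)[OF V] Sc by simp_all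
    have "mat_op_norm (?A t - ?A s) \<le> 2 * mat_op_norm (uexp (k n) (V n) (\<mu> n) t - uexp (k n) (V n) (\<mu> n) s) * mat_op_norm (S n)"
      by (rule conj_by_diff_norm[OF uexp_unitary[OF V] uexp_unitary[OF V] Sc])
    also have "\<dots> \<le> 2 * (\<bar>t - s\<bar> * M) * 1"
    proof -
      have "mat_op_norm (uexp (k n) (V n) (\<mu> n) t - uexp (k n) (V n) (\<mu> n) s) \<le> \<bar>t - s\<bar> * M"
        by (rule uexp_diff_norm[OF V]) (use M M0 in auto)
      moreover have "0 \<le> mat_op_norm (uexp (k n) (V n) (\<mu> n) t - uexp (k n) (V n) (\<mu> n) s)"
        by (intro mat_op_norm_nonneg[of _ "k n"] minus_carrier_mat uexp_carrier unitaryD(1)[OF V])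
      ultimately show ?thesis using S_norm[of n] mat_op_norm_nonneg[OF Sc[of n]] M0 by (intro mult_mono) auto
    qed
    finally have 1: "mat_op_norm (?A t - ?A s) \<le> \<bar>t - s\<bar> * (2 * M)" by (simp add: mult_ac)
    have 2: "mat_op_norm (?B s - ?B t) \<le> \<bar>t - s\<bar> * (25 * c)" using S_lip[of n s t] by (simp add: abs_minus_commute)
    have "mat_op_norm (?A t - ?B t) \<le> mat_op_norm (?A t - ?A s) + mat_op_norm (?A s - ?B t)"
      by (rule mat_op_norm_diff_triangle[OF A A B])
    also have "mat_op_norm (?A s - ?B t) \<le> mat_op_norm (?A s - ?B s) + mat_op_norm (?B s - ?B t)"
      by (rule mat_op_norm_diff_triangle[OF A B B])
    finally show ?thesis using 1 2 unfolding f_def \<Lambda>_def by (simp add: algebra_simps)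
  qed
  \<comment> \<open>The mesh is so fine that between grid points the norm grows by at most
    \<open>1 / 100\<close>. With the tolerance \<open>1 / 100\<close> at the grid points the total
    stays below \<open>1 / 24\<close>.\<close>
  obtain J :: nat where J: "100 * T * \<Lambda> \<le> real J" "J > 0"
  proof -
    obtain J0 :: nat where "100 * T * \<Lambda> \<le> real J0" using real_arch_simple by blast
    then show thesis using that[of "Suc J0"] by simp
  qed
  define \<delta> where "\<delta> = T / real J"
  have \<delta>: "\<delta> > 0" "\<delta> * \<Lambda> \<le> 1 / 100" unfolding \<delta>_def using T J by (simp_all add: field_simps)
  have "\<forall>\<^sub>F n in sequentially. \<forall>j\<in>{..J}. mat_op_norm (f n (real j * \<delta>)) < 1 / 100"
  proof (rule eventually_ball_finite)
    show "\<forall>j\<in>{..J}. \<forall>\<^sub>F n in sequentially. mat_op_norm (f n (real j * \<delta>)) < 1 / 100"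
    proof
      fix j assume "j \<in> {..J}"
      then have "real j * \<delta> \<le> real J * \<delta>" using \<delta> by (intro mult_right_mono) auto
      also have "\<dots> = T" unfolding \<delta>_def using J by simp
      finally show "\<forall>\<^sub>F n in sequentially. mat_op_norm (f n (real j * \<delta>)) < 1 / 100"
        using \<delta> by (intro pointwise) simp
    qed
  qed simp
  \<comment> \<open>The bound \<open>m\<close> on the chain lengths depends on \<open>M\<close> and
    \<open>c\<close> only, not on the block.\<close>
  moreover obtain m :: nat where m: "2 * M < real m * (12 * c)"
  proof -
    obtain m :: nat where m: "2 * M / (12 * c) < real m" using reals_Archimedean2 by blast
    have "2 * M < real m * (12 * c)" by (rule pos_divide_less_eq[THEN iffD1, OF _ m]) (use c in simp)
    then show thesis by (rule that)
  qed
  ultimately have "\<forall>\<^sub>F n in sequentially. norm (ell (H n) c) \<le> real m * (25 * c)"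
  proof (elim eventually_mono)
    fix n assume grid: "\<forall>j\<in>{..J}. mat_op_norm (f n (real j * \<delta>)) < 1 / 100"
    have "mat_op_norm (f n t) \<le> 1 / 24" if t: "t \<in> {0..1 / (24 * c)}" for t
    proof -
      define j where "j = nat \<lfloor>t / \<delta>\<rfloor>"
      have q: "0 \<le> t / \<delta>" using t \<delta> by simp
      have j: "real j \<le> t / \<delta>" "t / \<delta> \<le> real j + 1" unfolding j_def using q of_nat_floor[OF q] by linarith+
      have dist: "\<bar>t - real j * \<delta>\<bar> \<le> \<delta>" using j \<delta> by (simp add: field_simps abs_if)
      have "t / \<delta> \<le> T / \<delta>" using t \<delta> unfolding T_def by (intro divide_right_mono) auto
      also have "\<dots> = real J" unfolding \<delta>_def using T J by simp
      finally have "j \<le> J" using j(1) by simp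
      then have "mat_op_norm (f n (real j * \<delta>)) < 1 / 100" using grid by simp
      moreover have "\<bar>t - real j * \<delta>\<bar> * \<Lambda> \<le> \<delta> * \<Lambda>" using dist \<Lambda> by (intro mult_right_mono) auto
      ultimately show ?thesis using lip[of n t "real j * \<delta>"] \<delta>(2) by simp
    qed
    then have "N n < m"
      unfolding f_def S_def
      by (intro chain_length_bound[OF U V c inj sub gap _ M m]) auto
    then have "(real (N n) + 1) * (25 * c) \<le> real m * (25 * c)" using c by (intro mult_right_mono) auto
    then show "norm (ell (H n) c) \<le> real m * (25 * c)"
      using ell[of n] ell_H_nonneg[OF k_pos c, of n] by simp
  qed
  \<comment> \<open>A bound for almost all \<open>n\<close> suffices, since the finitely many other
    terms are real numbers.\<close>
  then show ?thesis by (rule BfunI)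
qed

end

lemma matrix_alg_Ad: "Ad (matrix_alg n) u x = conj_by u x"
  unfolding Ad_def conj_by_def by simp

theorem proposition2p3:
  fixes k :: "nat \<Rightarrow> nat"
    and \<beta> :: "nat \<Rightarrow> real \<Rightarrow> complex mat \<Rightarrow> complex mat"
    and h :: "nat \<Rightarrow> complex mat"
  defines "B \<equiv> product_alg (\<lambda>n. matrix_alg (k n))"
    and "I \<equiv> c0_direct_sum (\<lambda>n. matrix_alg (k n))"
  defines "B\<^sub>\<beta> \<equiv> continuous_part B (product_flow \<beta>)"
  assumes k_pos: "\<And>n. k n > 0"
    and flow: "\<And>n. flow (matrix_alg (k n)) (\<beta> n)"
    and h_sa: "\<And>n. selfadjoint (matrix_alg (k n)) (h n)"
    and h_gen: "\<And>n t x. x \<in> carrier (matrix_alg (k n)) \<Longrightarrow>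
       \<beta> n t x = Ad (matrix_alg (k n))
         (alg_exp (matrix_alg (k n)) ((\<i> * complex_of_real t) \<odot>\<^bsub>matrix_alg (k n)\<^esub> h n)) x"
    and h_spec: "\<And>n. real_spectrum (h n) \<inter> {..0} = {0}"
  shows "approximately_inner (quotient_alg B\<^sub>\<beta> I) (\<lambda>t. coset_map B\<^sub>\<beta> I (product_flow \<beta> t))
     \<longleftrightarrow> (\<forall>c>0. Bseq (\<lambda>n. ell (h n) c))"
proof -
  have hc: "h n \<in> carrier_mat (k n) (k n)" "mat_adjoint (h n) = h n" for n
    using h_sa[of n] unfolding selfadjoint_def by simp_all
  have "\<forall>n. \<exists>U l. unitary (k n) U \<and> h n = conj_by U (rdiag (k n) l)"
    using hermitian_diagonalisation[OF hc] by blast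
  then obtain U l where U: "\<And>n. unitary (k n) (U n)"
    and hU: "\<And>n. h n = conj_by (U n) (rdiag (k n) (l n))" by metis
  \<comment> \<open>The diagonalisations supply the spectral data of the locale, and
    \<open>matrix_alg_exp\<close> evaluates the exponentials in the hypothesis on
    \<open>\<beta>\<close>.\<close>
  have bf: "block_flow k U l \<beta>"
  proof
    show "unitary (k n) (U n)" for n by (rule U)
    fix n t and X :: "complex mat" assume "X \<in> carrier_mat (k n) (k n)"
    then have "\<beta> n t X = Ad (matrix_alg (k n))
         (alg_exp (matrix_alg (k n)) ((\<i> * complex_of_real t) \<odot>\<^bsub>matrix_alg (k n)\<^esub> h n)) X"
      by (intro h_gen) simp
    then show "\<beta> n t X = conj_by (uexp (k n) (U n) (l n) t) X"
      unfolding matrix_alg_Ad hU[of n] matrix_alg_exp[OF U] .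
  qed
  show ?thesis
    unfolding B_def I_def B\<^sub>\<beta>_def hU
  proof (intro iffI allI impI)
    fix c :: real assume "c > 0"
    then show "approximately_inner (quotient_alg (continuous_part (product_alg (\<lambda>n. matrix_alg (k n))) (product_flow \<beta>))
        (c0_direct_sum (\<lambda>n. matrix_alg (k n))))
        (\<lambda>t. coset_map (continuous_part (product_alg (\<lambda>n. matrix_alg (k n))) (product_flow \<beta>))
          (c0_direct_sum (\<lambda>n. matrix_alg (k n))) (product_flow \<beta> t)) \<Longrightarrow>
      Bseq (\<lambda>n. ell (conj_by (U n) (rdiag (k n) (l n))) c)"
      by (rule block_flow.ell_bounded_if_approximately_inner[OF bf k_pos])
  qed (rule block_flow.approximately_inner_if_ell_bounded[OF bf k_pos], simp)
qed

end
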